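(* Let $n\ge2$, let $\Omega\subset\mathbb R^n$ be a bounded domain with $\partial\Omega\in C^{1,1}$, and let $U\in L^{p,1}(\Omega)^n$ with $p>n$, $\mathrm{div}(U)=0$ in $\mathcal D'(\Omega)$ and $U\cdot\nu=0$ on $\partial\Omega$. Let $V$ be a potential on $\Omega$ whose set $K_V$ of irregular points is compact, and assume that $\mathrm{Cap}_{V,\infty}(K_V)=0$. Let $f$ be a bounded Radon measure on $\Omega$ such that $G=\mathrm{support}(f)\cap K_V$ is an isolated subset of $\mathrm{support}(f)$, i.e. there exists an open set $\omega$ such that $\omega\cap\mathrm{support}(f)=G$. If $|f|(K_V)>0$, then there is no $u\in L^1(V)\cap L^1_0(\Omega)$ such that $$\int_\Omega u(-\Delta\Phi-U\cdot\nabla\Phi+V\Phi)\,dx=\int_\Omega\Phi\,df\qquad\forall\,\Phi\in C^2_0(\overline\Omega).$$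
   Context: A potential on $\Omega$ is a measurable function $V:\Omega\to[0,+\infty]$ that is not identically zero (a.e.). For $\psi\in C^2_c(\Omega)$, $$\|\psi\|_{V,\infty}=\|\psi\|_{L^1(\Omega)}+\Big\|\frac{\nabla\psi}{\sqrt V}\Big\|_{L^\infty(\Omega)}+\Big\|\frac{\Delta\psi}{V}\Big\|_{L^\infty(\Omega)}\in[0,+\infty],$$ where a quotient is taken to be $0$ where its numerator vanishes or where $V=+\infty$, and to be $+\infty$ in absolute value where $V=0$ and the numerator is nonzero. For a compact $K\subset\Omega$, $$\mathbb B^2_K=\{\psi\in C^2_c(\Omega):\ 0\le\psi\le1,\ \psi=1\text{ in a neighborhood of }K\},\qquad \mathrm{Cap}_{V,\infty}(K)=\inf\{\|\psi\|_{V,\infty}:\ \psi\in\mathbb B^2_K\}.$$ Irregular points: $\Omega_V=\{x\in\Omega:\ \exists\,r_x>0,\ B(x;r_x)\subset\Omega,\ \|V\|_{L^{\frac n2,1}(B(x;r_x))}<+\infty\}$, an open set, and $K_V=\Omega\setminus\Omega_V$; the points of $K_V$ are called the irregular points of $V$. $C^2_0(\overline\Omega)=\{\varphi\in C^2(\overline\Omega):\ \varphi=0\text{ on }\partial\Omega\}$; with $\delta(x)=\mathrm{dist}(x;\partial\Omega)$, $L^1(V)=\{g\text{ measurable on }\Omega:\ \int_\Omega|g|V\,dx<+\infty\}$ and $L^1_0(\Omega)=\{g\in L^1(\Omega):\ \lim_{\varepsilon\to0}\frac1\varepsilon\int_{\{\delta\le\varepsilon\}}|g|\,dx=0\}$.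 Bounded Radon measures are signed, and $|f|$ is the total variation measure of $f$. For a function $u$ to satisfy the equation it is understood that the integrals make sense, i.e. $u|U|\in L^1(\Omega)$. The conditions $\mathrm{div}(U)=0$ and $U\cdot\nu=0$ on $\partial\Omega$ ($\nu$ the exterior normal) are understood in the weak sense: $\int_\Omega U\cdot\nabla\varphi\,dx=0$ for all $\varphi\in C^1(\overline\Omega)$. Lorentz spaces: with $|u|_*(s)=\inf\{t:\ |\{|u|>t\}|\le s\}$ and $|u|_{**}(t)=\frac1t\int_0^t|u|_*(\sigma)\,d\sigma$, for $1\le p<+\infty$, $L^{p,1}(\Omega)$ is the set of measurable $u$ with $\frac1{|\Omega|}\int_0^{|\Omega|}t^{1/p}|u|_{**}(t)\frac{dt}t<+\infty$ (similarly on balls). *)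

theory Defs
  imports "HOL-Probability.Essential_Supremum"
begin

section \<open>Differentiable functions\<close>

text \<open>All of the following is used for open sets only, so that the derivatives at the points of
  the set depend only on the values of the function on the set.\<close>

definition partial :: "'n \<Rightarrow> (real ^ 'n \<Rightarrow> real) \<Rightarrow> real ^ 'n \<Rightarrow> real" where
  "partial i f x = frechet_derivative f (at x) (axis i 1)"

definition grad :: "(real ^ 'n \<Rightarrow> real) \<Rightarrow> real ^ 'n \<Rightarrow> real ^ 'n" where
  "grad f x = (\<chi> i. partial i f x)"

definition laplacian :: "(real ^ 'n \<Rightarrow> real) \<Rightarrow> real ^ 'n \<Rightarrow> real" where
  "laplacian f x = (\<Sum>i\<in>UNIV. partial i (partial i f) x)"

definition C1_on :: "(real ^ 'n) set \<Rightarrow> (real ^ 'n \<Rightarrow> real) \<Rightarrow> bool" where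
  "C1_on S f \<longleftrightarrow> (\<forall>x\<in>S. f differentiable (at x)) \<and> (\<forall>i. continuous_on S (partial i f))"

definition C2_on :: "(real ^ 'n) set \<Rightarrow> (real ^ 'n \<Rightarrow> real) \<Rightarrow> bool" where
  "C2_on S f \<longleftrightarrow> C1_on S f \<and> (\<forall>i. C1_on S (partial i f))"

definition extends_to_closure :: "(real ^ 'n) set \<Rightarrow> (real ^ 'n \<Rightarrow> real) \<Rightarrow> bool" where
  "extends_to_closure S f \<longleftrightarrow> (\<exists>g. continuous_on (closure S) g \<and> (\<forall>x\<in>S. g x = f x))"

definition C1_closure :: "(real ^ 'n) set \<Rightarrow> (real ^ 'n \<Rightarrow> real) \<Rightarrow> bool" where
  "C1_closure S f \<longleftrightarrow> C1_on S f \<and> continuous_on (closure S) f \<and>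
     (\<forall>i. extends_to_closure S (partial i f))"

definition C2_closure :: "(real ^ 'n) set \<Rightarrow> (real ^ 'n \<Rightarrow> real) \<Rightarrow> bool" where
  "C2_closure S f \<longleftrightarrow> C2_on S f \<and> C1_closure S f \<and>
     (\<forall>i j. extends_to_closure S (partial j (partial i f)))"

definition C2_zero :: "(real ^ 'n) set \<Rightarrow> (real ^ 'n \<Rightarrow> real) set" where
  "C2_zero S = {f. C2_closure S f \<and> (\<forall>x\<in>frontier S. f x = 0)}"

text \<open>Only the restriction to \<open>S\<close> matters; values outside \<open>S\<close> are junk.\<close>

definition C2_compact :: "(real ^ 'n) set \<Rightarrow> (real ^ 'n \<Rightarrow> real) set" where
  "C2_compact S = {f. C2_on S f \<and> (\<exists>K. compact K \<and> K \<subseteq> S \<and> (\<forall>x\<in>S - K. f x = 0))}"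


section \<open>Domains of class \<open>C\<^sup>1\<^sup>,\<^sup>1\<close>\<close>

text \<open>Near each boundary point, in suitable orthonormal coordinates, the set is the strict
  epigraph of a function with Lipschitz gradient.  The direction of the last coordinate is the
  unit vector \<open>e\<close>, and a function of the other \<open>n - 1\<close> coordinates is encoded as a function
  on the whole space that is invariant under translations along \<open>e\<close>.\<close>

definition C11_boundary :: "(real ^ 'n) set \<Rightarrow> bool" where
  "C11_boundary S \<longleftrightarrow>
     (\<forall>x\<in>frontier S. \<exists>r>0. \<exists>e \<gamma>. norm e = 1 \<and> (\<forall>y t. \<gamma> (y + t *\<^sub>R e) = \<gamma> y) \<and>
        (\<forall>y. \<gamma> differentiable (at y)) \<and> (\<exists>L. L-lipschitz_on UNIV (grad \<gamma>)) \<and>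
        S \<inter> ball x r = {y \<in> ball x r. \<gamma> y < y \<bullet> e})"


section \<open>Lorentz spaces\<close>

definition decr_rearr ::
  "(real ^ 'n) set \<Rightarrow> (real ^ 'n \<Rightarrow> ennreal) \<Rightarrow> real \<Rightarrow> ennreal" where
  "decr_rearr S g s = Inf {t. emeasure lebesgue {x \<in> S. t < g x} \<le> ennreal s}"

definition mean_rearr ::
  "(real ^ 'n) set \<Rightarrow> (real ^ 'n \<Rightarrow> ennreal) \<Rightarrow> real \<Rightarrow> ennreal" where
  "mean_rearr S g t = (\<integral>\<^sup>+\<sigma>\<in>{0<..<t}. decr_rearr S g \<sigma> \<partial>lborel) / ennreal t"

text \<open>Here \<open>g\<close> stands for the absolute value of the function, and may take the value infinity.\<close>

definition lorentz_norm ::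
  "(real ^ 'n) set \<Rightarrow> real \<Rightarrow> (real ^ 'n \<Rightarrow> ennreal) \<Rightarrow> ennreal" where
  "lorentz_norm S p g =
     (\<integral>\<^sup>+t\<in>{0<..<measure lebesgue S}. ennreal (t powr (1 / p)) * mean_rearr S g t / ennreal t
        \<partial>lborel) / emeasure lebesgue S"

definition lorentz_space :: "(real ^ 'n) set \<Rightarrow> real \<Rightarrow> (real ^ 'n \<Rightarrow> real) set" where
  "lorentz_space S p =
     {u \<in> borel_measurable (lebesgue_on S). lorentz_norm S p (\<lambda>x. ennreal \<bar>u x\<bar>) < \<infinity>}"


section \<open>Potentials, capacity and irregular points\<close>

definition potential :: "(real ^ 'n) set \<Rightarrow> (real ^ 'n \<Rightarrow> ennreal) \<Rightarrow> bool" where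
  "potential S V \<longleftrightarrow> V \<in> borel_measurable (lebesgue_on S) \<and> \<not> (AE x in lebesgue_on S. V x = 0)"

definition ennsqrt :: "ennreal \<Rightarrow> ennreal" where
  "ennsqrt a = (if a = \<infinity> then \<infinity> else ennreal (sqrt (enn2real a)))"

text \<open>Division of extended nonnegative reals satisfies \<open>0 / a = 0\<close>, \<open>a / \<infinity> = 0\<close>
  for real \<open>a\<close>, and \<open>a / 0 = \<infinity>\<close> for \<open>a > 0\<close>; these are the conventions wanted for the
  two quotients below.\<close>

definition V_norm ::
  "(real ^ 'n) set \<Rightarrow> (real ^ 'n \<Rightarrow> ennreal) \<Rightarrow> (real ^ 'n \<Rightarrow> real) \<Rightarrow> ennreal" where
  "V_norm S V \<psi> =
     (\<integral>\<^sup>+x. ennreal \<bar>\<psi> x\<bar> \<partial>lebesgue_on S)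
     + esssup (lebesgue_on S) (\<lambda>x. ennreal (norm (grad \<psi> x)) / ennsqrt (V x))
     + esssup (lebesgue_on S) (\<lambda>x. ennreal \<bar>laplacian \<psi> x\<bar> / V x)"

definition cap_test :: "(real ^ 'n) set \<Rightarrow> (real ^ 'n) set \<Rightarrow> (real ^ 'n \<Rightarrow> real) set" where
  "cap_test S K = {\<psi> \<in> C2_compact S. (\<forall>x\<in>S. 0 \<le> \<psi> x \<and> \<psi> x \<le> 1) \<and>
     (\<exists>W. open W \<and> K \<subseteq> W \<and> (\<forall>x\<in>W \<inter> S. \<psi> x = 1))}"

definition Cap ::
  "(real ^ 'n) set \<Rightarrow> (real ^ 'n \<Rightarrow> ennreal) \<Rightarrow> (real ^ 'n) set \<Rightarrow> ennreal" where
  "Cap S V K = (INF \<psi>\<in>cap_test S K. V_norm S V \<psi>)"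

definition regular_points ::
  "(real ^ 'n) set \<Rightarrow> (real ^ 'n \<Rightarrow> ennreal) \<Rightarrow> (real ^ 'n) set" where
  "regular_points S V =
     {x \<in> S. \<exists>r>0. ball x r \<subseteq> S \<and> lorentz_norm (ball x r) (real CARD('n) / 2) V < \<infinity>}"

definition irregular_points ::
  "(real ^ 'n) set \<Rightarrow> (real ^ 'n \<Rightarrow> ennreal) \<Rightarrow> (real ^ 'n) set" where
  "irregular_points S V = S - regular_points S V"

definition L1_weighted ::
  "(real ^ 'n) set \<Rightarrow> (real ^ 'n \<Rightarrow> ennreal) \<Rightarrow> (real ^ 'n \<Rightarrow> real) set" where
  "L1_weighted S V = {g \<in> borel_measurable (lebesgue_on S).
     (\<integral>\<^sup>+x. ennreal \<bar>g x\<bar> * V x \<partial>lebesgue_on S) < \<infinity>}"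

definition L1_zero :: "(real ^ 'n) set \<Rightarrow> (real ^ 'n \<Rightarrow> real) set" where
  "L1_zero S = {g. integrable (lebesgue_on S) g \<and>
     ((\<lambda>\<epsilon>. (1 / \<epsilon>) * (LINT x|lebesgue_on {x \<in> S. infdist x (frontier S) \<le> \<epsilon>}. \<bar>g x\<bar>))
        \<longlongrightarrow> 0) (at_right 0)}"

text \<open>The weak form of \<open>div U = 0\<close> in \<open>S\<close> and \<open>U \<bullet> \<nu> = 0\<close> on the boundary.\<close>

definition div_free_tangential :: "(real ^ 'n) set \<Rightarrow> (real ^ 'n \<Rightarrow> real ^ 'n) \<Rightarrow> bool" where
  "div_free_tangential S U \<longleftrightarrow>
     (\<forall>\<phi>. C1_closure S \<phi> \<longrightarrow> (LINT x|lebesgue_on S. U x \<bullet> grad \<phi> x) = 0)"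


section \<open>Bounded Radon measures\<close>

text \<open>A signed measure is a countably additive real set function on the measurable sets of \<open>M\<close>;
  only the \<open>\<sigma>\<close>-algebra of \<open>M\<close> is relevant.  Its upper variation, its lower variation (the upper
  variation of \<open>- f\<close>) and their sum, the total variation, give the Jordan decomposition.
  In \<open>upper_var\<close>, the truncation of negative values by \<open>ennreal\<close> is harmless since the empty
  set is admissible.\<close>

definition signed_measure :: "'a measure \<Rightarrow> ('a set \<Rightarrow> real) \<Rightarrow> bool" where
  "signed_measure M f \<longleftrightarrow> f {} = 0 \<and>
     (\<forall>A :: nat \<Rightarrow> 'a set. range A \<subseteq> sets M \<longrightarrow> disjoint_family A \<longrightarrow>
        (\<lambda>i. f (A i)) sums f (\<Union>i. A i))"

definition upper_var :: "'a measure \<Rightarrow> ('a set \<Rightarrow> real) \<Rightarrow> 'a set \<Rightarrow> ennreal" where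
  "upper_var M f A = (SUP B\<in>{B \<in> sets M. B \<subseteq> A}. ennreal (f B))"

definition total_var :: "'a measure \<Rightarrow> ('a set \<Rightarrow> real) \<Rightarrow> 'a set \<Rightarrow> ennreal" where
  "total_var M f A = upper_var M f A + upper_var M (\<lambda>B. - f B) A"

definition signed_integral :: "'a measure \<Rightarrow> ('a set \<Rightarrow> real) \<Rightarrow> ('a \<Rightarrow> real) \<Rightarrow> real" where
  "signed_integral M f g =
     (LINT x|measure_of (space M) (sets M) (upper_var M f). g x)
     - (LINT x|measure_of (space M) (sets M) (upper_var M (\<lambda>B. - f B)). g x)"

text \<open>Finite Borel measures on an open subset of Euclidean space are automatically inner and
  outer regular, so regularity is not required separately.\<close>

definition bounded_radon_measure :: "(real ^ 'n) set \<Rightarrow> ((real ^ 'n) set \<Rightarrow> real) \<Rightarrow> bool" where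
  "bounded_radon_measure S f \<longleftrightarrow> signed_measure (restrict_space borel S) f \<and>
     total_var (restrict_space borel S) f S < \<infinity>"

definition support :: "(real ^ 'n) set \<Rightarrow> ((real ^ 'n) set \<Rightarrow> real) \<Rightarrow> (real ^ 'n) set" where
  "support S f =
     {x \<in> S. \<forall>W. open W \<longrightarrow> x \<in> W \<longrightarrow> total_var (restrict_space borel S) f (W \<inter> S) > 0}"


section \<open>The equation\<close>

text \<open>For \<open>u\<close> in \<open>L1_weighted \<Omega> V\<close>, \<open>u\<close> vanishes almost everywhere on the set where \<open>V\<close> is
  infinite, so the value that \<open>enn2real\<close> assigns to infinity is irrelevant.\<close>

definition solves_eq ::
  "(real ^ 'n) set \<Rightarrow> (real ^ 'n \<Rightarrow> real ^ 'n) \<Rightarrow> (real ^ 'n \<Rightarrow> ennreal) \<Rightarrow>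
   ((real ^ 'n) set \<Rightarrow> real) \<Rightarrow> (real ^ 'n \<Rightarrow> real) \<Rightarrow> bool" where
  "solves_eq \<Omega> U V f u \<longleftrightarrow> integrable (lebesgue_on \<Omega>) (\<lambda>x. u x * norm (U x)) \<and>
     (\<forall>\<Phi>\<in>C2_zero \<Omega>.
        (LINT x|lebesgue_on \<Omega>.
           u x * (- laplacian \<Phi> x - U x \<bullet> grad \<Phi> x + enn2real (V x) * \<Phi> x))
        = signed_integral (restrict_space borel \<Omega>) f \<Phi>)"

end

theory Submission
  imports Defs
begin

text \<open>Why a solution \<open>u\<close> cannot exist.  Let \<open>\<omega>\<close> isolate \<open>G\<close>, and let \<open>\<phi>\<close> be a \<open>C\<^sup>2\<close> function with compact support
in \<open>\<omega> \<inter> \<Omega>\<close>.  Capacity zero provides cut-offs \<open>\<psi>\<close> with values in \<open>[0, 1]\<close>, equal to \<open>1\<close> near the irregular set,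
such that \<open>\<integral> \<psi> \<le> \<epsilon>\<close>, \<open>|\<nabla>\<psi>| \<le> \<epsilon> \<surd>V\<close> and \<open>|\<Delta>\<psi>| \<le> \<epsilon> V\<close>.  Test the equation with \<open>\<psi> \<phi>\<close>.

The right-hand side does not depend on \<open>\<psi>\<close>: the variations of \<open>f\<close> are carried by the support of \<open>f\<close>, and there
\<open>\<psi> \<phi> = \<phi>\<close>, because the support meets \<open>\<omega>\<close> only in irregular points, where \<open>\<psi> = 1\<close>.  The left-hand side tends to \<open>0\<close>
with \<open>\<epsilon>\<close>: the terms without derivatives of \<open>\<psi>\<close> by dominated convergence, and the others because
\<open>|u \<phi> \<Delta>\<psi>| \<le> \<epsilon> |\<phi>| |u| V\<close>, \<open>|u \<nabla>\<psi> \<bullet> \<nabla>\<phi>| \<le> \<epsilon> |\<nabla>\<phi>| |u| (1 + V)\<close> and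
\<open>|u \<phi> U \<bullet> \<nabla>\<psi>| \<le> \<epsilon> |\<phi>| |u| (|U|\<^sup>2 + V)\<close> (lemma \<open>capacity_cutoff_limit\<close>).  Hence \<open>\<integral> \<phi> df = 0\<close> for all these \<open>\<phi>\<close>,
so \<open>f\<close> vanishes on the Borel subsets of \<open>\<omega> \<inter> \<Omega>\<close> (lemma \<open>test_functions_separate_signed_measure\<close>).  As the rest of
the irregular set avoids the support of \<open>f\<close>, the total variation of the irregular set is \<open>0\<close>.

The bound of the drift term needs \<open>|u| |U|\<^sup>2\<close> to be locally integrable, whereas the equation only provides
\<open>|u| |U|\<close>.  This is interior regularity for \<open>- \<Delta>u = f - V u - div (u U)\<close> (lemma \<open>drift_square_integrable\<close>).  With \<open>n\<close>
the dimension and \<open>\<nu>\<close> the finite measure \<open>|f| + |u| V dx\<close>, testing with a bump function times a regularised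
Newtonian kernel gives locally, for \<open>n - 2 < b \<le> n - 1\<close>,
  \<open>|u x| \<le> C (\<integral> |x - y|\<^bsup>1 - n\<^esup> |u y| (|U y| + 1) dy + \<integral> |x - y|\<^bsup>- b\<^esup> d\<nu> y)\<close>
(lemma \<open>newton_test_inequality\<close>).  Integrated against a weight \<open>g\<close>, this estimates \<open>\<integral> |u| g\<close> by \<open>\<integral> |u| g'\<close> on a
slightly larger ball, with \<open>g' y = (|U y| + 1) \<integral> |y - z|\<^bsup>1 - n\<^esup> g z dz\<close>.  Measure the size of a weight by the exponents \<open>b\<close> for
which \<open>\<integral> |x - y|\<^bsup>- b\<^esup> g y dy\<close> is bounded in \<open>x\<close>.  Since \<open>U\<close> lies in \<open>L\<^sup>q\<close> for some \<open>q > n\<close>, passing from \<open>g\<close> to \<open>g'\<close> raises the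
admissible exponent by a fixed amount (lemmas \<open>riesz_mult_le\<close> and \<open>riesz_pot_step\<close>).  The weight \<open>(|U| + 1)\<^sup>2\<close> has an
admissible exponent above \<open>n - 2\<close>, so after finitely many steps the exponent \<open>n - 1\<close> is admissible; then \<open>g'\<close> is at
most a multiple of \<open>|U| + 1\<close>, and the integrability of \<open>|u| (|U| + 1)\<close> ends the iteration (lemma \<open>riesz_bootstrap\<close>).\<close>

section \<open>Functions of class \<open>C\<^sup>2\<close>\<close>

lemma partial_eq:
  assumes "(f has_derivative D) (at x)"
  shows "partial i f x = D (axis i 1)"
  using frechet_derivative_at[OF assms] by (simp add: partial_def)

lemma has_derivative_partial:
  assumes "f differentiable (at x)"
  shows "(f has_derivative frechet_derivative f (at x)) (at x)"
  using assms by (simp add: frechet_derivative_works)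

lemma partial_const [simp]: "partial i (\<lambda>x. c) x = 0"
  using partial_eq[OF has_derivative_const, where i = i and x = x] by simp

lemma partial_add:
  assumes "f differentiable (at x)" "g differentiable (at x)"
  shows "partial i (\<lambda>x. f x + g x) x = partial i f x + partial i g x"
  using partial_eq[OF has_derivative_add[OF assms[THEN has_derivative_partial]], of i]
  by (simp add: partial_def)

lemma partial_mult:
  assumes "f differentiable (at x)" "g differentiable (at x)"
  shows "partial i (\<lambda>x. f x * g x) x = f x * partial i g x + partial i f x * g x"
  using partial_eq[OF has_derivative_mult[OF assms[THEN has_derivative_partial]], of i]
  by (simp add: partial_def)

lemma partial_compose:
  assumes "f differentiable (at x)" "(F has_real_derivative D) (at (f x))"
  shows "partial i (\<lambda>x. F (f x)) x = D * partial i f x"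
proof -
  have "((\<lambda>x. F (f x)) has_derivative (\<lambda>h. D * frechet_derivative f (at x) h)) (at x)"
    using has_derivative_compose[OF has_derivative_partial[OF assms(1)],
      of F "(*) D"] assms(2) by (simp add: has_field_derivative_def)
  from partial_eq[OF this, of i] show ?thesis by (simp add: partial_def)
qed

lemma differentiable_compose_real:
  assumes "f differentiable (at x)" "(F has_real_derivative D) (at (f x))"
  shows "(\<lambda>x. F (f x)) differentiable (at x)"
  using differentiable_chain_at[of f x F] assms differentiableI[of F "(*) D"]
  by (simp add: o_def has_field_derivative_def)

lemma differentiable_transform_open:
  assumes "open S" "x \<in> S" "\<And>y. y \<in> S \<Longrightarrow> f y = g y" "f differentiable (at x)"
  shows "g differentiable (at x)"
  using has_derivative_transform_within_open[of f _ x UNIV S g] assms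
  unfolding differentiable_def by fastforce

lemma partial_cong_open:
  assumes "open S" "x \<in> S" "\<And>y. y \<in> S \<Longrightarrow> f y = g y"
  shows "partial i f x = partial i g x"
proof -
  have "(f has_derivative D) (at x) \<longleftrightarrow> (g has_derivative D) (at x)" for D
    using has_derivative_transform_within_open[of f D x UNIV S g]
      has_derivative_transform_within_open[of g D x UNIV S f] assms by auto
  then show ?thesis by (simp add: partial_def frechet_derivative_def)
qed

lemma C1_on_continuous: "C1_on S f \<Longrightarrow> continuous_on S f"
  by (meson C1_on_def continuous_at_imp_continuous_on differentiable_imp_continuous_within)

lemma C1_on_cong:
  assumes "open S" "\<And>y. y \<in> S \<Longrightarrow> f y = g y" "C1_on S f"
  shows "C1_on S g"
  unfolding C1_on_def
proof (intro conjI ballI allI)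
  show "g differentiable (at x)" if "x \<in> S" for x
    using differentiable_transform_open[OF assms(1) that assms(2)] assms(3) that
    by (auto simp: C1_on_def)
  show "continuous_on S (partial i g)" for i
    by (rule continuous_on_eq[of S "partial i f"])
      (use assms(3) partial_cong_open[OF assms(1) _ assms(2)] in \<open>auto simp: C1_on_def\<close>)
qed

lemma C2_on_cong:
  assumes "open S" "\<And>y. y \<in> S \<Longrightarrow> f y = g y" "C2_on S f"
  shows "C2_on S g"
  unfolding C2_on_def
proof (intro conjI allI)
  show "C1_on S g" using C1_on_cong[OF assms(1,2)] assms(3) by (auto simp: C2_on_def)
  show "C1_on S (partial i g)" for i
    by (rule C1_on_cong[OF assms(1) partial_cong_open[OF assms(1) _ assms(2)]])
      (use assms(3) in \<open>auto simp: C2_on_def\<close>)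
qed

lemma C1_on_const [simp]: "C1_on S (\<lambda>x. c)"
  by (simp add: C1_on_def partial_const[abs_def])

lemma C1_on_add:
  assumes "C1_on S f" "C1_on S g" shows "C1_on S (\<lambda>x. f x + g x)"
proof -
  have c: "continuous_on S (\<lambda>x. partial i f x + partial i g x)" for i
    using assms by (auto simp: C1_on_def intro!: continuous_intros)
  have "continuous_on S (partial i (\<lambda>x. f x + g x))" for i
    by (rule continuous_on_eq[OF c[of i]]) (use assms in \<open>auto simp: C1_on_def partial_add\<close>)
  then show ?thesis using assms by (auto simp: C1_on_def)
qed

lemma C1_on_mult:
  assumes "C1_on S f" "C1_on S g" shows "C1_on S (\<lambda>x. f x * g x)"
proof -
  have c: "continuous_on S (\<lambda>x. f x * partial i g x + partial i f x * g x)" for i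
    using assms C1_on_continuous[OF assms(1)] C1_on_continuous[OF assms(2)]
    by (auto simp: C1_on_def intro!: continuous_intros)
  have "continuous_on S (partial i (\<lambda>x. f x * g x))" for i
    by (rule continuous_on_eq[OF c[of i]]) (use assms in \<open>auto simp: C1_on_def partial_mult\<close>)
  then show ?thesis using assms by (auto simp: C1_on_def)
qed

lemma C1_on_compose:
  assumes f: "C1_on S f"
    and F: "\<And>x. x \<in> S \<Longrightarrow> (F has_real_derivative F' (f x)) (at (f x))"
    and F': "continuous_on S (\<lambda>x. F' (f x))"
  shows "C1_on S (\<lambda>x. F (f x))"
proof -
  have d: "(\<lambda>x. F (f x)) differentiable (at x)" if "x \<in> S" for x
    by (rule differentiable_compose_real[where D = "F' (f x)"]) (use f F that in \<open>auto simp: C1_on_def\<close>)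
  have c: "continuous_on S (\<lambda>x. F' (f x) * partial i f x)" for i
    using f F' by (auto simp: C1_on_def intro!: continuous_intros)
  have "continuous_on S (partial i (\<lambda>x. F (f x)))" for i
    by (rule continuous_on_eq[OF c[of i]]) (rule partial_compose[symmetric], use f F in \<open>auto simp: C1_on_def\<close>)
  then show ?thesis using d by (auto simp: C1_on_def)
qed

lemma C2_on_differentiable: "C2_on S f \<Longrightarrow> x \<in> S \<Longrightarrow> f differentiable (at x)"
  by (simp add: C2_on_def C1_on_def)

lemma C2_on_partial_differentiable: "C2_on S f \<Longrightarrow> x \<in> S \<Longrightarrow> partial i f differentiable (at x)"
  by (simp add: C2_on_def C1_on_def)

lemma C2_on_const [simp]: "C2_on S (\<lambda>x. c)"
  by (simp add: C2_on_def partial_const[abs_def])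

lemma C2_on_add:
  assumes "open S" "C2_on S f" "C2_on S g" shows "C2_on S (\<lambda>x. f x + g x)"
  unfolding C2_on_def
proof (intro conjI allI)
  show "C1_on S (\<lambda>x. f x + g x)" by (rule C1_on_add) (use assms in \<open>simp_all add: C2_on_def\<close>)
  show "C1_on S (partial i (\<lambda>x. f x + g x))" for i
  proof (rule C1_on_cong[OF assms(1), of "\<lambda>x. partial i f x + partial i g x"])
    show "C1_on S (\<lambda>x. partial i f x + partial i g x)"
      by (rule C1_on_add) (use assms in \<open>simp_all add: C2_on_def\<close>)
  qed (rule partial_add[symmetric], use assms in \<open>auto intro: C2_on_differentiable\<close>)
qed

lemma C2_on_mult:
  assumes "open S" "C2_on S f" "C2_on S g" shows "C2_on S (\<lambda>x. f x * g x)"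
  unfolding C2_on_def
proof (intro conjI allI)
  show "C1_on S (\<lambda>x. f x * g x)" by (rule C1_on_mult) (use assms in \<open>simp_all add: C2_on_def\<close>)
  show "C1_on S (partial i (\<lambda>x. f x * g x))" for i
  proof (rule C1_on_cong[OF assms(1), of "\<lambda>x. f x * partial i g x + partial i f x * g x"])
    show "C1_on S (\<lambda>x. f x * partial i g x + partial i f x * g x)"
      by (rule C1_on_add; rule C1_on_mult) (use assms in \<open>simp_all add: C2_on_def\<close>)
  qed (rule partial_mult[symmetric], use assms in \<open>auto intro: C2_on_differentiable\<close>)
qed

lemma C2_on_compose:
  assumes "open S" and f: "C2_on S f"
    and F: "\<And>x. x \<in> S \<Longrightarrow> (F has_real_derivative F' (f x)) (at (f x))"
    and F': "\<And>x. x \<in> S \<Longrightarrow> (F' has_real_derivative F'' (f x)) (at (f x))"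
    and F'': "continuous_on S (\<lambda>x. F'' (f x))"
  shows "C2_on S (\<lambda>x. F (f x))"
proof -
  have C1: "C1_on S (\<lambda>x. F' (f x))"
    by (rule C1_on_compose[where F' = F'']) (use f F' F'' in \<open>auto simp: C2_on_def\<close>)
  have "C1_on S (\<lambda>x. F (f x))"
    by (rule C1_on_compose[where F' = F'])
      (use f F C1_on_continuous[OF C1] in \<open>auto simp: C2_on_def\<close>)
  moreover have "C1_on S (partial i (\<lambda>x. F (f x)))" for i
  proof (rule C1_on_cong[OF assms(1), of "\<lambda>x. F' (f x) * partial i f x"])
    show "C1_on S (\<lambda>x. F' (f x) * partial i f x)"
      by (rule C1_on_mult[OF C1]) (use f in \<open>simp add: C2_on_def\<close>)
  qed (rule partial_compose[symmetric], use f F in \<open>auto simp: C2_on_differentiable\<close>)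
  ultimately show ?thesis by (simp add: C2_on_def)
qed

lemma grad_mult:
  assumes "f differentiable (at x)" "g differentiable (at x)"
  shows "grad (\<lambda>x. f x * g x) x = f x *\<^sub>R grad g x + g x *\<^sub>R grad f x"
  using assms by (simp add: grad_def vec_eq_iff partial_mult mult.commute)

lemma laplacian_mult:
  assumes "open S" "x \<in> S" and f: "C2_on S f" and g: "C2_on S g"
  shows "laplacian (\<lambda>x. f x * g x) x = f x * laplacian g x + 2 * (grad f x \<bullet> grad g x) + g x * laplacian f x"
proof -
  have "partial i (partial i (\<lambda>x. f x * g x)) x
      = f x * partial i (partial i g) x + 2 * (partial i f x * partial i g x) + g x * partial i (partial i f) x" for i
  proof -
    have "partial i (partial i (\<lambda>x. f x * g x)) x
        = partial i (\<lambda>x. f x * partial i g x + partial i f x * g x) x"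
      by (rule partial_cong_open[OF assms(1,2)], rule partial_mult)
        (use f g in \<open>auto intro: C2_on_differentiable\<close>)
    then show ?thesis
      using assms C2_on_differentiable[OF f] C2_on_differentiable[OF g]
        C2_on_partial_differentiable[OF f] C2_on_partial_differentiable[OF g]
      by (simp add: partial_add partial_mult algebra_simps)
  qed
  then show ?thesis
    by (simp add: laplacian_def grad_def inner_vec_def sum.distrib sum_distrib_left)
qed

lemma laplacian_compose:
  assumes "open S" "x \<in> S" and f: "C2_on S f"
    and F: "\<And>x. x \<in> S \<Longrightarrow> (F has_real_derivative F' (f x)) (at (f x))"
    and F': "(F' has_real_derivative F'') (at (f x))"
  shows "laplacian (\<lambda>x. F (f x)) x = F'' * (grad f x \<bullet> grad f x) + F' (f x) * laplacian f x"
proof -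
  have "partial i (partial i (\<lambda>x. F (f x))) x
      = F'' * (partial i f x * partial i f x) + F' (f x) * partial i (partial i f) x" for i
  proof -
    have d: "(\<lambda>x. F' (f x)) differentiable (at x)"
      by (rule differentiable_compose_real[OF C2_on_differentiable[OF f assms(2)], where F = F' and D = F'']) (rule F')
    have "partial i (partial i (\<lambda>x. F (f x))) x = partial i (\<lambda>x. F' (f x) * partial i f x) x"
      by (rule partial_cong_open[OF assms(1,2)], rule partial_compose)
        (use f F in \<open>auto simp: C2_on_differentiable\<close>)
    moreover have "partial i (\<lambda>x. F' (f x)) x = F'' * partial i f x"
      by (rule partial_compose[OF C2_on_differentiable[OF f assms(2)], where F = F']) (rule F')
    ultimately show ?thesis
      using d C2_on_partial_differentiable[OF f assms(2)]
      by (simp add: partial_mult algebra_simps)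
  qed
  then show ?thesis
    by (simp add: laplacian_def grad_def inner_vec_def sum.distrib sum_distrib_left)
qed

lemma grad_compose:
  assumes "f differentiable (at x)" "(F has_real_derivative D) (at (f x))"
  shows "grad (\<lambda>x. F (f x)) x = D *\<^sub>R grad f x"
  by (simp add: grad_def vec_eq_iff partial_compose[OF assms(1), where F = F, OF assms(2)])

lemma sqdist_has_derivative:
  fixes a :: "real ^ 'n"
  shows "((\<lambda>y. (y - a) \<bullet> (y - a)) has_derivative (\<lambda>h. 2 * ((y - a) \<bullet> h))) (at y)"
  by (auto intro!: derivative_eq_intros simp: inner_commute)

lemma partial_sqdist: "partial i (\<lambda>y. (y - a) \<bullet> (y - a)) = (\<lambda>y. 2 * y $ i - 2 * a $ i)"
  using partial_eq[OF sqdist_has_derivative, where i = i] by (simp add: fun_eq_iff inner_axis right_diff_distrib)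

lemma coord_has_derivative:
  "((\<lambda>y :: real ^ 'n. 2 * y $ i - c) has_derivative (\<lambda>h. 2 * (h $ i))) (at y)"
proof -
  have "((\<lambda>y :: real ^ 'n. y $ i) has_derivative (\<lambda>h. h $ i)) (at y)"
    by (rule bounded_linear.has_derivative[OF bounded_linear_vec_nth has_derivative_ident])
  then show ?thesis by (auto intro!: derivative_eq_intros)
qed

lemma partial_coord:
  "partial j (\<lambda>y :: real ^ 'n. 2 * y $ i - c) = (\<lambda>y. if i = j then 2 else 0)"
  using partial_eq[OF coord_has_derivative, where i = j] by (auto simp: fun_eq_iff axis_def)

lemma C2_on_sqdist: "C2_on S (\<lambda>y :: real ^ 'n. (y - a) \<bullet> (y - a))"
  unfolding C2_on_def C1_on_def partial_sqdist partial_coord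
  by (auto intro!: continuous_intros differentiableI[OF sqdist_has_derivative] differentiableI[OF coord_has_derivative])

lemma grad_sqdist: "grad (\<lambda>y. (y - a) \<bullet> (y - a)) x = 2 *\<^sub>R (x - a)"
  by (simp add: grad_def partial_sqdist vec_eq_iff)

lemma laplacian_sqdist: "laplacian (\<lambda>y :: real ^ 'n. (y - a) \<bullet> (y - a)) x = 2 * real CARD('n)"
  by (simp add: laplacian_def partial_sqdist partial_coord)

lemma C2_on_radial:
  fixes a :: "real ^ 'n"
  assumes "\<And>s. s \<ge> 0 \<Longrightarrow> (F has_real_derivative F' s) (at s)"
    and "\<And>s. s \<ge> 0 \<Longrightarrow> (F' has_real_derivative F'' s) (at s)"
    and "continuous_on {0..} F''"
  shows "C2_on UNIV (\<lambda>y. F ((y - a) \<bullet> (y - a)))"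
proof (rule C2_on_compose[OF open_UNIV C2_on_sqdist, where F' = F'])
  show "continuous_on UNIV (\<lambda>y. F'' ((y - a) \<bullet> (y - a)))"
    by (rule continuous_on_compose2[OF assms(3)]) (auto intro!: continuous_intros)
qed (use assms in auto)

lemma laplacian_radial:
  fixes a :: "real ^ 'n"
  assumes "\<And>s. s \<ge> 0 \<Longrightarrow> (F has_real_derivative F' s) (at s)"
    and "\<And>s. s \<ge> 0 \<Longrightarrow> (F' has_real_derivative F'' s) (at s)"
  shows "laplacian (\<lambda>y. F ((y - a) \<bullet> (y - a))) y
    = 4 * ((y - a) \<bullet> (y - a)) * F'' ((y - a) \<bullet> (y - a)) + 2 * real CARD('n) * F' ((y - a) \<bullet> (y - a))"
proof -
  have "laplacian (\<lambda>y. F ((y - a) \<bullet> (y - a))) y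
    = F'' ((y - a) \<bullet> (y - a)) * (grad (\<lambda>y. (y - a) \<bullet> (y - a)) y \<bullet> grad (\<lambda>y. (y - a) \<bullet> (y - a)) y)
      + F' ((y - a) \<bullet> (y - a)) * laplacian (\<lambda>y. (y - a) \<bullet> (y - a)) y"
    by (rule laplacian_compose[OF open_UNIV UNIV_I C2_on_sqdist]) (use assms in auto)
  then show ?thesis by (simp add: grad_sqdist laplacian_sqdist)
qed

lemma grad_radial:
  fixes a :: "real ^ 'n"
  assumes "\<And>s. s \<ge> 0 \<Longrightarrow> (F has_real_derivative F' s) (at s)"
  shows "grad (\<lambda>y. F ((y - a) \<bullet> (y - a))) y = (2 * F' ((y - a) \<bullet> (y - a))) *\<^sub>R (y - a)"
proof -
  have "grad (\<lambda>y. F ((y - a) \<bullet> (y - a))) y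
     = F' ((y - a) \<bullet> (y - a)) *\<^sub>R grad (\<lambda>y. (y - a) \<bullet> (y - a)) y"
    by (rule grad_compose[OF differentiableI[OF sqdist_has_derivative]]) (use assms in auto)
  then show ?thesis by (simp add: grad_sqdist)
qed

text \<open>The open sets \<open>S\<close> and \<open>- K\<close> cover the space, and being \<open>C\<^sup>2\<close> is local on open sets.  This makes a cut-off,
about which nothing is known outside \<open>S\<close>, harmless as soon as it is multiplied by a function supported in \<open>K\<close>.\<close>

lemma C2_on_extend_zero:
  assumes S: "open S" and K: "compact K" "K \<subseteq> S" and f: "C2_on S f" and 0: "\<And>x. x \<notin> K \<Longrightarrow> f x = 0"
  shows "C2_on UNIV f"
proof -
  have oK: "open (- K)" using K by (simp add: compact_imp_closed open_Compl)
  have 2: "C2_on (- K) f" by (rule C2_on_cong[OF oK, of "\<lambda>x. 0"]) (use 0 in auto)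
  have U: "S \<union> (- K) = UNIV" using K by auto
  have C1: "C1_on UNIV g" if "C1_on S g" "C1_on (- K) g" for g
  proof -
    have "g differentiable (at x)" for x
      using that U by (cases "x \<in> S") (auto simp: C1_on_def)
    moreover have "continuous_on UNIV (partial i g)" for i
      using continuous_on_open_Un[OF S oK, of "partial i g"] that unfolding U C1_on_def by simp
    ultimately show ?thesis by (simp add: C1_on_def)
  qed
  show ?thesis using f 2 C1[of f] C1[of "partial i f" for i] by (simp add: C2_on_def)
qed

lemma C2_zeroI:
  assumes S: "open S" and K: "compact K" "K \<subseteq> S" and f: "C2_on UNIV f" and 0: "\<And>x. x \<notin> K \<Longrightarrow> f x = 0"
  shows "f \<in> C2_zero S"
proof -
  have sub: "C1_on S g" if "C1_on UNIV g" for g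
    using that by (auto simp: C1_on_def intro: continuous_on_subset[OF _ subset_UNIV])
  have ext: "extends_to_closure S g" if "continuous_on UNIV g" for g
    using that continuous_on_subset[of UNIV g "closure S"] by (auto simp: extends_to_closure_def)
  have p: "C1_on UNIV f" "C1_on UNIV (partial i f)" "continuous_on UNIV (partial i f)"
     "continuous_on UNIV (partial j (partial i f))" for i j
    using f by (simp_all add: C2_on_def C1_on_def)
  have "C2_on S f" using sub[OF p(1)] sub[OF p(2)] by (simp add: C2_on_def)
  moreover have "C1_closure S f"
    using sub[OF p(1)] ext[OF p(3)] continuous_on_subset[OF C1_on_continuous[OF p(1)]]
    by (simp add: C1_closure_def)
  moreover have "frontier S \<inter> K = {}" using S K by (auto simp: frontier_def interior_open)
  ultimately show ?thesis
    using 0 ext[OF p(4)] by (auto simp: C2_zero_def C2_closure_def)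
qed

lemma partial_eq_0_open:
  assumes "open S" "\<And>y. y \<in> S \<Longrightarrow> f y = 0" "x \<in> S"
  shows "partial i f x = 0"
  using partial_cong_open[OF assms(1,3), of f "\<lambda>_. 0" i] assms(2) by simp

text \<open>Bounds on the whole space come from compactness of \<open>K\<close>, since all derivatives vanish on the open set \<open>- K\<close>.\<close>

lemma C2_compact_support_bounds:
  fixes f :: "real ^ 'n \<Rightarrow> real"
  assumes f: "C2_on UNIV f" and K: "compact K" and 0: "\<And>x. x \<notin> K \<Longrightarrow> f x = 0"
  shows "continuous_on UNIV f" "continuous_on UNIV (grad f)" "continuous_on UNIV (laplacian f)"
    and "\<And>x. x \<notin> K \<Longrightarrow> grad f x = 0" "\<And>x. x \<notin> K \<Longrightarrow> laplacian f x = 0"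
    and "\<exists>B\<ge>1. \<forall>x. \<bar>f x\<bar> \<le> B \<and> norm (grad f x) \<le> B \<and> \<bar>laplacian f x\<bar> \<le> B"
proof -
  have oK: "open (- K)" using K by (simp add: compact_imp_closed open_Compl)
  have C1: "C1_on UNIV f" "C1_on UNIV (partial i f)" for i using f by (simp_all add: C2_on_def)
  show 1: "continuous_on UNIV f" using C1(1) by (rule C1_on_continuous)
  show 2: "continuous_on UNIV (grad f)"
    using C1_on_continuous[OF C1(2)] unfolding grad_def[abs_def] by (intro continuous_on_vec_lambda)
  show 3: "continuous_on UNIV (laplacian f)"
    using C1(2) unfolding laplacian_def[abs_def] C1_on_def by (intro continuous_on_sum) auto
  have p: "partial i f x = 0" if "x \<notin> K" for x i
    by (rule partial_eq_0_open[OF oK]) (use 0 that in auto)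
  show 4: "grad f x = 0" if "x \<notin> K" for x using p[OF that] by (simp add: grad_def vec_eq_iff)
  show 5: "laplacian f x = 0" if "x \<notin> K" for x
  proof -
    have "partial i (partial i f) x = 0" for i
      by (rule partial_eq_0_open[OF oK, where f = "partial i f"]) (use p that in auto)
    then show ?thesis by (simp add: laplacian_def)
  qed
  have bdd: "\<exists>B. \<forall>x. norm (g x) \<le> B" if g: "continuous_on UNIV g" "\<And>x. x \<notin> K \<Longrightarrow> g x = 0"
    for g :: "real ^ 'n \<Rightarrow> 'b :: real_normed_vector"
  proof -
    have "bounded (g ` K)"
      by (intro compact_imp_bounded compact_continuous_image continuous_on_subset[OF g(1)] K) auto
    then obtain B where "\<forall>x\<in>K. norm (g x) \<le> B" by (auto simp: bounded_iff)
    then have "norm (g x) \<le> max B 0" for x using g(2)[of x] by (cases "x \<in> K") auto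
    then show ?thesis by blast
  qed
  obtain B1 where B1: "\<And>x. norm (f x) \<le> B1" using bdd[OF 1 0] by auto
  obtain B2 where B2: "\<And>x. norm (grad f x) \<le> B2" using bdd[OF 2 4] by auto
  obtain B3 where B3: "\<And>x. norm (laplacian f x) \<le> B3" using bdd[OF 3 5] by auto
  show "\<exists>B\<ge>1. \<forall>x. \<bar>f x\<bar> \<le> B \<and> norm (grad f x) \<le> B \<and> \<bar>laplacian f x\<bar> \<le> B"
  proof (intro exI[of _ "max 1 (max B1 (max B2 B3))"] conjI allI)
    fix x
    show "\<bar>f x\<bar> \<le> max 1 (max B1 (max B2 B3))" using B1[of x] by simp
    show "norm (grad f x) \<le> max 1 (max B1 (max B2 B3))" using B2[of x] by simp
    show "\<bar>laplacian f x\<bar> \<le> max 1 (max B1 (max B2 B3))" using B3[of x] by simp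
  qed simp
qed

lemma C2_on_sum:
  assumes "finite I" "\<And>i. i \<in> I \<Longrightarrow> C2_on UNIV (f i)"
  shows "C2_on UNIV (\<lambda>x. \<Sum>i\<in>I. f i x)"
  using assms
proof (induction rule: finite_induct)
  case (insert i I)
  have "C2_on UNIV (\<lambda>x. f i x + (\<Sum>i\<in>I. f i x))"
    by (rule C2_on_add) (use insert in auto)
  then show ?case using insert by simp
qed simp

lemma C2_on_subset_UNIV: "C2_on UNIV f \<Longrightarrow> C2_on S f"
  unfolding C2_on_def C1_on_def by (auto intro: continuous_on_subset[OF _ subset_UNIV])


section \<open>From Lorentz spaces to Lebesgue spaces\<close>

lemma ennreal_le_suminf: "f k \<le> (\<Sum>k. f k)" for f :: "nat \<Rightarrow> ennreal"
  using sum_le_suminf[of f "{k}"] by simp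

lemma nn_integral_suminf_balls:
  fixes c r :: "nat \<Rightarrow> real" and x :: "real ^ 'n"
  shows "(\<integral>\<^sup>+y. (\<Sum>k. ennreal (c k) * indicator (ball x (r k)) y) \<partial>lborel)
    = (\<Sum>k. ennreal (c k) * emeasure lborel (ball x (r k)))"
proof (subst nn_integral_suminf)
  show "(\<lambda>y. ennreal (c k) * indicator (ball x (r k)) y) \<in> borel_measurable lborel" for k
    by (intro borel_measurable_times_ennreal borel_measurable_indicator) simp_all
  show "(\<Sum>k. \<integral>\<^sup>+y. ennreal (c k) * indicator (ball x (r k)) y \<partial>lborel)
    = (\<Sum>k. ennreal (c k) * emeasure lborel (ball x (r k)))"
    by (intro suminf_cong nn_integral_cmult_indicator) simp
qed

lemma integrable_mult_bounded:
  fixes f g :: "'a \<Rightarrow> real"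
  assumes f: "integrable M f" and [measurable]: "g \<in> borel_measurable M" and B: "\<And>x. \<bar>g x\<bar> \<le> B"
  shows "integrable M (\<lambda>x. f x * g x)"
proof (rule Bochner_Integration.integrable_bound)
  show "integrable M (\<lambda>x. B * f x)" using f by simp
  have [measurable]: "f \<in> borel_measurable M" using f by simp
  show "(\<lambda>x. f x * g x) \<in> borel_measurable M" by measurable
  have "\<bar>f x\<bar> * \<bar>g x\<bar> \<le> \<bar>f x\<bar> * \<bar>B\<bar>" for x using B[of x] by (intro mult_left_mono) auto
  then show "AE x in M. norm (f x * g x) \<le> norm (B * f x)" by (simp add: abs_mult mult.commute)
qed

lemma power2_powr:
  fixes x :: real
  assumes "x > 0" shows "(x\<^sup>2) powr c = x powr (2 * c)"
proof -
  have "x\<^sup>2 = x powr 2" using assms by (simp add: powr_numeral)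
  then show ?thesis by (simp only: powr_powr)
qed

text \<open>The Lorentz norm controls the distribution function.  Let \<open>s\<close> be smaller than the measure of \<open>{l < g}\<close>.  For
\<open>t \<le> s\<close> the rearrangement is at least \<open>l\<close>, hence so is its mean, while \<open>t\<^bsup>1/p - 1\<^esup> \<ge> s\<^bsup>1/p - 1\<^esup>\<close>.  Integrating over
\<open>(0, s)\<close> shows that the norm is at least a multiple of \<open>l s\<^bsup>1/p\<^esup>\<close>, and \<open>s\<close> may be taken arbitrarily close to the measure.\<close>

lemma lorentz_norm_weak_type:
  fixes S :: "(real ^ 'n) set"
  assumes p: "p \<ge> 1" and fin: "emeasure lebesgue S < \<infinity>" and norm: "lorentz_norm S p g < \<infinity>"
    and S: "S \<in> sets lebesgue" and g: "g \<in> borel_measurable (lebesgue_on S)"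
  obtains C where "C \<ge> 0" "\<And>l. l > 0 \<Longrightarrow> emeasure lebesgue {x \<in> S. ennreal l < g x} \<le> ennreal ((C / l) powr p)"
proof -
  define A where "A = (\<integral>\<^sup>+t\<in>{0<..<measure lebesgue S}. ennreal (t powr (1 / p)) * mean_rearr S g t / ennreal t \<partial>lborel)"
  have A: "A < \<infinity>"
    using norm fin unfolding lorentz_norm_def A_def[symmetric]
    by (cases A; cases "emeasure lebesgue S") (auto simp: ennreal_divide_eq_top_iff top_unique ennreal_top_divide split: if_splits)
  have sets: "{x \<in> S. t < g x} \<in> sets lebesgue" for t
  proof -
    have "{x \<in> space (lebesgue_on S). t < g x} \<in> sets (lebesgue_on S)" using g by measurable
    then show ?thesis using S by (simp add: sets_restrict_space_iff space_restrict_space)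
  qed
  show ?thesis
  proof (rule that[of "enn2real A"])
    fix l :: real assume l: "l > 0"
    define m where "m = emeasure lebesgue {x \<in> S. ennreal l < g x}"
    have m: "m \<le> emeasure lebesgue S"
      unfolding m_def by (rule emeasure_mono) (use S in auto)
    show "m \<le> ennreal ((enn2real A / l) powr p)"
    proof (rule dense_le)
      fix s' assume s': "s' < m"
      then obtain s where s: "s' = ennreal s" "s \<ge> 0"
        using m fin by (cases s') auto
      show "s' \<le> ennreal ((enn2real A / l) powr p)"
      proof (cases "s = 0")
        case False
        with s have s0: "s > 0" by simp
        have sS: "s < measure lebesgue S"
          using s' s m fin by (simp add: emeasure_eq_ennreal_measure) 
            (metis ennreal_less_iff less_le_trans)
        have dec: "ennreal l \<le> decr_rearr S g t" if "t \<le> s" for t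
          unfolding decr_rearr_def
        proof (rule Inf_greatest, clarsimp)
          fix r assume r: "emeasure lebesgue {x \<in> S. r < g x} \<le> ennreal t"
          show "ennreal l \<le> r"
          proof (rule ccontr)
            assume "\<not> ennreal l \<le> r"
            then have "m \<le> emeasure lebesgue {x \<in> S. r < g x}"
              unfolding m_def by (intro emeasure_mono sets) auto
            then show False using r that s' s
              by (metis ennreal_leI leD order.trans)
          qed
        qed
        have mean: "ennreal l \<le> mean_rearr S g t" if t: "0 < t" "t \<le> s" for t
        proof -
          have "ennreal l * ennreal t = (\<integral>\<^sup>+\<sigma>\<in>{0<..<t}. ennreal l \<partial>lborel)"
            using t by (simp add: nn_integral_cmult_indicator)
          also have "\<dots> \<le> (\<integral>\<^sup>+\<sigma>\<in>{0<..<t}. decr_rearr S g \<sigma> \<partial>lborel)"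
            using dec t by (intro nn_integral_mono) (auto simp: indicator_def)
          finally show ?thesis
            unfolding mean_rearr_def using t
            by (metis divide_right_mono_ennreal ennreal_mult_divide_eq ennreal_neq_top ennreal_eq_0_iff not_le)
        qed
        have "ennreal (l * s powr (1 / p)) = (\<integral>\<^sup>+t\<in>{0<..<s}. ennreal (l * s powr (1 / p) / s) \<partial>lborel)"
          using s0 l by (simp add: nn_integral_cmult_indicator ennreal_mult[symmetric])
        also have "\<dots> \<le> A"
          unfolding A_def
        proof (rule nn_integral_mono)
          fix t :: real
          show "ennreal (l * s powr (1 / p) / s) * indicator {0<..<s} t
            \<le> ennreal (t powr (1 / p)) * mean_rearr S g t / ennreal t * indicator {0<..<measure lebesgue S} t"
          proof (cases "t \<in> {0<..<s}")
            case True
            then have t: "0 < t" "t < s" by auto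
            have "s powr (1 / p) / s = s powr (1 / p - 1)" using s0 by (simp add: powr_diff)
            also have "\<dots> \<le> t powr (1 / p - 1)" using t p by (intro powr_mono2') auto
            also have "\<dots> = t powr (1 / p) / t" using t by (simp add: powr_diff)
            finally have "l * (s powr (1 / p) / s) \<le> l * (t powr (1 / p) / t)"
              using l by (intro mult_left_mono) auto
            then have "ennreal (l * s powr (1 / p) / s) \<le> ennreal (t powr (1 / p) * l / t)"
              by (intro ennreal_leI) (simp add: mult.commute)
            also have "\<dots> = ennreal (t powr (1 / p)) * ennreal l / ennreal t"
              using t l by (simp add: ennreal_mult[symmetric] divide_ennreal)
            also have "\<dots> \<le> ennreal (t powr (1 / p)) * mean_rearr S g t / ennreal t"
              using mean[of t] t by (intro divide_right_mono_ennreal mult_left_mono) auto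
            finally show ?thesis using t sS by simp
          qed simp
        qed
        finally have "l * s powr (1 / p) \<le> enn2real A"
          using A l by (metis enn2real_ennreal enn2real_mono infinity_ennreal_def mult_nonneg_nonneg less_imp_le powr_ge_zero)
        then have "s powr (1 / p) \<le> enn2real A / l" using l by (simp add: field_simps)
        then have "(s powr (1 / p)) powr p \<le> (enn2real A / l) powr p"
          using p by (intro powr_mono2) auto
        then show ?thesis using s0 p s by (simp add: powr_powr ennreal_leI)
      qed (use s in auto)
    qed
  qed simp
qed

text \<open>Split at the levels \<open>2\<^sup>k\<close>: by the weak-type bound the part of \<open>|u|\<^sup>q\<close> between two consecutive levels contributes
at most a multiple of \<open>2\<^bsup>k (q - p)\<^esup>\<close>, and this is summable because \<open>q < p\<close>.\<close>

lemma lorentz_space_Lq: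
  fixes S :: "(real ^ 'n) set"
  assumes p: "p \<ge> 1" and q: "0 < q" "q < p" and fin: "emeasure lebesgue S < \<infinity>"
    and S: "S \<in> sets lebesgue" and u: "u \<in> lorentz_space S p"
  shows "(\<integral>\<^sup>+x. ennreal (\<bar>u x\<bar> powr q) \<partial>lebesgue_on S) < \<infinity>"
proof -
  have um [measurable]: "u \<in> borel_measurable (lebesgue_on S)" using u by (simp add: lorentz_space_def)
  obtain C where C: "C \<ge> 0"
     "\<And>l. l > 0 \<Longrightarrow> emeasure lebesgue {x \<in> S. ennreal l < ennreal \<bar>u x\<bar>} \<le> ennreal ((C / l) powr p)"
    using lorentz_norm_weak_type[OF p fin _ S, of "\<lambda>x. ennreal \<bar>u x\<bar>"] u by (auto simp: lorentz_space_def)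
  define E where "E k = {x \<in> S. 2 ^ k < \<bar>u x\<bar>}" for k :: nat
  have E: "E k \<in> sets (lebesgue_on S)" for k
  proof -
    have "{x \<in> space (lebesgue_on S). 2 ^ k < \<bar>u x\<bar>} \<in> sets (lebesgue_on S)" by measurable
    then show ?thesis by (simp add: E_def space_restrict_space)
  qed
  have meas: "emeasure (lebesgue_on S) (E k) \<le> ennreal ((C / 2 ^ k) powr p)" for k
    using C(2)[of "2 ^ k"] S by (simp add: E_def emeasure_restrict_space ennreal_less_iff)
  have le: "ennreal (\<bar>u x\<bar> powr q) \<le> 1 + (\<Sum>k. ennreal ((2 ^ Suc k) powr q) * indicator (E k) x)" if "x \<in> S" for x
  proof (cases "\<bar>u x\<bar> \<le> 1")
    case True
    then have "\<bar>u x\<bar> powr q \<le> 1" using q by (simp add: powr_le1)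
    then have "ennreal (\<bar>u x\<bar> powr q) \<le> 1" by (metis ennreal_1 ennreal_leI)
    then show ?thesis by (rule order_trans) simp
  next
    case False
    define P where "P k \<longleftrightarrow> \<bar>u x\<bar> \<le> 2 ^ k" for k :: nat
    have "\<exists>k. P k" unfolding P_def using real_arch_pow[of 2 "\<bar>u x\<bar>"] by (auto intro: less_imp_le)
    then have *: "P (LEAST k. P k)" by (rule LeastI_ex)
    moreover have "\<not> P 0" using False by (simp add: P_def)
    ultimately obtain k where k: "(LEAST k. P k) = Suc k" by (metis not0_implies_Suc)
    then have "\<not> P k" using not_less_Least[of k P] by simp
    then have "x \<in> E k" "\<bar>u x\<bar> \<le> 2 ^ Suc k" using * k that by (auto simp: P_def E_def)
    then have "ennreal (\<bar>u x\<bar> powr q) \<le> ennreal ((2 ^ Suc k) powr q) * indicator (E k) x"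
      using q by (auto intro!: ennreal_leI powr_mono2)
    also have "\<dots> \<le> (\<Sum>k. ennreal ((2 ^ Suc k) powr q) * indicator (E k) x)"
      by (rule ennreal_le_suminf)
    also have "\<dots> \<le> 1 + (\<Sum>k. ennreal ((2 ^ Suc k) powr q) * indicator (E k) x)" by simp
    finally show ?thesis .
  qed
  have "(\<integral>\<^sup>+x. ennreal (\<bar>u x\<bar> powr q) \<partial>lebesgue_on S)
      \<le> (\<integral>\<^sup>+x. 1 + (\<Sum>k. ennreal ((2 ^ Suc k) powr q) * indicator (E k) x) \<partial>lebesgue_on S)"
    by (intro nn_integral_mono le) simp
  also have "\<dots> = emeasure (lebesgue_on S) (space (lebesgue_on S)) + (\<Sum>k. ennreal ((2 ^ Suc k) powr q) * emeasure (lebesgue_on S) (E k))"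
    using E by (simp add: nn_integral_add nn_integral_suminf nn_integral_cmult_indicator)
  also have "\<dots> \<le> emeasure lebesgue S + (\<Sum>k. ennreal (2 powr q * C powr p * (2 powr (q - p)) ^ k))"
  proof (intro add_mono suminf_le)
    fix k
    have "ennreal ((2 ^ Suc k) powr q) * emeasure (lebesgue_on S) (E k)
      \<le> ennreal ((2 ^ Suc k) powr q) * ennreal ((C / 2 ^ k) powr p)" by (intro mult_left_mono meas) simp
    also have "\<dots> = ennreal (2 powr q * C powr p * (2 powr (q - p)) ^ k)"
    proof -
      have "(2 ^ Suc k) powr q = 2 powr q * (2 powr (k * q))"
        by (simp add: powr_mult powr_powr flip: powr_realpow)
      moreover have "(C / 2 ^ k) powr p = C powr p / 2 powr (k * p)"
        using C(1) by (simp add: powr_divide powr_powr flip: powr_realpow)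
      moreover have "(2 powr (q - p)) ^ k = 2 powr (k * q) / 2 powr (k * p)"
        by (simp add: powr_diff[symmetric] powr_powr algebra_simps flip: powr_realpow)
      ultimately show ?thesis by (simp add: ennreal_mult[symmetric] mult_ac)
    qed
    finally show "ennreal ((2 ^ Suc k) powr q) * emeasure (lebesgue_on S) (E k)
      \<le> ennreal (2 powr q * C powr p * (2 powr (q - p)) ^ k)" .
  qed (use S in \<open>auto simp: emeasure_restrict_space space_restrict_space\<close>)
  also have "\<dots> < \<infinity>"
  proof -
    have "summable (\<lambda>k. 2 powr q * C powr p * (2 powr (q - p)) ^ k)"
      using q by (intro summable_mult summable_geometric) (simp add: powr_less_one)
    then have "(\<Sum>k. ennreal (2 powr q * C powr p * (2 powr (q - p)) ^ k)) < \<infinity>"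
      by (subst suminf_ennreal2) auto
    then show ?thesis using fin by simp
  qed
  finally show ?thesis .
qed


section \<open>The Jordan decomposition of a signed measure\<close>

lemma signed_measure_empty: "signed_measure M f \<Longrightarrow> f {} = 0"
  by (simp add: signed_measure_def)

lemma signed_measure_uminus: "signed_measure M f \<Longrightarrow> signed_measure M (\<lambda>A. - f A)"
  by (auto simp: signed_measure_def intro: sums_minus)

lemma signed_measure_Un:
  assumes f: "signed_measure M f" and "A \<in> sets M" "B \<in> sets M" "A \<inter> B = {}"
  shows "f (A \<union> B) = f A + f B"
proof -
  have "disjoint_family (binaryset A B)"
    using assms(4) by (simp add: disjoint_family_on_def binaryset_def Int_commute)
  moreover have "range (binaryset A B) \<subseteq> sets M"
    using assms(2,3) by (simp add: range_binaryset_eq)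
  ultimately have "(\<lambda>i. f (binaryset A B i)) sums f (\<Union>i. binaryset A B i)"
    using f unfolding signed_measure_def by blast
  moreover have "(\<lambda>i. f (binaryset A B i)) sums (f A + f B)"
    using binaryset_sums[of f A B] signed_measure_empty[OF f] by simp
  ultimately show ?thesis by (simp add: UN_binaryset_eq sums_unique2)
qed

lemma upper_var_upper: "B \<in> sets M \<Longrightarrow> B \<subseteq> A \<Longrightarrow> ennreal (f B) \<le> upper_var M f A"
  unfolding upper_var_def by (rule SUP_upper) auto

lemma upper_var_mono: "A \<subseteq> B \<Longrightarrow> upper_var M f A \<le> upper_var M f B"
  unfolding upper_var_def by (rule SUP_subset_mono) auto

text \<open>Subsets on which \<open>f\<close> is negative may be replaced by the empty set, so that two suprema of nonnegative numbers
are added; the union of the two subsets is then a competitor for the union.\<close>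

lemma upper_var_superadditive:
  assumes f: "signed_measure M f" and "A1 \<inter> A2 = {}"
  shows "upper_var M f A1 + upper_var M f A2 \<le> upper_var M f (A1 \<union> A2)"
proof -
  have ne: "{B \<in> sets M. B \<subseteq> A} \<noteq> {}" for A by auto
  have "ennreal (f B1) + ennreal (f B2) \<le> upper_var M f (A1 \<union> A2)"
    if B: "B1 \<in> sets M" "B1 \<subseteq> A1" "B2 \<in> sets M" "B2 \<subseteq> A2" for B1 B2
  proof -
    consider "f B1 < 0" | "f B2 < 0" | "f B1 \<ge> 0" "f B2 \<ge> 0" by linarith
    then show ?thesis
    proof cases
      case 3
      have "f (B1 \<union> B2) = f B1 + f B2"
        using assms B by (intro signed_measure_Un) auto
      then show ?thesis using 3 upper_var_upper[of "B1 \<union> B2" M "A1 \<union> A2" f] B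
        by (auto simp: ennreal_plus[symmetric] simp del: ennreal_plus)
    qed (use upper_var_upper[of B1 M "A1 \<union> A2" f] upper_var_upper[of B2 M "A1 \<union> A2" f] B in \<open>auto simp: ennreal_neg\<close>)
  qed
  then have "ennreal (f B1) + upper_var M f A2 \<le> upper_var M f (A1 \<union> A2)"
    if "B1 \<in> sets M" "B1 \<subseteq> A1" for B1
    unfolding upper_var_def[of _ _ A2] using that
    by (subst ennreal_SUP_add_right[OF ne]) (auto intro!: SUP_least)
  then show ?thesis
    unfolding upper_var_def[of _ _ A1]
    by (subst ennreal_SUP_add_left[OF ne, symmetric]) (auto intro!: SUP_least)
qed

text \<open>This is what makes \<open>measure_of\<close> return the upper variation: for a set function that is not countably additive
it returns the zero measure.\<close>

lemma upper_var_countably_additive: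
  assumes f: "signed_measure M f"
  shows "countably_additive (sets M) (upper_var M f)"
  unfolding countably_additive_def
proof (intro allI impI)
  fix A :: "nat \<Rightarrow> 'a set"
  assume A: "range A \<subseteq> sets M" "disjoint_family A" "(\<Union>i. A i) \<in> sets M"
  show "(\<Sum>i. upper_var M f (A i)) = upper_var M f (\<Union>i. A i)"
  proof (rule antisym)
    have "(\<Sum>i<n. upper_var M f (A i)) \<le> upper_var M f (\<Union>i<n. A i)" for n
    proof (induction n)
      case (Suc n)
      have "A i \<inter> A n = {}" if "i < n" for i
        using A(2) that by (simp add: disjoint_family_on_def)
      then have disj: "(\<Union>i<n. A i) \<inter> A n = {}" by blast
      have "(\<Sum>i<Suc n. upper_var M f (A i)) \<le> upper_var M f (\<Union>i<n. A i) + upper_var M f (A n)"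
        using Suc by (simp add: add_right_mono)
      also have "\<dots> \<le> upper_var M f ((\<Union>i<n. A i) \<union> A n)"
        by (rule upper_var_superadditive[OF f disj])
      also have "(\<Union>i<n. A i) \<union> A n = (\<Union>i<Suc n. A i)" by (simp add: lessThan_Suc Un_commute)
      finally show ?case .
    qed simp
    also have "upper_var M f (\<Union>i<n. A i) \<le> upper_var M f (\<Union>i. A i)" for n
      by (rule upper_var_mono) auto
    finally show "(\<Sum>i. upper_var M f (A i)) \<le> upper_var M f (\<Union>i. A i)"
      by (intro suminf_le_const) auto
  next
    show "upper_var M f (\<Union>i. A i) \<le> (\<Sum>i. upper_var M f (A i))"
      unfolding upper_var_def[of _ _ "\<Union>i. A i"]
    proof (rule SUP_least, clarsimp)
      fix B assume B: "B \<in> sets M" "B \<subseteq> (\<Union>i. A i)"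
      have "(\<lambda>i. f (B \<inter> A i)) sums f (\<Union>i. B \<inter> A i)"
      proof -
        have "disjoint_family (\<lambda>i. B \<inter> A i)" using A(2) by (fastforce simp: disjoint_family_on_def)
        moreover have "range (\<lambda>i. B \<inter> A i) \<subseteq> sets M" using A(1) B(1) by auto
        ultimately show ?thesis using f unfolding signed_measure_def by blast
      qed
      moreover have "(\<Union>i. B \<inter> A i) = B" using B by auto
      ultimately have "(\<lambda>n. ennreal (\<Sum>i<n. f (B \<inter> A i))) \<longlonglongrightarrow> ennreal (f B)"
        by (auto simp: sums_def intro: tendsto_ennrealI)
      then show "ennreal (f B) \<le> (\<Sum>i. upper_var M f (A i))"
      proof (rule LIMSEQ_le_const2, intro exI allI impI)
        fix n
        have "ennreal (\<Sum>i<n. f (B \<inter> A i)) \<le> ennreal (\<Sum>i<n. max 0 (f (B \<inter> A i)))"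
          by (intro ennreal_leI sum_mono) auto
        also have "\<dots> = (\<Sum>i<n. ennreal (max 0 (f (B \<inter> A i))))" by (simp add: sum_ennreal)
        also have "\<dots> \<le> (\<Sum>i<n. upper_var M f (A i))"
          using A B by (intro sum_mono) (auto simp: max_def intro!: upper_var_upper)
        also have "\<dots> \<le> (\<Sum>i. upper_var M f (A i))" by (intro sum_le_suminf) auto
        finally show "ennreal (\<Sum>i<n. f (B \<inter> A i)) \<le> (\<Sum>i. upper_var M f (A i))" .
      qed
    qed
  qed
qed

abbreviation upper_measure :: "'a measure \<Rightarrow> ('a set \<Rightarrow> real) \<Rightarrow> 'a measure" where
  "upper_measure M f \<equiv> measure_of (space M) (sets M) (upper_var M f)"

abbreviation lower_measure :: "'a measure \<Rightarrow> ('a set \<Rightarrow> real) \<Rightarrow> 'a measure" where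
  "lower_measure M f \<equiv> upper_measure M (\<lambda>B. - f B)"

lemma space_upper_measure: "space (upper_measure M f) = space M"
  by (simp add: space_measure_of sets.space_closed)

lemma sets_upper_measure: "sets (upper_measure M f) = sets M"
  by (rule sets.sets_measure_of_eq)

lemma measurable_ident_upper_measure:
  "(\<lambda>x. x) \<in> measurable (upper_measure (restrict_space borel S) g) borel"
  by (subst measurable_cong_sets[OF sets_upper_measure refl]) (auto intro: measurable_restrict_space1)

lemma emeasure_upper_measure:
  assumes f: "signed_measure M f" and A: "A \<in> sets M"
  shows "emeasure (upper_measure M f) A = upper_var M f A"
proof (rule emeasure_measure_of_sigma)
  show "sigma_algebra (space M) (sets M)" by (rule sets.sigma_algebra_axioms)
  show "positive (sets M) (upper_var M f)"
  proof -
    have "{B \<in> sets M. B \<subseteq> {}} = {{}}" by auto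
    then show ?thesis using signed_measure_empty[OF f] by (simp add: positive_def upper_var_def)
  qed
  show "countably_additive (sets M) (upper_var M f)" by (rule upper_var_countably_additive[OF f])
qed fact

text \<open>From \<open>f B = f A - f (A - B)\<close>, maximising \<open>f\<close> over the subsets of \<open>A\<close> is the same as maximising \<open>- f\<close>, up to the
constant \<open>f A\<close>.\<close>

lemma jordan_decomposition:
  assumes f: "signed_measure M f" and A: "A \<in> sets M"
    and fin: "upper_var M f A < \<infinity>" "upper_var M (\<lambda>B. - f B) A < \<infinity>"
  shows "f A = enn2real (upper_var M f A) - enn2real (upper_var M (\<lambda>B. - f B) A)"
proof -
  have le: "enn2real (upper_var M f A) \<le> f A + enn2real (upper_var M (\<lambda>B. - f B) A)"
    if f: "signed_measure M f" and fin: "upper_var M f A < \<infinity>" "upper_var M (\<lambda>B. - f B) A < \<infinity>" for f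
  proof -
    define Q where "Q = enn2real (upper_var M (\<lambda>B. - f B) A)"
    have Q: "- f B \<le> Q" if "B \<in> sets M" "B \<subseteq> A" for B
      using upper_var_upper[OF that, of "\<lambda>B. - f B"] fin(2) unfolding Q_def
      by (cases "upper_var M (\<lambda>B. - f B) A") (auto simp: ennreal_le_iff2)
    have "upper_var M f A \<le> ennreal (f A + Q)"
      unfolding upper_var_def
    proof (rule SUP_least, clarsimp, rule ennreal_leI)
      fix B assume B: "B \<in> sets M" "B \<subseteq> A"
      then have "f A = f B + f (A - B)"
        using signed_measure_Un[OF f, of B "A - B"] A by (simp add: Un_absorb1)
      then show "f B \<le> f A + Q" using Q[of "A - B"] A B by auto
    qed
    then show ?thesis using Q[OF A] enn2real_leI unfolding Q_def by force
  qed
  have "enn2real (upper_var M (\<lambda>B. - f B) A) \<le> - f A + enn2real (upper_var M f A)"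
    using le[OF signed_measure_uminus[OF f]] fin by simp
  with le[OF f fin] show ?thesis by linarith
qed


section \<open>Riesz kernels\<close>

text \<open>The kernel \<open>|x - y|\<^bsup>- b\<^esup>\<close>.  The value infinity on the diagonal keeps it an upper bound of the Newtonian kernels also
at the atoms of a measure in the variable \<open>y\<close>.\<close>

definition riesz :: "real \<Rightarrow> real ^ 'n \<Rightarrow> real ^ 'n \<Rightarrow> ennreal" where
  "riesz b x y = (if x = y then \<infinity> else ennreal (dist x y powr (- b)))"

definition riesz_pot :: "(real ^ 'n) set \<Rightarrow> real \<Rightarrow> (real ^ 'n \<Rightarrow> ennreal) \<Rightarrow> real ^ 'n \<Rightarrow> ennreal" where
  "riesz_pot S b g x = (\<integral>\<^sup>+y\<in>S. riesz b x y * g y \<partial>lborel)"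

lemma riesz_commute: "riesz b x y = riesz b y x"
  by (simp add: riesz_def dist_commute)

lemma riesz_pos: "riesz b x y \<noteq> 0"
  by (simp add: riesz_def)

lemma measurable_riesz [measurable]:
  assumes [measurable]: "f \<in> borel_measurable M" "g \<in> borel_measurable M"
  shows "(\<lambda>z. riesz b (f z) (g z)) \<in> borel_measurable M"
  unfolding riesz_def by measurable

lemma measurable_nn_integral_riesz:
  fixes S :: "(real ^ 'n) set"
  assumes "finite_measure \<nu>" and [measurable_cong]: "sets \<nu> = sets borel" and [measurable]: "S \<in> sets borel"
  shows "(\<lambda>x. \<integral>\<^sup>+y\<in>S. riesz b x y \<partial>\<nu>) \<in> borel_measurable borel"
proof -
  interpret finite_measure \<nu> by fact
  show ?thesis by (rule borel_measurable_nn_integral) measurable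
qed

lemma bounded_dist_less:
  fixes S :: "'a::metric_space set"
  assumes "bounded S"
  shows "\<exists>R>0. \<forall>x\<in>S. \<forall>y\<in>S. dist x y < R"
  using diameter_ge_0[OF assms] diameter_bounded_bound[OF assms]
  by (intro exI[of _ "diameter S + 1"]) force

lemma riesz_mono_exponent:
  assumes "b \<le> b'" "dist x y \<le> R" "R > 0"
  shows "riesz b x y \<le> ennreal (R powr (b' - b)) * riesz b' x y"
proof (cases "x = y")
  case True
  then show ?thesis using assms by (simp add: riesz_def ennreal_mult_top)
next
  case False
  have "dist x y powr (- b) = dist x y powr (b' - b) * dist x y powr (- b')"
    using False by (simp flip: powr_add)
  also have "\<dots> \<le> R powr (b' - b) * dist x y powr (- b')"
    using assms by (intro mult_right_mono powr_mono2) auto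
  finally show ?thesis using False by (simp add: riesz_def ennreal_mult[symmetric] ennreal_leI)
qed

text \<open>The pointwise inequality behind the iteration; it replaces the composition formula for Riesz kernels.  The larger
of \<open>|x - y|\<close> and \<open>|y - z|\<close> is at least \<open>|x - z| / 2\<close>.  Extract the power \<open>b - e\<close> from the factor that contains the larger
distance, and replace the rest of that factor by the smaller distance.  What remains is a power \<open>- (s + e)\<close> of the
smaller distance.\<close>

lemma riesz_mult_le:
  assumes "0 \<le> e" "e \<le> b" "b - e \<le> s"
  shows "riesz b x y * riesz s y z
    \<le> ennreal (2 powr (b - e)) * riesz (b - e) x z * (riesz (s + e) x y + riesz (s + e) y z)"
proof (cases "x = y \<or> y = z \<or> x = z")
  case True
  have "ennreal (2 powr (b - e)) * riesz (b - e) x z * (riesz (s + e) x y + riesz (s + e) y z) = \<infinity>"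
  proof (cases "x = z")
    case True
    then have "riesz (b - e) x z = \<infinity>" by (simp add: riesz_def)
    then show ?thesis using riesz_pos[of "s + e" x y] by (simp add: ennreal_mult_top ennreal_top_mult)
  next
    case False
    with \<open>x = y \<or> y = z \<or> x = z\<close> have "riesz (s + e) x y + riesz (s + e) y z = \<infinity>"
      by (auto simp: riesz_def)
    then show ?thesis using riesz_pos[of "b - e" x z] by (simp only:) (simp add: ennreal_mult_top)
  qed
  then show ?thesis by simp
next
  case False
  define A B d where "A = dist x y" and "B = dist y z" and "d = dist x z"
  have pos: "A > 0" "B > 0" "d > 0" and d: "d \<le> A + B"
    using False by (auto simp: A_def B_def d_def dist_triangle)
  have half: "M powr (- c) \<le> 2 powr c * d powr (- c)" if "d \<le> 2 * M" "M > 0" "c \<ge> 0" for M c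
  proof -
    have "M powr (- c) \<le> (d / 2) powr (- c)"
      using that pos by (intro powr_mono2') auto
    also have "\<dots> = 2 powr c * d powr (- c)"
      using pos by (simp add: powr_divide powr_minus field_simps)
    finally show ?thesis .
  qed
  have "A powr (- b) * B powr (- s) \<le> 2 powr (b - e) * d powr (- (b - e)) * (A powr (- (s + e)) + B powr (- (s + e)))"
  proof (cases "A \<le> B")
    case True
    have "A powr (- b) * B powr (- s) = A powr (- b) * (B powr (- (b - e)) * B powr (- (s - b + e)))"
      by (simp flip: powr_add)
    also have "\<dots> \<le> A powr (- b) * ((2 powr (b - e) * d powr (- (b - e))) * A powr (- (s - b + e)))"
      using True d pos assms by (intro mult_left_mono mult_mono half powr_mono2') auto
    also have "\<dots> = 2 powr (b - e) * d powr (- (b - e)) * (A powr (- b) * A powr (- (s - b + e)))" by simp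
    also have "A powr (- b) * A powr (- (s - b + e)) = A powr (- (s + e))"
      by (simp flip: powr_add)
    also have "2 powr (b - e) * d powr (- (b - e)) * A powr (- (s + e))
      \<le> 2 powr (b - e) * d powr (- (b - e)) * (A powr (- (s + e)) + B powr (- (s + e)))"
      by (intro mult_left_mono) auto
    finally show ?thesis .
  next
    case False
    have "A powr (- b) * B powr (- s) = A powr (- (b - e)) * A powr (- e) * B powr (- s)"
      by (simp flip: powr_add)
    also have "\<dots> \<le> (2 powr (b - e) * d powr (- (b - e))) * B powr (- e) * B powr (- s)"
      using False d pos assms by (intro mult_right_mono mult_mono half powr_mono2') auto
    also have "\<dots> = 2 powr (b - e) * d powr (- (b - e)) * (B powr (- e) * B powr (- s))" by simp
    also have "B powr (- e) * B powr (- s) = B powr (- (s + e))"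
      by (simp add: add.commute flip: powr_add)
    also have "2 powr (b - e) * d powr (- (b - e)) * B powr (- (s + e))
      \<le> 2 powr (b - e) * d powr (- (b - e)) * (A powr (- (s + e)) + B powr (- (s + e)))"
      by (intro mult_left_mono) auto
    finally show ?thesis .
  qed
  then show ?thesis using False
    by (simp add: riesz_def A_def B_def d_def ennreal_mult[symmetric] ennreal_plus[symmetric] ennreal_leI del: ennreal_plus)
qed

lemma emeasure_ball_scale:
  fixes x :: "real ^ 'n"
  assumes "r \<ge> 0"
  shows "emeasure lborel (ball x r) = ennreal (r ^ CARD('n)) * emeasure lborel (ball (0 :: real ^ 'n) 1)"
  using emeasure_lebesgue_ball_conv_unit_ball[OF assms, of x] by simp

text \<open>Dyadic shells: where \<open>|x - y|\<close> is between \<open>R / 2\<^bsup>k+1\<^esup>\<close> and \<open>R / 2\<^sup>k\<close>, the integral is of the order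
\<open>2\<^bsup>k (a - n)\<^esup>\<close> with \<open>n\<close> the dimension.\<close>

lemma riesz_integral_ball:
  fixes x :: "real ^ 'n"
  assumes a: "0 \<le> a" "a < real CARD('n)" and R: "R > 0"
  obtains D where "D < \<infinity>" "\<And>x :: real ^ 'n. (\<integral>\<^sup>+y\<in>ball x R. riesz a x y \<partial>lborel) \<le> D"
proof (rule that)
  define n where "n = real CARD('n)"
  define c where "c = emeasure lborel (ball (0 :: real ^ 'n) 1)"
  define D where "D = (\<Sum>k. ennreal (2 powr a * R powr (n - a) * (2 powr (a - n)) ^ k)) * c"
  show "D < \<infinity>"
  proof -
    have "summable (\<lambda>k. 2 powr a * R powr (n - a) * (2 powr (a - n)) ^ k)"
      using a by (intro summable_mult summable_geometric) (simp add: n_def powr_less_one)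
    then have "(\<Sum>k. ennreal (2 powr a * R powr (n - a) * (2 powr (a - n)) ^ k)) < \<infinity>"
      by (subst suminf_ennreal2) auto
    then show ?thesis unfolding D_def c_def
      using emeasure_lborel_ball_finite[of "0 :: real ^ 'n" 1] by (simp add: ennreal_mult_less_top)
  qed
  fix x :: "real ^ 'n"
  have le: "riesz a x y * indicator (ball x R) y \<le> (\<Sum>k. ennreal ((R / 2 ^ Suc k) powr (- a)) * indicator (ball x (R / 2 ^ k)) y)"
    if "y \<noteq> x" for y
  proof (cases "y \<in> ball x R")
    case True
    define P where "P k \<longleftrightarrow> R / 2 ^ k \<le> dist x y" for k :: nat
    have "dist x y > 0" using that by simp
    obtain k where "R / dist x y < 2 ^ k" using real_arch_pow[of 2 "R / dist x y"] by auto
    then have "P k" using \<open>dist x y > 0\<close> by (simp add: P_def field_simps)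
    then have *: "P (LEAST k. P k)" by (rule LeastI)
    moreover have "\<not> P 0" using True by (simp add: P_def)
    ultimately obtain k where k: "(LEAST k. P k) = Suc k" by (metis not0_implies_Suc)
    then have "\<not> P k" using not_less_Least[of k P] by simp
    then have in_ball: "y \<in> ball x (R / 2 ^ k)" and d: "R / 2 ^ Suc k \<le> dist x y"
      using * k by (auto simp: P_def)
    have "dist x y powr (- a) \<le> (R / 2 ^ Suc k) powr (- a)"
      using d a R by (intro powr_mono2') auto
    then have "riesz a x y * indicator (ball x R) y \<le> ennreal ((R / 2 ^ Suc k) powr (- a)) * indicator (ball x (R / 2 ^ k)) y"
      using that True in_ball by (simp add: riesz_def ennreal_leI)
    also have "\<dots> \<le> (\<Sum>k. ennreal ((R / 2 ^ Suc k) powr (- a)) * indicator (ball x (R / 2 ^ k)) y)"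
      by (rule ennreal_le_suminf)
    finally show ?thesis .
  qed simp
  have "(\<integral>\<^sup>+y\<in>ball x R. riesz a x y \<partial>lborel)
     \<le> (\<integral>\<^sup>+y. (\<Sum>k. ennreal ((R / 2 ^ Suc k) powr (- a)) * indicator (ball x (R / 2 ^ k)) y) \<partial>lborel)"
  proof (rule nn_integral_mono_AE)
    show "AE y in lborel. riesz a x y * indicator (ball x R) y
      \<le> (\<Sum>k. ennreal ((R / 2 ^ Suc k) powr (- a)) * indicator (ball x (R / 2 ^ k)) y)"
      using AE_lborel_singleton[of x] by eventually_elim (rule le)
  qed
  also have "\<dots> = (\<Sum>k. ennreal ((R / 2 ^ Suc k) powr (- a)) * emeasure lborel (ball x (R / 2 ^ k)))"
    by (rule nn_integral_suminf_balls)
  also have "\<dots> = (\<Sum>k. ennreal (2 powr a * R powr (n - a) * (2 powr (a - n)) ^ k) * c)"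
  proof (intro suminf_cong)
    fix k
    have two: "R / 2 ^ k = R * 2 powr (- real k)" "R / 2 ^ Suc k = R * 2 powr (- (real k + 1))"
      by (simp_all add: powr_add powr_realpow powr_minus powr_diff field_simps)
    have "(R / 2 ^ Suc k) powr (- a) = R powr (- a) * 2 powr ((real k + 1) * a)"
      unfolding two using R by (subst powr_mult) (simp_all only: powr_powr minus_mult_minus)
    moreover have "(R / 2 ^ k) ^ CARD('n) = R powr n * 2 powr (- (k * n))"
    proof -
      have "(R / 2 ^ k) ^ CARD('n) = (R / 2 ^ k) powr n" using R by (simp add: n_def powr_realpow)
      also have "\<dots> = R powr n * 2 powr (- (k * n))"
        unfolding two using R by (subst powr_mult) (simp_all only: powr_powr mult_minus_left)
      finally show ?thesis .
    qed
    moreover have "(2 powr (a - n)) ^ k = 2 powr ((a - n) * k)"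
      by (simp add: powr_powr flip: powr_realpow)
    moreover have "R powr (- a) * 2 powr ((real k + 1) * a) * (R powr n * 2 powr (- (k * n)))
       = (R powr (- a) * R powr n) * (2 powr ((real k + 1) * a) * 2 powr (- (k * n)))" by simp
    moreover have "\<dots> = R powr (n - a) * 2 powr (a + (a - n) * k)"
      by (simp add: powr_add[symmetric] algebra_simps)
    ultimately have "(R / 2 ^ Suc k) powr (- a) * (R / 2 ^ k) ^ CARD('n) = 2 powr a * R powr (n - a) * (2 powr (a - n)) ^ k"
      by (simp add: powr_add)
    then show "ennreal ((R / 2 ^ Suc k) powr (- a)) * emeasure lborel (ball x (R / 2 ^ k))
      = ennreal (2 powr a * R powr (n - a) * (2 powr (a - n)) ^ k) * c"
      using R by (simp only: emeasure_ball_scale c_def[symmetric] divide_nonneg_nonneg less_imp_le zero_le_power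
          zero_le_numeral mult.assoc[symmetric] ennreal_mult[symmetric] powr_ge_zero)
  qed
  also have "\<dots> = D" by (simp add: D_def ennreal_suminf_multc)
  finally show "(\<integral>\<^sup>+y\<in>ball x R. riesz a x y \<partial>lborel) \<le> D" .
qed

text \<open>Young's inequality without constants: either the product is at most the first term, or the kernel is at most
\<open>w\<^bsup>r - 1\<^esup>\<close> and the product is at most the second.\<close>

lemma riesz_young:
  assumes r: "r > 1" and w: "w \<ge> 0"
  shows "riesz b x y * ennreal w \<le> riesz (b * (r / (r - 1))) x y + ennreal (w powr r)"
proof (cases "x = y")
  case False
  define a where "a = dist x y powr (- b)"
  have a: "a > 0" using False by (simp add: a_def)
  have "a * w \<le> a powr (r / (r - 1)) + w powr r"
  proof (cases "w = 0 \<or> w \<le> a powr (1 / (r - 1))")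
    case True
    have "a * a powr (1 / (r - 1)) = a powr (1 + 1 / (r - 1))" using a by (simp add: powr_add)
    also have "1 + 1 / (r - 1) = r / (r - 1)" using r by (simp add: field_simps)
    finally have "a * a powr (1 / (r - 1)) = a powr (r / (r - 1))" .
    then show ?thesis using True a by (metis add_increasing2 mult_left_mono less_imp_le powr_ge_zero mult_zero_right add_nonneg_nonneg)
  next
    case False
    then have "a powr (1 / (r - 1)) \<le> w" "w > 0" using w by auto
    then have "(a powr (1 / (r - 1))) powr (r - 1) \<le> w powr (r - 1)"
      using r by (intro powr_mono2) auto
    then have "a \<le> w powr (r - 1)" using a r by (simp add: powr_powr)
    then have "a * w \<le> w powr (r - 1) * w" using w by (rule mult_right_mono)
    also have "\<dots> = w powr r" using \<open>w > 0\<close> by (simp add: powr_diff)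
    finally show ?thesis by (simp add: add_increasing)
  qed
  moreover have "a powr (r / (r - 1)) = dist x y powr (- (b * (r / (r - 1))))"
    by (simp add: a_def powr_powr)
  ultimately show ?thesis using False w
    by (simp add: riesz_def a_def ennreal_mult[symmetric] ennreal_plus[symmetric] ennreal_leI del: ennreal_plus)
qed (simp add: riesz_def)

lemma riesz_pot_bounded:
  fixes S :: "(real ^ 'n) set" and w :: "real ^ 'n \<Rightarrow> real"
  assumes S: "bounded S" "S \<in> sets borel" and w: "w \<in> borel_measurable borel" "\<And>x. w x \<ge> 0"
    and r: "r > 1" and fin: "(\<integral>\<^sup>+x\<in>S. ennreal (w x powr r) \<partial>lborel) < \<infinity>"
    and b: "0 \<le> b" "b * (r / (r - 1)) < real CARD('n)"
  obtains D where "D < \<infinity>" "\<And>x. x \<in> S \<Longrightarrow> riesz_pot S b (\<lambda>y. ennreal (w y)) x \<le> D"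
proof -
  note [measurable] = S(2) w(1)
  obtain R where R: "R > 0" "\<And>x y. x \<in> S \<Longrightarrow> y \<in> S \<Longrightarrow> dist x y < R"
    using bounded_dist_less[OF S(1)] by blast
  obtain D where D: "D < \<infinity>" "\<And>x :: real ^ 'n. (\<integral>\<^sup>+y\<in>ball x R. riesz (b * (r / (r - 1))) x y \<partial>lborel) \<le> D"
    using riesz_integral_ball[of "b * (r / (r - 1))" R] b r R by auto
  show ?thesis
  proof (rule that)
    show "D + (\<integral>\<^sup>+x\<in>S. ennreal (w x powr r) \<partial>lborel) < \<infinity>" using D fin by simp
    fix x assume x: "x \<in> S"
    have "riesz_pot S b (\<lambda>y. ennreal (w y)) x
       \<le> (\<integral>\<^sup>+y. riesz (b * (r / (r - 1))) x y * indicator (ball x R) y + ennreal (w y powr r) * indicator S y \<partial>lborel)"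
      unfolding riesz_pot_def
    proof (rule nn_integral_mono)
      fix y
      show "riesz b x y * ennreal (w y) * indicator S y
         \<le> riesz (b * (r / (r - 1))) x y * indicator (ball x R) y + ennreal (w y powr r) * indicator S y"
        using riesz_young[OF r w(2), of b x y] R(2)[OF x, of y] by (cases "y \<in> S") auto
    qed
    also have "\<dots> = (\<integral>\<^sup>+y\<in>ball x R. riesz (b * (r / (r - 1))) x y \<partial>lborel) + (\<integral>\<^sup>+x\<in>S. ennreal (w x powr r) \<partial>lborel)"
    proof (rule nn_integral_add)
      have [measurable]: "ball x R \<in> sets borel" "(\<lambda>x. w x powr r) \<in> borel_measurable borel" by simp_all
      show "(\<lambda>y. riesz (b * (r / (r - 1))) x y * indicator (ball x R) y) \<in> borel_measurable lborel"
        by measurable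
      show "(\<lambda>y. ennreal (w y powr r) * indicator S y) \<in> borel_measurable lborel" by simp
    qed
    also have "\<dots> \<le> D + (\<integral>\<^sup>+x\<in>S. ennreal (w x powr r) \<partial>lborel)"
      by (intro add_right_mono D)
    finally show "riesz_pot S b (\<lambda>y. ennreal (w y)) x \<le> D + (\<integral>\<^sup>+x\<in>S. ennreal (w x powr r) \<partial>lborel)" .
  qed
qed

lemma measurable_riesz_pot [measurable]:
  fixes S :: "(real ^ 'n) set"
  assumes [measurable]: "S \<in> sets borel" "g \<in> borel_measurable borel"
  shows "riesz_pot S b g \<in> borel_measurable borel"
proof -
  have "(\<lambda>x. \<integral>\<^sup>+y\<in>S. riesz b x y * g y \<partial>lborel) \<in> borel_measurable borel"
    by (rule sigma_finite_measure.borel_measurable_nn_integral[OF sigma_finite_lborel]) measurable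
  then show ?thesis by (simp add: riesz_pot_def[abs_def])
qed

text \<open>One step of the iteration.  By Tonelli and \<open>riesz_mult_le\<close>, the new potential is at most the old one with kernel
exponent \<open>b\<close>, times two potentials of \<open>w\<close>; thus multiplying by \<open>w\<close> after taking the potential of order \<open>s\<close> raises the
admissible exponent by \<open>e\<close>.\<close>

lemma riesz_pot_step:
  fixes S :: "(real ^ 'n) set"
  assumes [measurable]: "S \<in> sets borel" "g \<in> borel_measurable borel" "w \<in> borel_measurable borel"
    and e: "0 \<le> e" "0 \<le> b" "b \<le> s"
    and D: "\<And>x. x \<in> S \<Longrightarrow> riesz_pot S (s + e) w x \<le> D"
    and A: "\<And>x. x \<in> S \<Longrightarrow> riesz_pot S b g x \<le> A"
    and x: "x \<in> S"
  shows "riesz_pot S (b + e) (\<lambda>y. w y * riesz_pot S s g y) x \<le> ennreal (2 powr b) * (2 * D) * A"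
proof -
  have "riesz_pot S (b + e) (\<lambda>y. w y * riesz_pot S s g y) x
    = (\<integral>\<^sup>+y. (\<integral>\<^sup>+z. riesz (b + e) x y * w y * indicator S y * (riesz s y z * g z * indicator S z) \<partial>lborel) \<partial>lborel)"
    unfolding riesz_pot_def by (subst nn_integral_cmult) (auto simp: mult_ac)
  also have "\<dots> = (\<integral>\<^sup>+z. (\<integral>\<^sup>+y. riesz (b + e) x y * w y * indicator S y * (riesz s y z * g z * indicator S z) \<partial>lborel) \<partial>lborel)"
    by (rule lborel_pair.Fubini') measurable
  also have "\<dots> \<le> (\<integral>\<^sup>+z. ennreal (2 powr b) * (2 * D) * (riesz b x z * g z * indicator S z) \<partial>lborel)"
  proof (rule nn_integral_mono)
    fix z
    show "(\<integral>\<^sup>+y. riesz (b + e) x y * w y * indicator S y * (riesz s y z * g z * indicator S z) \<partial>lborel)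
       \<le> ennreal (2 powr b) * (2 * D) * (riesz b x z * g z * indicator S z)"
    proof (cases "z \<in> S")
      case True
      have "(\<integral>\<^sup>+y. riesz (b + e) x y * w y * indicator S y * (riesz s y z * g z * indicator S z) \<partial>lborel)
        \<le> (\<integral>\<^sup>+y. (ennreal (2 powr b) * riesz b x z * g z) * (riesz (s + e) x y * w y * indicator S y + riesz (s + e) z y * w y * indicator S y) \<partial>lborel)"
      proof (rule nn_integral_mono)
        fix y
        have "riesz (b + e) x y * w y * indicator S y * (riesz s y z * g z * indicator S z)
           = (riesz (b + e) x y * riesz s y z) * (w y * indicator S y * g z)"
          using True by (simp add: mult_ac)
        also have "\<dots> \<le> (ennreal (2 powr b) * riesz b x z * (riesz (s + e) x y + riesz (s + e) y z)) * (w y * indicator S y * g z)"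
          using riesz_mult_le[of e "b + e" s x y z] e by (intro mult_right_mono) auto
        also have "\<dots> = (ennreal (2 powr b) * riesz b x z * g z) * (riesz (s + e) x y * w y * indicator S y + riesz (s + e) z y * w y * indicator S y)"
          by (simp add: riesz_commute[of _ y z] distrib_left distrib_right mult_ac)
        finally show "riesz (b + e) x y * w y * indicator S y * (riesz s y z * g z * indicator S z)
          \<le> (ennreal (2 powr b) * riesz b x z * g z) * (riesz (s + e) x y * w y * indicator S y + riesz (s + e) z y * w y * indicator S y)" .
      qed
      also have "\<dots> = (ennreal (2 powr b) * riesz b x z * g z) * (riesz_pot S (s + e) w x + riesz_pot S (s + e) w z)"
        unfolding riesz_pot_def by (subst nn_integral_cmult, measurable, subst nn_integral_add, measurable)
      also have "\<dots> \<le> (ennreal (2 powr b) * riesz b x z * g z) * (D + D)"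
        using D[OF x] D[OF True] by (intro mult_left_mono add_mono) auto
      also have "\<dots> = ennreal (2 powr b) * (2 * D) * (riesz b x z * g z * indicator S z)"
        using True by (simp only: mult_2[symmetric] indicator_simps mult_1_right) (simp only: mult_ac)
      finally show ?thesis .
    qed simp
  qed
  also have "\<dots> = ennreal (2 powr b) * (2 * D) * riesz_pot S b g x"
    unfolding riesz_pot_def by (rule nn_integral_cmult) measurable
  also have "\<dots> \<le> ennreal (2 powr b) * (2 * D) * A" by (intro mult_left_mono A x) auto
  finally show ?thesis .
qed


section \<open>Iterated Riesz potentials\<close>

text \<open>The regularity argument in abstract form: \<open>rep\<close> is the potential estimate, and the conclusion improves the
integrability of \<open>|u| W\<close> to that of \<open>|u| W\<^sup>2\<close>.  The induction is on the number \<open>j\<close> of steps by which the admissible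
exponent of a weight \<open>g\<close> stays below \<open>n - 1\<close>, simultaneously for all weights and all balls; balls must vary because
each use of \<open>rep\<close> enlarges the ball.\<close>

lemma riesz_bootstrap:
  fixes \<Omega> :: "(real ^ 'n) set" and u W :: "real ^ 'n \<Rightarrow> real" and \<nu> :: "'i \<Rightarrow> (real ^ 'n) measure"
  defines "n \<equiv> real CARD('n)"
  assumes n: "n \<ge> 2" and \<Omega>: "open \<Omega>" "bounded \<Omega>"
    and meas: "u \<in> borel_measurable borel" "W \<in> borel_measurable borel" and W: "\<And>x. W x \<ge> 0"
    and uW: "(\<integral>\<^sup>+x\<in>\<Omega>. ennreal (\<bar>u x\<bar> * W x) \<partial>lborel) < \<infinity>"
    and q: "q > n" and Wq: "(\<integral>\<^sup>+x\<in>\<Omega>. ennreal (W x powr q) \<partial>lborel) < \<infinity>"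
    and I: "finite I" "\<And>i. i \<in> I \<Longrightarrow> finite_measure (\<nu> i)" "\<And>i. i \<in> I \<Longrightarrow> sets (\<nu> i) = sets borel"
    and rep: "\<And>b a r. n - 2 < b \<Longrightarrow> b \<le> n - 1 \<Longrightarrow> cball a r \<subseteq> \<Omega> \<Longrightarrow>
       \<exists>r' C. cball a r' \<subseteq> \<Omega> \<and> (AE x in lborel. x \<in> cball a r \<longrightarrow>
         ennreal \<bar>u x\<bar> \<le> ennreal C * (riesz_pot (cball a r') (n - 1) (\<lambda>y. ennreal (\<bar>u y\<bar> * W y)) x
           + (\<Sum>i\<in>I. \<integral>\<^sup>+y\<in>\<Omega>. riesz b x y \<partial>\<nu> i)))"
    and ball: "cball a r \<subseteq> \<Omega>"
  shows "(\<integral>\<^sup>+x\<in>cball a r. ennreal (\<bar>u x\<bar> * (W x)\<^sup>2) \<partial>lborel) < \<infinity>"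
proof -
  have [measurable]: "\<Omega> \<in> sets borel" "cball a r \<in> sets borel" for a :: "real ^ 'n" and r using \<Omega> by auto
  note [measurable] = meas
  have nq: "n / q < 1" using n q by (simp add: divide_less_eq)
  obtain m :: nat where m: "m > 0" "1 / m < 1 - n / q"
    using nat_approx_posE[of "1 - n / q"] nq by (metis diff_gt_0_iff_gt zero_less_Suc)
  \<comment> \<open>the gain per step; a reciprocal, so that \<open>m - 1\<close> steps lead from \<open>n - 2 + e\<close> exactly to \<open>n - 1\<close>\<close>
  define e where "e = 1 / real m"
  have e: "0 < e" "e < 1 - n / q" "e \<le> 1" "real m * e = 1" using m by (auto simp: e_def)
  define s where "s = n - 1"
  define b0 where "b0 = n - 2 + e"
  have b0: "n - 2 < b0" "b0 \<le> n - 1" using e by (auto simp: b0_def)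
  obtain R where R: "R > 0" "\<And>x y. x \<in> \<Omega> \<Longrightarrow> y \<in> \<Omega> \<Longrightarrow> dist x y < R"
    using bounded_dist_less[OF \<Omega>(2)] by blast
  \<comment> \<open>the potential of order \<open>s + e\<close> of \<open>W\<close> is bounded since \<open>(s + e) q / (q - 1) < n\<close>\<close>
  have "(s + e) * q < n * (q - 1)"
  proof -
    have "(s + e) * q < (n - n / q) * q"
      using e q n by (intro mult_strict_right_mono) (auto simp: s_def)
    also have "\<dots> = n * (q - 1)" using q n by (simp add: field_simps)
    finally show ?thesis .
  qed
  then have "(s + e) * (q / (q - 1)) < n" using q n by (simp add: divide_less_eq)
  then obtain D where D: "D < \<infinity>" "\<And>x. x \<in> \<Omega> \<Longrightarrow> riesz_pot \<Omega> (s + e) (\<lambda>y. ennreal (W y)) x \<le> D"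
    using riesz_pot_bounded[OF \<Omega>(2) _ meas(2) W _ Wq, of "s + e"] q n e by (auto simp: s_def n_def)
  let ?J = "\<lambda>a r g. \<integral>\<^sup>+x\<in>cball a r. ennreal \<bar>u x\<bar> * g x \<partial>lborel"
  let ?T = "\<lambda>g y. ennreal (W y) * riesz_pot \<Omega> s g y"
  have main: "?J a r g < \<infinity>"
    if "g \<in> borel_measurable borel" "A < \<infinity>" "j < m" "\<And>x. x \<in> \<Omega> \<Longrightarrow> riesz_pot \<Omega> (s - j * e) g x \<le> A"
      "cball a r \<subseteq> \<Omega>" for g :: "real ^ 'n \<Rightarrow> ennreal" and A j a r
    using that
  proof (induction j arbitrary: g A a r)
    \<comment> \<open>the potential estimate integrated against \<open>g\<close>, up to a finite contribution \<open>K\<close> of the measures \<open>\<nu>\<close>\<close>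
    have common: "\<exists>r' C K. K < \<infinity> \<and> cball a r' \<subseteq> \<Omega> \<and> ?J a r g
       \<le> ennreal C * (?J a r' (?T g) + K)"
      if g [measurable]: "g \<in> borel_measurable borel" and A: "A < \<infinity>" and j: "j < m"
        and pot: "\<And>x. x \<in> \<Omega> \<Longrightarrow> riesz_pot \<Omega> (s - j * e) g x \<le> A" and ball: "cball a r \<subseteq> \<Omega>"
      for g :: "real ^ 'n \<Rightarrow> ennreal" and A j a r
    proof -
      obtain r' C where r': "cball a r' \<subseteq> \<Omega>" and C: "AE x in lborel. x \<in> cball a r \<longrightarrow>
         ennreal \<bar>u x\<bar> \<le> ennreal C * (riesz_pot (cball a r') (n - 1) (\<lambda>y. ennreal (\<bar>u y\<bar> * W y)) x
           + (\<Sum>i\<in>I. \<integral>\<^sup>+y\<in>\<Omega>. riesz b0 x y \<partial>\<nu> i))"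
        using rep[OF b0 ball] by blast
      \<comment> \<open>for \<open>j < m\<close> the admissible exponent is at least \<open>b0\<close>, which bounds the part with the measures \<open>\<nu>\<close>\<close>
      have "j + 1 \<le> m" using j by simp
      then have "(real j + 1) * e \<le> real m * e" using e by (intro mult_right_mono) auto
      then have "b0 \<le> s - j * e" using e by (simp add: b0_def s_def algebra_simps)
      then have pot0: "riesz_pot \<Omega> b0 g x \<le> ennreal (R powr (s - j * e - b0)) * A" if x: "x \<in> \<Omega>" for x
      proof -
        have "riesz_pot \<Omega> b0 g x \<le> (\<integral>\<^sup>+y. ennreal (R powr (s - j * e - b0)) * (riesz (s - j * e) x y * g y * indicator \<Omega> y) \<partial>lborel)"
          unfolding riesz_pot_def
        proof (rule nn_integral_mono)
          fix y
          show "riesz b0 x y * g y * indicator \<Omega> y \<le> ennreal (R powr (s - j * e - b0)) * (riesz (s - j * e) x y * g y * indicator \<Omega> y)"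
            using riesz_mono_exponent[OF \<open>b0 \<le> s - j * e\<close> less_imp_le[OF R(2)[OF x, of y]] R(1)]
            by (cases "y \<in> \<Omega>") (auto simp: mult.assoc[symmetric] intro!: mult_right_mono)
        qed
        also have "\<dots> = ennreal (R powr (s - j * e - b0)) * riesz_pot \<Omega> (s - j * e) g x"
          unfolding riesz_pot_def by (rule nn_integral_cmult) measurable
        also have "\<dots> \<le> ennreal (R powr (s - j * e - b0)) * A" by (intro mult_left_mono pot x) auto
        finally show ?thesis .
      qed
      define K where "K = (\<Sum>i\<in>I. ennreal (R powr (s - j * e - b0)) * A * emeasure (\<nu> i) (space (\<nu> i)))"
      have K: "K < \<infinity>"
      proof -
        have "emeasure (\<nu> i) (space (\<nu> i)) \<noteq> top" if "i \<in> I" for i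
          using finite_measure.emeasure_finite[OF I(2)[OF that], of "space (\<nu> i)"] by simp
        then show ?thesis
          unfolding K_def using A I(1) by (auto simp: ennreal_mult_eq_top_iff less_top[symmetric])
      qed
      have *: "(\<integral>\<^sup>+x\<in>\<Omega>. g x * (\<integral>\<^sup>+y\<in>\<Omega>. riesz b0 x y \<partial>\<nu> i) \<partial>lborel)
          \<le> ennreal (R powr (s - j * e - b0)) * A * emeasure (\<nu> i) (space (\<nu> i))" if i: "i \<in> I" for i
      proof -
        note [measurable_cong] = I(3)[OF i]
        interpret F: finite_measure "\<nu> i" using I(2)[OF i] .
        interpret PP: pair_sigma_finite lborel "\<nu> i" ..
        have "(\<integral>\<^sup>+x\<in>\<Omega>. g x * (\<integral>\<^sup>+y\<in>\<Omega>. riesz b0 x y \<partial>\<nu> i) \<partial>lborel)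
          = (\<integral>\<^sup>+x. (\<integral>\<^sup>+y. g x * indicator \<Omega> x * (riesz b0 x y * indicator \<Omega> y) \<partial>\<nu> i) \<partial>lborel)"
          by (subst nn_integral_cmult) (auto simp: mult_ac)
        also have "\<dots> = (\<integral>\<^sup>+y. (\<integral>\<^sup>+x. g x * indicator \<Omega> x * (riesz b0 x y * indicator \<Omega> y) \<partial>lborel) \<partial>\<nu> i)"
          by (rule PP.Fubini'[symmetric]) measurable
        also have "\<dots> = (\<integral>\<^sup>+y. riesz_pot \<Omega> b0 g y * indicator \<Omega> y \<partial>\<nu> i)"
        proof (rule nn_integral_cong)
          fix y
          show "(\<integral>\<^sup>+x. g x * indicator \<Omega> x * (riesz b0 x y * indicator \<Omega> y) \<partial>lborel) = riesz_pot \<Omega> b0 g y * indicator \<Omega> y"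
            unfolding riesz_pot_def
            by (subst nn_integral_multc[symmetric]) (auto simp: mult_ac riesz_commute[of _ y])
        qed
        also have "\<dots> \<le> (\<integral>\<^sup>+y. ennreal (R powr (s - j * e - b0)) * A \<partial>\<nu> i)"
          using pot0 by (intro nn_integral_mono) (auto simp: indicator_def)
        also have "\<dots> = ennreal (R powr (s - j * e - b0)) * A * emeasure (\<nu> i) (space (\<nu> i))" by simp
        finally show ?thesis .
      qed
      have [measurable]: "(\<lambda>x. \<integral>\<^sup>+y\<in>\<Omega>. riesz b0 x y \<partial>\<nu> i) \<in> borel_measurable borel" if i: "i \<in> I" for i
        by (rule measurable_nn_integral_riesz[OF I(2)[OF i] I(3)[OF i]]) measurable
      have "?J a r g
         \<le> (\<integral>\<^sup>+x. ennreal C * (riesz_pot (cball a r') s (\<lambda>y. ennreal (\<bar>u y\<bar> * W y)) x * g x * indicator \<Omega> x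
              + (\<Sum>i\<in>I. g x * (\<integral>\<^sup>+y\<in>\<Omega>. riesz b0 x y \<partial>\<nu> i) * indicator \<Omega> x)) \<partial>lborel)"
      proof (rule nn_integral_mono_AE)
        show "AE x in lborel. ennreal \<bar>u x\<bar> * g x * indicator (cball a r) x
          \<le> ennreal C * (riesz_pot (cball a r') s (\<lambda>y. ennreal (\<bar>u y\<bar> * W y)) x * g x * indicator \<Omega> x
              + (\<Sum>i\<in>I. g x * (\<integral>\<^sup>+y\<in>\<Omega>. riesz b0 x y \<partial>\<nu> i) * indicator \<Omega> x))"
          using C
        proof eventually_elim
          case (elim x)
          show ?case
          proof (cases "x \<in> cball a r")
            case True
            then have "ennreal \<bar>u x\<bar> * g x \<le> ennreal C * (riesz_pot (cball a r') s (\<lambda>y. ennreal (\<bar>u y\<bar> * W y)) x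
              + (\<Sum>i\<in>I. \<integral>\<^sup>+y\<in>\<Omega>. riesz b0 x y \<partial>\<nu> i)) * g x"
              using elim by (intro mult_right_mono) (auto simp: s_def)
            then show ?thesis using True ball
              by (auto simp: distrib_right sum_distrib_right mult.assoc mult.commute[of "g x"])
          qed simp
        qed
      qed
      also have "\<dots> = ennreal C * ((\<integral>\<^sup>+x. riesz_pot (cball a r') s (\<lambda>y. ennreal (\<bar>u y\<bar> * W y)) x * g x * indicator \<Omega> x \<partial>lborel)
         + (\<Sum>i\<in>I. \<integral>\<^sup>+x\<in>\<Omega>. g x * (\<integral>\<^sup>+y\<in>\<Omega>. riesz b0 x y \<partial>\<nu> i) \<partial>lborel))"
        by (subst nn_integral_cmult, measurable, subst nn_integral_add, measurable, subst nn_integral_sum, measurable)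
      also have "\<dots> \<le> ennreal C * (?J a r' (?T g) + K)"
      proof (intro mult_left_mono add_mono)
        show "(\<Sum>i\<in>I. \<integral>\<^sup>+x\<in>\<Omega>. g x * (\<integral>\<^sup>+y\<in>\<Omega>. riesz b0 x y \<partial>\<nu> i) \<partial>lborel) \<le> K"
          unfolding K_def by (intro sum_mono *)
        have "(\<integral>\<^sup>+x. riesz_pot (cball a r') s (\<lambda>y. ennreal (\<bar>u y\<bar> * W y)) x * g x * indicator \<Omega> x \<partial>lborel)
          = (\<integral>\<^sup>+x. (\<integral>\<^sup>+y. riesz s x y * ennreal (\<bar>u y\<bar> * W y) * indicator (cball a r') y * (g x * indicator \<Omega> x) \<partial>lborel) \<partial>lborel)"
          unfolding riesz_pot_def by (subst nn_integral_multc) (auto simp: mult_ac)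
        also have "\<dots> = (\<integral>\<^sup>+y. (\<integral>\<^sup>+x. riesz s x y * ennreal (\<bar>u y\<bar> * W y) * indicator (cball a r') y * (g x * indicator \<Omega> x) \<partial>lborel) \<partial>lborel)"
          by (rule lborel_pair.Fubini') measurable
        also have "\<dots> = ?J a r' (?T g)"
        proof (rule nn_integral_cong)
          fix y
          have "(\<integral>\<^sup>+x. riesz s x y * ennreal (\<bar>u y\<bar> * W y) * indicator (cball a r') y * (g x * indicator \<Omega> x) \<partial>lborel)
            = (\<integral>\<^sup>+x. (ennreal (\<bar>u y\<bar> * W y) * indicator (cball a r') y) * (riesz s y x * g x * indicator \<Omega> x) \<partial>lborel)"
            by (intro nn_integral_cong) (simp add: mult_ac riesz_commute[of _ _ y])
          also have "\<dots> = (ennreal (\<bar>u y\<bar> * W y) * indicator (cball a r') y) * riesz_pot \<Omega> s g y"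
            unfolding riesz_pot_def by (rule nn_integral_cmult) measurable
          finally show "(\<integral>\<^sup>+x. riesz s x y * ennreal (\<bar>u y\<bar> * W y) * indicator (cball a r') y * (g x * indicator \<Omega> x) \<partial>lborel)
            = ennreal \<bar>u y\<bar> * (ennreal (W y) * riesz_pot \<Omega> s g y) * indicator (cball a r') y"
            using W[of y] by (simp add: ennreal_mult mult_ac)
        qed
        finally show "(\<integral>\<^sup>+x. riesz_pot (cball a r') s (\<lambda>y. ennreal (\<bar>u y\<bar> * W y)) x * g x * indicator \<Omega> x \<partial>lborel)
          \<le> ?J a r' (?T g)" by simp
      qed auto
      finally show ?thesis using K r' by blast
    qed
    {
      case 0
      obtain r' C K where K: "K < \<infinity>" "cball a r' \<subseteq> \<Omega>" "?J a r g
       \<le> ennreal C * (?J a r' (?T g) + K)"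
        using common[OF 0] by blast
      have "?J a r' (?T g)
         \<le> (\<integral>\<^sup>+y. A * (ennreal (\<bar>u y\<bar> * W y) * indicator \<Omega> y) \<partial>lborel)"
      proof (rule nn_integral_mono)
        fix y
        show "ennreal \<bar>u y\<bar> * (ennreal (W y) * riesz_pot \<Omega> s g y) * indicator (cball a r') y
          \<le> A * (ennreal (\<bar>u y\<bar> * W y) * indicator \<Omega> y)"
        proof (cases "y \<in> cball a r'")
          case True
          then have "y \<in> \<Omega>" using K(2) by blast
          then have "riesz_pot \<Omega> s g y \<le> A" using 0(4) by simp
          then have "ennreal (\<bar>u y\<bar> * W y) * riesz_pot \<Omega> s g y \<le> ennreal (\<bar>u y\<bar> * W y) * A"
            by (rule mult_left_mono) simp
          then show ?thesis using True \<open>y \<in> \<Omega>\<close> W[of y] by (simp add: ennreal_mult mult_ac)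
        qed simp
      qed
      also have "\<dots> = A * (\<integral>\<^sup>+x\<in>\<Omega>. ennreal (\<bar>u x\<bar> * W x) \<partial>lborel)"
        by (rule nn_integral_cmult) measurable
      also have "\<dots> < \<infinity>" using 0(2) uW by (simp add: ennreal_mult_less_top)
      finally have "ennreal C * (?J a r' (?T g) + K) < \<infinity>"
        using K(1) by (simp add: ennreal_mult_less_top)
      with K(3) show ?case by (rule le_less_trans)
    next
      case (Suc j)
      note [measurable] = Suc.prems(1)
      obtain r' C K where K: "K < \<infinity>" "cball a r' \<subseteq> \<Omega>" "?J a r g
       \<le> ennreal C * (?J a r' (?T g) + K)"
        using common[OF Suc.prems] by blast
      define b where "b = s - real (Suc j) * e"
      have "real (Suc j) * e \<le> real m * e" using Suc.prems(3) e by (intro mult_right_mono) auto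
      then have b: "0 \<le> b" "b \<le> s" "b + e = s - j * e"
        using n e by (auto simp: b_def s_def algebra_simps)
      have pot: "riesz_pot \<Omega> b g x \<le> A" if "x \<in> \<Omega>" for x
        using Suc.prems(4)[OF that] by (simp only: b_def)
      have fin: "ennreal (2 powr b) * (2 * D) * A < \<infinity>"
        using D(1) Suc.prems(2) by (simp add: ennreal_mult_less_top)
      have "?J a r' (?T g) < \<infinity>"
      proof (rule Suc.IH[OF _ fin _ _ K(2)])
        show "riesz_pot \<Omega> (s - j * e) (?T g) x \<le> ennreal (2 powr b) * (2 * D) * A"
          if x: "x \<in> \<Omega>" for x
          using riesz_pot_step[of \<Omega> g "\<lambda>y. ennreal (W y)" e b s D A x] b e D(2) pot x by simp
        show "j < m" using Suc.prems(3) by simp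
      qed measurable
      then have "ennreal C * (?J a r' (?T g) + K) < \<infinity>"
        using K(1) by (simp add: ennreal_mult_less_top)
      with K(3) show ?case by (rule le_less_trans)
    }
  qed
  \<comment> \<open>the initial weight: the exponent \<open>b0\<close> is admissible for \<open>W\<^sup>2\<close>, which lies in \<open>L\<^bsup>q/2\<^esup>\<close>\<close>
  have "b0 * q < n * (q - 2)"
  proof -
    have "b0 * q < (n - 2 * (n / q)) * q"
      using e q n by (intro mult_strict_right_mono) (auto simp: b0_def)
    also have "\<dots> = n * (q - 2)" using q n by (simp add: field_simps)
    finally show ?thesis .
  qed
  then have "b0 * (q / 2 / (q / 2 - 1)) < n" using q n by (simp add: field_simps)
  moreover have "(\<integral>\<^sup>+x\<in>\<Omega>. ennreal ((W x)\<^sup>2 powr (q / 2)) \<partial>lborel) < \<infinity>"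
  proof -
    have "(W x)\<^sup>2 powr (q / 2) = W x powr q" for x
    proof (cases "W x = 0")
      case False
      then have "W x > 0" using W[of x] by simp
      then have "(W x)\<^sup>2 = W x powr 2" by (simp add: powr_numeral)
      then show ?thesis by (simp add: powr_powr)
    qed simp
    then show ?thesis using Wq by simp
  qed
  ultimately obtain A where A: "A < \<infinity>" "\<And>x. x \<in> \<Omega> \<Longrightarrow> riesz_pot \<Omega> b0 (\<lambda>y. ennreal ((W y)\<^sup>2)) x \<le> A"
    using riesz_pot_bounded[OF \<Omega>(2), of "\<lambda>x. (W x)\<^sup>2" "q / 2" b0] q n b0 by (auto simp: n_def)
  have eq: "s - real (m - 1) * e = b0"
    using m e by (simp add: s_def b0_def of_nat_diff algebra_simps)
  have "(\<integral>\<^sup>+x\<in>cball a r. ennreal \<bar>u x\<bar> * ennreal ((W x)\<^sup>2) \<partial>lborel) < \<infinity>"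
  proof (rule main[where A = A and j = "m - 1"])
    show "riesz_pot \<Omega> (s - real (m - 1) * e) (\<lambda>x. ennreal ((W x)\<^sup>2)) x \<le> A" if "x \<in> \<Omega>" for x
      using A(2)[OF that] by (simp only: eq)
  qed (use A(1) m ball in auto)
  then show ?thesis by (simp add: ennreal_mult)
qed


section \<open>Approximation of the identity by the regularised Newtonian kernel\<close>

text \<open>For the indicator of \<open>A\<close>, take an open set \<open>T\<close> containing \<open>A\<close> with \<open>T - A\<close> of small measure, and the continuous
functions \<open>min 1 (k dist (x, - T))\<close>, which increase to the indicator of \<open>T\<close>.\<close>

lemma integrable_approx_continuous:
  fixes f :: "'a::euclidean_space \<Rightarrow> real"
  assumes "integrable lborel f" "e > 0"
  shows "\<exists>g M. continuous_on UNIV g \<and> (\<forall>x. \<bar>g x\<bar> \<le> M) \<and> integrable lborel g \<and> (LINT x|lborel. \<bar>f x - g x\<bar>) < e"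
  using assms
proof (induction f arbitrary: e rule: integrable_induct)
  case (base A c)
  \<comment> \<open>small enough for \<open>|c| (d + d) < e\<close>\<close>
  define d where "d = e / (2 * (\<bar>c\<bar> + 1))"
  have d: "d > 0" "\<bar>c\<bar> * d < e / 2"
    using base(3) by (auto simp: d_def field_simps add_pos_nonneg)
  obtain T where T: "open T" "A \<subseteq> T" "T - A \<in> lmeasurable" "emeasure lebesgue (T - A) < ennreal d"
    using sets_lebesgue_outer_open[of A d] base(1) d by auto
  have [measurable]: "T \<in> sets borel" "A \<in> sets borel" using T base(1) by auto
  have "emeasure lborel (T - A) < ennreal d" using T(4) by simp
  moreover have "emeasure lborel T = emeasure lborel A + emeasure lborel (T - A)"
    using T(2) by (subst plus_emeasure) (auto simp: Un_absorb1)
  ultimately have finT: "emeasure lborel T < \<infinity>" using base(2) by (auto simp: less_top[symmetric])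
  have fin: "integrable lborel (indicat_real T)" "integrable lborel (indicat_real A)"
    using finT base(2) by (auto simp: integrable_indicator_iff)
  have fin': "integrable lborel (indicat_real (T - A))"
    using \<open>emeasure lborel (T - A) < ennreal d\<close> by (auto simp: integrable_indicator_iff less_top[symmetric])
  have "T \<noteq> UNIV" using finT by auto
  define h where "h k x = min 1 (real k * infdist x (- T))" for k x
  have h: "0 \<le> h k x" "h k x \<le> indicat_real T x" "h k x \<le> 1" for k x
    by (auto simp: h_def indicator_def infdist_nonneg)
  have hc: "continuous_on UNIV (h k)" for k unfolding h_def by (intro continuous_intros)
  then have [measurable]: "h k \<in> borel_measurable borel" for k by (rule borel_measurable_continuous_onI)
  have lim: "(\<lambda>k. h k x) \<longlonglongrightarrow> indicat_real T x" for x
  proof (cases "x \<in> T")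
    case True
    then have pos: "infdist x (- T) > 0"
      using T(1) \<open>T \<noteq> UNIV\<close> infdist_pos_not_in_closed[of "- T" x] by auto
    obtain N where N: "1 < real N * infdist x (- T)"
      using reals_Archimedean3[OF pos] by blast
    have "h k x = 1" if "k \<ge> N" for k
    proof -
      have "real N * infdist x (- T) \<le> real k * infdist x (- T)" using that pos by (intro mult_right_mono) auto
      then show ?thesis using N by (simp add: h_def)
    qed
    then show ?thesis using True by (intro tendsto_eventually) (auto simp: eventually_sequentially)
  next
    case False
    then have "h k x = 0" for k by (simp add: h_def)
    then show ?thesis using False by simp
  qed
  have "(\<lambda>k. LINT x|lborel. \<bar>indicat_real T x - h k x\<bar>) \<longlonglongrightarrow> integral\<^sup>L lborel (\<lambda>x :: 'a. 0 :: real)"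
  proof (rule Bochner_Integration.integral_dominated_convergence[where w = "indicat_real T"])
    show "AE x in lborel. (\<lambda>k. \<bar>indicat_real T x - h k x\<bar>) \<longlonglongrightarrow> 0"
    proof (intro always_eventually allI tendsto_rabs_zero)
      fix x
      have "(\<lambda>k. indicat_real T x - h k x) \<longlonglongrightarrow> indicat_real T x - indicat_real T x" by (intro tendsto_intros lim)
      then show "(\<lambda>k. indicat_real T x - h k x) \<longlonglongrightarrow> 0" by simp
    qed
    show "AE x in lborel. norm \<bar>indicat_real T x - h k x\<bar> \<le> indicat_real T x" for k
      using h by (intro always_eventually allI) (auto simp: abs_le_iff)
  qed (use fin in auto)
  then have "eventually (\<lambda>k. (LINT x|lborel. \<bar>indicat_real T x - h k x\<bar>) < d) sequentially"
    using d by (auto dest: order_tendstoD)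
  then obtain k where k: "(LINT x|lborel. \<bar>indicat_real T x - h k x\<bar>) < d"
    by (auto simp: eventually_sequentially)
  have hi: "integrable lborel (h k)"
    by (rule Bochner_Integration.integrable_bound[OF fin(1)]) (use h in auto)
  have "(LINT x|lborel. \<bar>indicat_real A x *\<^sub>R c - h k x * c\<bar>)
      \<le> (LINT x|lborel. \<bar>c\<bar> * (indicat_real (T - A) x + \<bar>indicat_real T x - h k x\<bar>))"
  proof (rule integral_mono)
    fix x
    have "\<bar>indicat_real A x *\<^sub>R c - h k x * c\<bar> = \<bar>c\<bar> * \<bar>indicat_real A x - h k x\<bar>"
      by (simp add: abs_mult[symmetric] algebra_simps)
    also have "\<dots> \<le> \<bar>c\<bar> * (indicat_real (T - A) x + \<bar>indicat_real T x - h k x\<bar>)"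
      using T(2) by (intro mult_left_mono) (auto simp: indicator_def)
    finally show "\<bar>indicat_real A x *\<^sub>R c - h k x * c\<bar> \<le> \<bar>c\<bar> * (indicat_real (T - A) x + \<bar>indicat_real T x - h k x\<bar>)" .
  qed (use fin fin' hi in auto)
  also have "\<dots> = \<bar>c\<bar> * (measure lborel (T - A) + (LINT x|lborel. \<bar>indicat_real T x - h k x\<bar>))"
    using fin fin' hi by (simp add: Bochner_Integration.integral_add)
  also have "\<dots> \<le> \<bar>c\<bar> * (d + d)"
  proof (intro mult_left_mono add_mono)
    show "measure lborel (T - A) \<le> d"
      using \<open>emeasure lborel (T - A) < ennreal d\<close> d by (simp add: measure_def enn2real_leI less_imp_le)
  qed (use k in auto)
  also have "\<dots> < e" using d(2) by simp
  finally have "(LINT x|lborel. \<bar>indicat_real A x *\<^sub>R c - h k x * c\<bar>) < e" .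
  moreover have "\<bar>h k x * c\<bar> \<le> \<bar>c\<bar>" for x
    using h[of k x] mult_right_mono[of "\<bar>h k x\<bar>" 1 "\<bar>c\<bar>"] by (simp add: abs_mult)
  moreover have "continuous_on UNIV (\<lambda>x. h k x * c)" using hc[of k] by (intro continuous_intros)
  ultimately show ?case using hi by (intro exI[of _ "\<lambda>x. h k x * c"] exI[of _ "\<bar>c\<bar>"]) auto
next
  case (add f f')
  obtain g M where g: "continuous_on UNIV g" "\<And>x. \<bar>g x\<bar> \<le> M" "integrable lborel g" "(LINT x|lborel. \<bar>f x - g x\<bar>) < e / 2"
    using add(3)[of "e / 2"] add(5) by auto
  obtain g' M' where g': "continuous_on UNIV g'" "\<And>x. \<bar>g' x\<bar> \<le> M'" "integrable lborel g'" "(LINT x|lborel. \<bar>f' x - g' x\<bar>) < e / 2"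
    using add(4)[of "e / 2"] add(5) by auto
  have "(LINT x|lborel. \<bar>(f x + f' x) - (g x + g' x)\<bar>) \<le> (LINT x|lborel. \<bar>f x - g x\<bar> + \<bar>f' x - g' x\<bar>)"
    using add(1,2) g(3) g'(3) by (intro integral_mono) auto
  also have "\<dots> = (LINT x|lborel. \<bar>f x - g x\<bar>) + (LINT x|lborel. \<bar>f' x - g' x\<bar>)"
    using add(1,2) g(3) g'(3) by (intro Bochner_Integration.integral_add) auto
  also have "\<dots> < e" using g(4) g'(4) by simp
  finally have "(LINT x|lborel. \<bar>(f x + f' x) - (g x + g' x)\<bar>) < e" .
  moreover have "\<bar>g x + g' x\<bar> \<le> M + M'" for x using g(2)[of x] g'(2)[of x] by linarith
  moreover have "continuous_on UNIV (\<lambda>x. g x + g' x)" using g(1) g'(1) by (intro continuous_intros)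
  ultimately show ?case using g(3) g'(3) by (intro exI[of _ "\<lambda>x. g x + g' x"] exI[of _ "M + M'"]) auto
next
  case (lim f s)
  have "(\<lambda>k. LINT x|lborel. \<bar>f x - s k x\<bar>) \<longlonglongrightarrow> integral\<^sup>L lborel (\<lambda>x :: 'a. 0 :: real)"
  proof (rule Bochner_Integration.integral_dominated_convergence[where w = "\<lambda>x. 3 * \<bar>f x\<bar>"])
    show "AE x in lborel. (\<lambda>k. \<bar>f x - s k x\<bar>) \<longlonglongrightarrow> 0"
    proof (intro always_eventually allI tendsto_rabs_zero)
      fix x
      have "(\<lambda>k. f x - s k x) \<longlonglongrightarrow> f x - f x" using lim(2)[of x] by (intro tendsto_intros) auto
      then show "(\<lambda>k. f x - s k x) \<longlonglongrightarrow> 0" by simp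
    qed
    show "AE x in lborel. norm \<bar>f x - s k x\<bar> \<le> 3 * \<bar>f x\<bar>" for k
    proof (intro always_eventually allI)
      fix x
      show "norm \<bar>f x - s k x\<bar> \<le> 3 * \<bar>f x\<bar>" using lim(3)[of x k] by simp
    qed
  qed (use lim(1,4) in auto)
  then have "eventually (\<lambda>k. (LINT x|lborel. \<bar>f x - s k x\<bar>) < e / 2) sequentially"
    using lim(6) order_tendstoD(2)[of "\<lambda>k. LINT x|lborel. \<bar>f x - s k x\<bar>" 0 sequentially "e / 2"] by simp
  then obtain k where k: "(LINT x|lborel. \<bar>f x - s k x\<bar>) < e / 2"
    by (auto simp: eventually_sequentially)
  obtain g M where g: "continuous_on UNIV g" "\<forall>x. \<bar>g x\<bar> \<le> M" "integrable lborel g" "(LINT x|lborel. \<bar>s k x - g x\<bar>) < e / 2"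
    using lim(5)[of "e / 2" k] lim(6) by auto
  have "(LINT x|lborel. \<bar>f x - g x\<bar>) \<le> (LINT x|lborel. \<bar>f x - s k x\<bar> + \<bar>s k x - g x\<bar>)"
    using lim(1,4) g(3) by (intro integral_mono) auto
  also have "\<dots> = (LINT x|lborel. \<bar>f x - s k x\<bar>) + (LINT x|lborel. \<bar>s k x - g x\<bar>)"
    using lim(1,4) g(3) by (intro Bochner_Integration.integral_add) auto
  also have "\<dots> < e" using k g(4) by simp
  finally show ?case using g(1-3) by blast
qed

text \<open>Minus the Laplacian, in the variable \<open>y\<close>, of the Newtonian kernel regularised by replacing \<open>|y - x|\<^sup>2\<close> with
\<open>|y - x|\<^sup>2 + d\<^sup>2\<close>.  It is explicit, positive, and an approximation of a multiple of the identity as \<open>d\<close> tends to \<open>0\<close>.\<close>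

definition mollifier :: "real \<Rightarrow> real ^ 'n \<Rightarrow> real ^ 'n \<Rightarrow> real" where
  "mollifier d x y = 2 * real CARD('n) * d\<^sup>2 * ((y - x) \<bullet> (y - x) + d\<^sup>2) powr (- real CARD('n) / 2 - 1)"

lemma mollifier_nonneg: "mollifier d x y \<ge> 0"
  by (simp add: mollifier_def)

lemma mollifier_commute: "mollifier d x y = mollifier d y x"
  by (simp add: mollifier_def inner_diff_left inner_diff_right inner_commute algebra_simps)

lemma measurable_mollifier [measurable]:
  assumes [measurable]: "f \<in> borel_measurable M" "g \<in> borel_measurable M"
  shows "(\<lambda>z. mollifier d (f z) (g z)) \<in> borel_measurable M"
  unfolding mollifier_def by measurable

lemma mollifier_scale:
  fixes x z :: "real ^ 'n"
  assumes d: "d > 0"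
  shows "d ^ CARD('n) * mollifier d x (x + d *\<^sub>R z) = mollifier 1 0 z"
proof -
  have "(d *\<^sub>R z) \<bullet> (d *\<^sub>R z) + d\<^sup>2 = d\<^sup>2 * (z \<bullet> z + 1)"
    by (simp add: power2_eq_square algebra_simps)
  moreover have "(d\<^sup>2) powr (- real CARD('n) / 2 - 1) = d powr (- real CARD('n) - 2)"
  proof -
    have "d\<^sup>2 = d powr 2" using d by (simp add: powr_numeral)
    then show ?thesis by (simp add: powr_powr)
  qed
  ultimately have "((d *\<^sub>R z) \<bullet> (d *\<^sub>R z) + d\<^sup>2) powr (- real CARD('n) / 2 - 1)
      = d powr (- real CARD('n) - 2) * (z \<bullet> z + 1) powr (- real CARD('n) / 2 - 1)"
    by (simp add: powr_mult)
  moreover have "d ^ CARD('n) * d\<^sup>2 * d powr (- real CARD('n) - 2) = 1"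
    using d by (simp add: powr_realpow[symmetric] powr_numeral[symmetric] powr_add[symmetric] del: powr_numeral)
  ultimately show ?thesis by (simp add: mollifier_def) 
qed

lemma nn_integral_affine:
  fixes f :: "real ^ 'n \<Rightarrow> ennreal"
  assumes [measurable]: "f \<in> borel_measurable borel" and d: "d > 0"
  shows "(\<integral>\<^sup>+y. f y \<partial>lborel) = ennreal (d ^ CARD('n)) * (\<integral>\<^sup>+z. f (x + d *\<^sub>R z) \<partial>lborel)"
proof -
  have "(\<integral>\<^sup>+y. f y \<partial>lborel) = (\<integral>\<^sup>+y. f y \<partial>density (distr lborel borel (\<lambda>z. x + d *\<^sub>R z)) (\<lambda>_. \<bar>d\<bar> ^ CARD('n)))"
    using lborel_affine[of d x] d by simp
  also have "\<dots> = ennreal (d ^ CARD('n)) * (\<integral>\<^sup>+z. f (x + d *\<^sub>R z) \<partial>lborel)"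
    using d by (simp add: nn_integral_density nn_integral_distr nn_integral_cmult)
  finally show ?thesis .
qed

lemma mollifier_mass:
  fixes x :: "real ^ 'n"
  assumes d: "d > 0"
  shows "(\<integral>\<^sup>+y. ennreal (mollifier d x y) \<partial>lborel) = (\<integral>\<^sup>+z. ennreal (mollifier 1 (0 :: real ^ 'n) z) \<partial>lborel)"
proof -
  have "(\<integral>\<^sup>+y. ennreal (mollifier d x y) \<partial>lborel)
     = ennreal (d ^ CARD('n)) * (\<integral>\<^sup>+z. ennreal (mollifier d x (x + d *\<^sub>R z)) \<partial>lborel)"
    by (rule nn_integral_affine) (use d in measurable)
  also have "\<dots> = (\<integral>\<^sup>+z. ennreal (mollifier 1 (0 :: real ^ 'n) z) \<partial>lborel)"
    using d by (subst nn_integral_cmult[symmetric]) (auto simp: ennreal_mult[symmetric] mollifier_scale mollifier_nonneg)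
  finally show ?thesis .
qed

text \<open>Dyadic balls again: at distance \<open>2\<^sup>k\<close> the function is of the order \<open>2\<^bsup>-k (n + 2)\<^esup>\<close>, against a volume of the order
\<open>2\<^bsup>k n\<^esup>\<close>.\<close>

lemma mollifier_mass_finite: "(\<integral>\<^sup>+z. ennreal (mollifier 1 (0 :: real ^ 'n) z) \<partial>lborel) < \<infinity>"
proof -
  define n where "n = CARD('n)"
  define K where "K = 2 * real n * 2 ^ (n + 2)"
  define c where "c = emeasure lborel (ball (0 :: real ^ 'n) 1)"
  have le: "ennreal (mollifier 1 0 z) \<le> (\<Sum>k. ennreal (K / 2 ^ (k * (n + 2))) * indicator (ball 0 (2 ^ k)) z)" for z :: "real ^ 'n"
  proof -
    define P where "P k \<longleftrightarrow> norm z < 2 ^ k" for k :: nat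
    obtain k0 where "P k0" unfolding P_def using real_arch_pow[of 2 "norm z"] by auto
    define k where "k = (LEAST k. P k)"
    have Pk: "P k" unfolding k_def by (rule LeastI) fact
    have "mollifier 1 0 z \<le> K / 2 ^ (k * (n + 2))"
    proof (cases k)
      case 0
      have "(z \<bullet> z + 1) powr (- real n / 2 - 1) \<le> 1 powr (- real n / 2 - 1)"
        by (intro powr_mono2') auto
      then have "mollifier 1 0 z \<le> 2 * real n * 1"
        by (simp add: mollifier_def n_def mult_left_mono)
      also have "\<dots> \<le> K" unfolding K_def by (intro mult_left_mono one_le_power) auto
      finally show ?thesis using 0 by simp
    next
      case (Suc i)
      then have "\<not> P i" using not_less_Least[of i P] by (simp add: k_def)
      then have "2 ^ i \<le> norm z" by (simp add: P_def)
      then have "(2 ^ i)\<^sup>2 \<le> (norm z)\<^sup>2" by (intro power_mono) auto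
      also have "\<dots> \<le> z \<bullet> z + 1" by (simp add: power2_norm_eq_inner)
      finally have "(z \<bullet> z + 1) powr (- real n / 2 - 1) \<le> ((2 ^ i)\<^sup>2) powr (- real n / 2 - 1)"
        by (intro powr_mono2') auto
      also have "((2 ^ i)\<^sup>2 :: real) = 2 powr (2 * real i)" 
      proof -
        have "((2 ^ i)\<^sup>2 :: real) = 2 ^ (i * 2)" by (simp only: power_mult)
        also have "\<dots> = 2 powr real (i * 2)" by (rule powr_realpow[symmetric]) simp
        finally show ?thesis by (simp add: mult.commute)
      qed
      also have "(2 powr (2 * real i)) powr (- real n / 2 - 1) = 2 powr (- (real (i * (n + 2))))"
        by (simp add: powr_powr algebra_simps)
      also have "\<dots> = 1 / 2 ^ (i * (n + 2))"
        by (simp add: powr_minus_divide powr_realpow del: of_nat_mult of_nat_add)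
      finally have "2 * real n * (z \<bullet> z + 1) powr (- real n / 2 - 1) \<le> 2 * real n * (1 / 2 ^ (i * (n + 2)))"
        by (intro mult_left_mono) auto
      moreover have "mollifier 1 0 z = 2 * real n * (z \<bullet> z + 1) powr (- real n / 2 - 1)"
        by (simp add: mollifier_def n_def)
      ultimately have "mollifier 1 0 z \<le> 2 * real n * (1 / 2 ^ (i * (n + 2)))" by simp
      also have "\<dots> = K / 2 ^ (k * (n + 2))"
        by (simp add: K_def Suc power_add)
      finally show ?thesis .
    qed
    then have "ennreal (mollifier 1 0 z) \<le> ennreal (K / 2 ^ (k * (n + 2))) * indicator (ball 0 (2 ^ k)) z"
      using Pk by (simp add: P_def ennreal_leI)
    also have "\<dots> \<le> (\<Sum>k. ennreal (K / 2 ^ (k * (n + 2))) * indicator (ball 0 (2 ^ k)) z)"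
      by (rule ennreal_le_suminf)
    finally show ?thesis .
  qed
  have "(\<integral>\<^sup>+z. ennreal (mollifier 1 (0 :: real ^ 'n) z) \<partial>lborel)
     \<le> (\<integral>\<^sup>+z. (\<Sum>k. ennreal (K / 2 ^ (k * (n + 2))) * indicator (ball (0 :: real ^ 'n) (2 ^ k)) z) \<partial>lborel)"
    by (intro nn_integral_mono le)
  also have "\<dots> = (\<Sum>k. ennreal (K / 2 ^ (k * (n + 2))) * emeasure lborel (ball (0 :: real ^ 'n) (2 ^ k)))"
    by (rule nn_integral_suminf_balls)
  also have "\<dots> = (\<Sum>k. ennreal (K * (1 / 4) ^ k) * c)"
  proof (intro suminf_cong)
    fix k
    have "K / 2 ^ (k * (n + 2)) * (2 ^ k) ^ n = K * (1 / 4) ^ k"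
    proof -
      have "(2 :: real) ^ (k * (n + 2)) = (2 ^ k) ^ n * 4 ^ k"
      proof -
        have "(2 :: real) ^ (k * (n + 2)) = 2 ^ (k * n) * 2 ^ (2 * k)"
          unfolding power_add[symmetric] by (simp add: algebra_simps)
        also have "\<dots> = (2 ^ k) ^ n * (2\<^sup>2) ^ k" by (simp only: power_mult)
        finally show ?thesis by simp
      qed
      then show ?thesis by (simp add: power_divide)
    qed
    moreover have "emeasure lborel (ball (0 :: real ^ 'n) (2 ^ k)) = ennreal ((2 ^ k) ^ n) * c"
      unfolding n_def c_def by (rule emeasure_ball_scale) simp
    moreover have "K \<ge> 0" by (simp add: K_def)
    ultimately show "ennreal (K / 2 ^ (k * (n + 2))) * emeasure lborel (ball (0 :: real ^ 'n) (2 ^ k)) = ennreal (K * (1 / 4) ^ k) * c"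
      by (simp add: mult.assoc[symmetric] ennreal_mult[symmetric])
  qed
  also have "\<dots> < \<infinity>"
  proof -
    have "summable (\<lambda>k. K * (1 / 4 :: real) ^ k)" by (intro summable_mult summable_geometric) simp
    moreover have "K \<ge> 0" by (simp add: K_def)
    ultimately have "(\<Sum>k. ennreal (K * (1 / 4) ^ k)) < \<infinity>" by (subst suminf_ennreal2) auto
    then show ?thesis unfolding c_def
      using emeasure_lborel_ball_finite[of "0 :: real ^ 'n" 1] by (simp add: ennreal_suminf_multc ennreal_mult_less_top)
  qed
  finally show ?thesis .
qed

lemma mollifier_mass_pos: "(\<integral>\<^sup>+z. ennreal (mollifier 1 (0 :: real ^ 'n) z) \<partial>lborel) \<noteq> 0"
proof
  assume "(\<integral>\<^sup>+z. ennreal (mollifier 1 (0 :: real ^ 'n) z) \<partial>lborel) = 0"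
  then have "AE z in lborel. ennreal (mollifier 1 (0 :: real ^ 'n) z) = 0"
    by (subst (asm) nn_integral_0_iff_AE) auto
  moreover have "mollifier 1 0 z > 0" for z :: "real ^ 'n"
  proof -
    have "z \<bullet> z + 1 > 0" by (simp add: add_nonneg_pos)
    then show ?thesis by (simp add: mollifier_def)
  qed
  ultimately have "AE z in lborel :: (real ^ 'n) measure. False"
    by (simp add: ennreal_eq_0_iff not_le[symmetric])
  then have "emeasure (lborel :: (real ^ 'n) measure) UNIV = 0"
    using ae_filter_eq_bot_iff[of "lborel :: (real ^ 'n) measure"] by (simp add: eventually_False)
  then show False by simp
qed

lemma mollifier_le:
  fixes x y :: "real ^ 'n"
  assumes d: "d > 0"
  shows "mollifier d x y \<le> 2 * real CARD('n) * d\<^sup>2 * (d\<^sup>2) powr (- real CARD('n) / 2 - 1)"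
  unfolding mollifier_def using d by (intro mult_left_mono powr_mono2') auto

lemma integral_mollifier_scale:
  fixes g :: "real ^ 'n \<Rightarrow> real"
  assumes [measurable]: "g \<in> borel_measurable borel" and d: "d > 0"
  shows "(LINT y|lborel. g y * mollifier d x y) = (LINT z|lborel. g (x + d *\<^sub>R z) * mollifier 1 0 z)"
proof -
  have "(LINT y|lborel. g y * mollifier d x y)
    = (LINT y|density (distr lborel borel (\<lambda>z. x + d *\<^sub>R z)) (\<lambda>_. \<bar>d\<bar> ^ CARD('n)). g y * mollifier d x y)"
    using lborel_affine[of d x] d by simp
  also have "\<dots> = (LINT y|distr lborel borel (\<lambda>z. x + d *\<^sub>R z). \<bar>d\<bar> ^ CARD('n) *\<^sub>R (g y * mollifier d x y))"
    by (rule integral_density) auto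
  also have "\<dots> = (LINT z|lborel. \<bar>d\<bar> ^ CARD('n) *\<^sub>R (g (x + d *\<^sub>R z) * mollifier d x (x + d *\<^sub>R z)))"
    by (rule integral_distr) auto
  also have "\<dots> = (LINT z|lborel. g (x + d *\<^sub>R z) * mollifier 1 0 z)"
    using d by (intro Bochner_Integration.integral_cong refl) (simp add: mollifier_scale[OF d])
  finally show ?thesis .
qed

text \<open>If every mollification of \<open>w\<close> is bounded by \<open>P\<close>, so is \<open>w\<close>, almost everywhere and up to the mass \<open>c\<close> of the
mollifier.  The function \<open>E\<close> measures the failure \<open>c |w| - P\<close>.  Approximate \<open>w\<close> in \<open>L\<^sup>1\<close> by a continuous bounded \<open>g\<close>,
whose mollifications converge pointwise to \<open>c g\<close>.  Then \<open>E\<close> is at most \<open>c |w - g|\<close> plus the lower limit of the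
mollifications of \<open>|w - g|\<close>, and by the lemma of Fatou its integral is at most \<open>2 c\<close> times the distance of \<open>w\<close> and \<open>g\<close>.\<close>

lemma mollifier_bound_AE:
  fixes w :: "real ^ 'n \<Rightarrow> real" and P :: "real ^ 'n \<Rightarrow> ennreal"
  assumes w: "integrable lborel w" and [measurable]: "P \<in> borel_measurable borel" "S \<in> sets borel"
    and le: "\<And>x d. x \<in> S \<Longrightarrow> 0 < d \<Longrightarrow> d \<le> 1 \<Longrightarrow> ennreal \<bar>LINT y|lborel. w y * mollifier d x y\<bar> \<le> P x"
  shows "AE x in lborel. x \<in> S \<longrightarrow> (\<integral>\<^sup>+z. ennreal (mollifier 1 (0 :: real ^ 'n) z) \<partial>lborel) * ennreal \<bar>w x\<bar> \<le> P x"
proof -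
  define c where "c = (LINT z|lborel. mollifier 1 (0 :: real ^ 'n) z)"
  have moll_int: "integrable lborel (mollifier 1 (0 :: real ^ 'n))"
    using mollifier_mass_finite by (intro integrableI_bounded) (auto simp: mollifier_nonneg)
  have c: "(\<integral>\<^sup>+z. ennreal (mollifier 1 (0 :: real ^ 'n) z) \<partial>lborel) = ennreal c"
    unfolding c_def by (rule nn_integral_eq_integral[OF moll_int]) (simp add: mollifier_nonneg)
  have c0: "c \<ge> 0" unfolding c_def by (simp add: mollifier_nonneg)
  have [measurable]: "w \<in> borel_measurable borel" using w by simp
  define E where "E x = ennreal (c * \<bar>w x\<bar> - enn2real (P x)) * indicator (S \<inter> {x. P x < \<infinity>}) x" for x
  have [measurable]: "E \<in> borel_measurable borel" unfolding E_def by measurable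
  have small: "(\<integral>\<^sup>+x. E x \<partial>lborel) \<le> ennreal (2 * c * e)" if e: "e > 0" for e
  proof -
    obtain g M where g: "continuous_on UNIV g" "\<And>x. \<bar>g x\<bar> \<le> M" "integrable lborel g" "(LINT x|lborel. \<bar>w x - g x\<bar>) < e"
      using integrable_approx_continuous[OF w e] by auto
    have [measurable]: "g \<in> borel_measurable borel" using g(3) by simp
    define d where "d k = 1 / (real k + 1)" for k
    have d: "0 < d k" "d k \<le> 1" for k by (auto simp: d_def field_simps)
    define Q where "Q k x = (\<integral>\<^sup>+y. ennreal \<bar>w y - g y\<bar> * ennreal (mollifier (d k) x y) \<partial>lborel)" for k x
    have [measurable]: "Q k \<in> borel_measurable borel" for k
    proof -
      have "(\<lambda>x. \<integral>\<^sup>+y. ennreal \<bar>w y - g y\<bar> * ennreal (mollifier (d k) x y) \<partial>lborel) \<in> borel_measurable borel"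
        by (rule sigma_finite_measure.borel_measurable_nn_integral[OF sigma_finite_lborel]) measurable
      then show ?thesis by (simp add: Q_def[abs_def])
    qed
    have norm_le: "(\<integral>\<^sup>+y. ennreal \<bar>w y - g y\<bar> \<partial>lborel) \<le> ennreal e"
      using w g(3,4) by (subst nn_integral_eq_integral) (auto intro: ennreal_leI)
    have Q_int: "(\<integral>\<^sup>+x. Q k x \<partial>lborel) \<le> ennreal (c * e)" for k
    proof -
      have "(\<integral>\<^sup>+x. Q k x \<partial>lborel) = (\<integral>\<^sup>+y. (\<integral>\<^sup>+x. ennreal \<bar>w y - g y\<bar> * ennreal (mollifier (d k) x y) \<partial>lborel) \<partial>lborel)"
        unfolding Q_def by (rule lborel_pair.Fubini'[symmetric]) measurable
      also have "\<dots> = (\<integral>\<^sup>+y. ennreal \<bar>w y - g y\<bar> * ennreal c \<partial>lborel)"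
      proof (rule nn_integral_cong)
        fix y
        have "(\<integral>\<^sup>+x. ennreal \<bar>w y - g y\<bar> * ennreal (mollifier (d k) x y) \<partial>lborel)
            = ennreal \<bar>w y - g y\<bar> * (\<integral>\<^sup>+x. ennreal (mollifier (d k) y x) \<partial>lborel)"
          by (simp add: nn_integral_cmult mollifier_commute[of _ _ y])
        then show "(\<integral>\<^sup>+x. ennreal \<bar>w y - g y\<bar> * ennreal (mollifier (d k) x y) \<partial>lborel) = ennreal \<bar>w y - g y\<bar> * ennreal c"
          by (simp only: mollifier_mass[OF d(1)] c)
      qed
      also have "\<dots> = (\<integral>\<^sup>+y. ennreal \<bar>w y - g y\<bar> \<partial>lborel) * ennreal c"
        by (rule nn_integral_multc) measurable
      also have "\<dots> \<le> ennreal e * ennreal c" by (intro mult_right_mono norm_le) simp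
      finally show ?thesis using e c0 by (simp add: ennreal_mult[symmetric] mult.commute)
    qed
    have pointwise: "E x \<le> ennreal c * ennreal \<bar>w x - g x\<bar> + liminf (\<lambda>k. Q k x)" for x
    proof (cases "x \<in> S \<and> P x < \<infinity>")
      case True
      define p where "p = enn2real (P x)"
      have p: "P x = ennreal p" "p \<ge> 0" using True by (auto simp: p_def)
      define J where "J k = (LINT y|lborel. g y * mollifier (d k) x y)" for k
      have J_lim: "J \<longlonglongrightarrow> g x * c"
      proof -
        have "(\<lambda>k. LINT z|lborel. g (x + d k *\<^sub>R z) * mollifier 1 0 z) \<longlonglongrightarrow> (LINT z|lborel. g x * mollifier 1 (0 :: real ^ 'n) z)"
        proof (rule Bochner_Integration.integral_dominated_convergence)
          show "integrable lborel (\<lambda>z. M * mollifier 1 (0 :: real ^ 'n) z)" using moll_int by simp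
          show "AE z in lborel. (\<lambda>k. g (x + d k *\<^sub>R z) * mollifier 1 0 z) \<longlonglongrightarrow> g x * mollifier 1 0 z"
          proof (intro always_eventually allI tendsto_mult_right)
            fix z
            have "d \<longlonglongrightarrow> 0" unfolding d_def using LIMSEQ_inverse_real_of_nat by (simp add: inverse_eq_divide add.commute)
            then have "(\<lambda>k. x + d k *\<^sub>R z) \<longlonglongrightarrow> x + 0 *\<^sub>R z" by (intro tendsto_intros)
            moreover have "isCont g x" using g(1) by (simp add: continuous_on_eq_continuous_at)
            ultimately show "(\<lambda>k. g (x + d k *\<^sub>R z)) \<longlonglongrightarrow> g x" using isCont_tendsto_compose[of x g] by simp
          qed
          show "AE z in lborel. norm (g (x + d k *\<^sub>R z) * mollifier 1 0 z) \<le> M * mollifier 1 0 z" for k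
            using g(2) by (intro always_eventually allI) (auto simp: abs_mult mollifier_nonneg intro!: mult_right_mono)
        qed measurable
        moreover have "J = (\<lambda>k. LINT z|lborel. g (x + d k *\<^sub>R z) * mollifier 1 0 z)"
          unfolding J_def by (intro ext integral_mollifier_scale d) measurable
        ultimately show ?thesis by (simp add: c_def)
      qed
      have step: "ennreal (\<bar>J k\<bar> - p) \<le> Q k x" for k
      proof -
        have bdd: "\<bar>mollifier (d k) x y\<bar> \<le> 2 * real CARD('n) * (d k)\<^sup>2 * ((d k)\<^sup>2) powr (- real CARD('n) / 2 - 1)" for y
          using mollifier_le[OF d(1)] by (simp add: mollifier_nonneg)
        have int: "integrable lborel (\<lambda>y. f y * mollifier (d k) x y)" if "integrable lborel f" for f
          by (rule integrable_mult_bounded[OF that _ bdd]) measurable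
        have wg: "integrable lborel (\<lambda>y. w y - g y)" using w g(3) by simp
        have "\<bar>J k - (LINT y|lborel. w y * mollifier (d k) x y)\<bar> = \<bar>LINT y|lborel. (w y - g y) * mollifier (d k) x y\<bar>"
          unfolding J_def using int[OF w] int[OF g(3)] by (simp add: left_diff_distrib)
        then have "ennreal \<bar>J k - (LINT y|lborel. w y * mollifier (d k) x y)\<bar> \<le> (\<integral>\<^sup>+y. ennreal \<bar>(w y - g y) * mollifier (d k) x y\<bar> \<partial>lborel)"
          using integral_norm_bound_ennreal[OF int[OF wg]] by simp
        also have "\<dots> = Q k x"
          unfolding Q_def by (intro nn_integral_cong) (simp add: abs_mult mollifier_nonneg ennreal_mult)
        finally have 1: "ennreal \<bar>J k - (LINT y|lborel. w y * mollifier (d k) x y)\<bar> \<le> Q k x" .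
        have "\<bar>LINT y|lborel. w y * mollifier (d k) x y\<bar> \<le> p"
          using le[of x "d k"] True d p by (simp add: ennreal_le_iff)
        then have "\<bar>J k\<bar> - p \<le> \<bar>J k - (LINT y|lborel. w y * mollifier (d k) x y)\<bar>" by linarith
        then show ?thesis using 1 ennreal_leI order_trans by blast
      qed
      have "(\<lambda>k. ennreal (\<bar>J k\<bar> - p)) \<longlonglongrightarrow> ennreal (\<bar>g x * c\<bar> - p)"
        by (intro tendsto_ennrealI tendsto_intros J_lim)
      then have "ennreal (\<bar>g x * c\<bar> - p) = liminf (\<lambda>k. ennreal (\<bar>J k\<bar> - p))"
        by (rule lim_imp_Liminf[symmetric, rotated]) simp
      also have "\<dots> \<le> liminf (\<lambda>k. Q k x)" by (intro Liminf_mono always_eventually allI step)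
      finally have 2: "ennreal (\<bar>g x * c\<bar> - p) \<le> liminf (\<lambda>k. Q k x)" .
      have "c * \<bar>w x\<bar> \<le> c * (\<bar>w x - g x\<bar> + \<bar>g x\<bar>)" by (intro mult_left_mono c0) linarith
      then have "c * \<bar>w x\<bar> - p \<le> c * \<bar>w x - g x\<bar> + max 0 (\<bar>g x * c\<bar> - p)"
        using c0 by (simp add: abs_mult algebra_simps)
      then have "ennreal (c * \<bar>w x\<bar> - p) \<le> ennreal (c * \<bar>w x - g x\<bar> + max 0 (\<bar>g x * c\<bar> - p))" by (rule ennreal_leI)
      also have "\<dots> = ennreal c * ennreal \<bar>w x - g x\<bar> + ennreal (\<bar>g x * c\<bar> - p)"
        using c0 by (subst ennreal_plus) (auto simp: ennreal_mult max_def ennreal_neg)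
      also have "\<dots> \<le> ennreal c * ennreal \<bar>w x - g x\<bar> + liminf (\<lambda>k. Q k x)" by (intro add_left_mono 2)
      finally show ?thesis using True by (simp add: E_def p_def)
    qed (auto simp: E_def)
    have "(\<integral>\<^sup>+x. E x \<partial>lborel) \<le> (\<integral>\<^sup>+x. ennreal c * ennreal \<bar>w x - g x\<bar> + liminf (\<lambda>k. Q k x) \<partial>lborel)"
      by (intro nn_integral_mono pointwise)
    also have "\<dots> = ennreal c * (\<integral>\<^sup>+x. ennreal \<bar>w x - g x\<bar> \<partial>lborel) + (\<integral>\<^sup>+x. liminf (\<lambda>k. Q k x) \<partial>lborel)"
      by (subst nn_integral_add, measurable, subst nn_integral_cmult, measurable)
    also have "\<dots> \<le> ennreal c * ennreal e + ennreal (c * e)"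
    proof (intro add_mono mult_left_mono norm_le)
      have "(\<integral>\<^sup>+x. liminf (\<lambda>k. Q k x) \<partial>lborel) \<le> liminf (\<lambda>k. \<integral>\<^sup>+x. Q k x \<partial>lborel)"
        by (rule nn_integral_liminf) measurable
      also have "\<dots> \<le> liminf (\<lambda>k :: nat. ennreal (c * e))" by (intro Liminf_mono always_eventually allI Q_int)
      also have "\<dots> = ennreal (c * e)" by (rule Liminf_const) simp
      finally show "(\<integral>\<^sup>+x. liminf (\<lambda>k. Q k x) \<partial>lborel) \<le> ennreal (c * e)" .
    qed simp
    also have "\<dots> = ennreal (2 * c * e)" using c0 e by (simp add: ennreal_mult[symmetric] ennreal_plus[symmetric] del: ennreal_plus)
    finally show ?thesis .
  qed
  have "(\<integral>\<^sup>+x. E x \<partial>lborel) \<le> 0"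
  proof (rule ennreal_le_epsilon)
    fix e :: real assume e: "e > 0"
    have "(\<integral>\<^sup>+x. E x \<partial>lborel) \<le> ennreal (2 * c * (e / (2 * (c + 1))))" by (rule small) (use e c0 in auto)
    also have "2 * c * (e / (2 * (c + 1))) \<le> e" using e c0 by (simp add: field_simps)
    then have "ennreal (2 * c * (e / (2 * (c + 1)))) \<le> 0 + ennreal e" by (simp add: ennreal_leI)
    finally show "(\<integral>\<^sup>+x. E x \<partial>lborel) \<le> 0 + ennreal e" .
  qed
  then have "AE x in lborel. E x = 0" by (subst (asm) le_zero_eq, subst (asm) nn_integral_0_iff_AE) auto
  then show ?thesis
  proof eventually_elim
    case (elim x)
    show ?case
    proof (cases "x \<in> S \<and> P x < \<infinity>")
      case True
      then have "c * \<bar>w x\<bar> \<le> enn2real (P x)" using elim by (simp add: E_def ennreal_eq_0_iff)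
      then have "ennreal (c * \<bar>w x\<bar>) \<le> ennreal (enn2real (P x))" by (rule ennreal_leI)
      then show ?thesis using True c0 by (simp add: c ennreal_mult)
    qed (auto simp: less_top[symmetric])
  qed
qed


section \<open>Bump functions and the Newtonian profile\<close>

lemma positive_part_power_deriv:
  "((\<lambda>t :: real. (max 0 t) ^ Suc (Suc k)) has_real_derivative real (Suc (Suc k)) * (max 0 t) ^ Suc k) (at t)"
proof -
  consider "t > 0" | "t < 0" | "t = 0" by linarith
  then show ?thesis
  proof cases
    case 1
    have "((\<lambda>t. t ^ Suc (Suc k)) has_real_derivative real (Suc (Suc k)) * (max 0 t) ^ Suc k) (at t)"
      using DERIV_pow[of "Suc (Suc k)" t] 1 by simp
    then show ?thesis
      by (rule has_field_derivative_transform_within_open[where S = "{0<..}"]) (use 1 in auto)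
  next
    case 2
    have "((\<lambda>t. 0) has_real_derivative 0) (at t)" by simp
    then have "((\<lambda>t. (max 0 t) ^ Suc (Suc k)) has_real_derivative 0) (at t)"
      by (rule has_field_derivative_transform_within_open[where S = "{..<0}"]) (use 2 in auto)
    then show ?thesis using 2 by simp
  next
    case 3
    have "((\<lambda>h :: real. ((max 0 (0 + h)) ^ Suc (Suc k) - (max 0 0) ^ Suc (Suc k)) / h) \<longlongrightarrow> 0) (at 0)"
    proof (rule Lim_null_comparison)
      show "eventually (\<lambda>h :: real. norm (((max 0 (0 + h)) ^ Suc (Suc k) - (max 0 0) ^ Suc (Suc k)) / h) \<le> \<bar>h\<bar> ^ Suc k) (at 0)"
      proof (rule always_eventually, rule allI)
        fix h :: real
        show "norm (((max 0 (0 + h)) ^ Suc (Suc k) - (max 0 0) ^ Suc (Suc k)) / h) \<le> \<bar>h\<bar> ^ Suc k"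
        proof (cases "h \<le> 0")
          case True
          then have "norm (((max 0 (0 + h)) ^ Suc (Suc k) - (max 0 0) ^ Suc (Suc k)) / h) = 0" by simp
          then show ?thesis by (simp only: zero_le_power abs_ge_zero)
        next
          case False
          then show ?thesis by (simp add: abs_mult power_abs)
        qed
      qed
      show "((\<lambda>h :: real. \<bar>h\<bar> ^ Suc k) \<longlongrightarrow> 0) (at 0)"
        by (auto intro!: tendsto_eq_intros)
    qed
    then show ?thesis using 3 by (simp add: DERIV_def)
  qed
qed

text \<open>The third power of the positive part is the smallest integer power that is \<open>C\<^sup>2\<close>.\<close>

definition bump :: "real ^ 'n \<Rightarrow> real \<Rightarrow> real ^ 'n \<Rightarrow> real" where
  "bump a r y = (max 0 (r\<^sup>2 - (y - a) \<bullet> (y - a))) ^ 3"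

lemma C2_on_bump: "C2_on UNIV (bump a r)"
proof -
  have "C2_on UNIV (\<lambda>y. (\<lambda>s. (max 0 (r\<^sup>2 - s)) ^ 3) ((y - a) \<bullet> (y - a)))"
  proof (rule C2_on_radial)
    show "((\<lambda>s. (max 0 (r\<^sup>2 - s)) ^ 3) has_real_derivative - 3 * (max 0 (r\<^sup>2 - s))\<^sup>2) (at s)" for s
    proof -
      have "((\<lambda>t. max 0 t ^ 3) has_real_derivative 3 * (max 0 (r\<^sup>2 - s))\<^sup>2) (at (r\<^sup>2 - s))"
        using positive_part_power_deriv[of 1 "r\<^sup>2 - s"] by (simp add: numeral_eq_Suc)
      then have "((\<lambda>s. max 0 (r\<^sup>2 - s) ^ 3) has_real_derivative 3 * (max 0 (r\<^sup>2 - s))\<^sup>2 * - 1) (at s)"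
        by (rule DERIV_chain2[where f = "\<lambda>t. max 0 t ^ 3" and g = "\<lambda>s. r\<^sup>2 - s"]) (auto intro!: derivative_eq_intros)
      then show ?thesis by simp
    qed
    show "((\<lambda>s. - 3 * (max 0 (r\<^sup>2 - s))\<^sup>2) has_real_derivative 6 * max 0 (r\<^sup>2 - s)) (at s)" for s
    proof -
      have "((\<lambda>t. max 0 t ^ 2) has_real_derivative 2 * max 0 (r\<^sup>2 - s)) (at (r\<^sup>2 - s))"
        using positive_part_power_deriv[of 0 "r\<^sup>2 - s"] by (simp add: numeral_eq_Suc)
      then have "((\<lambda>s. (max 0 (r\<^sup>2 - s))\<^sup>2) has_real_derivative 2 * max 0 (r\<^sup>2 - s) * - 1) (at s)"
        by (rule DERIV_chain2[where f = "\<lambda>t. (max 0 t)\<^sup>2" and g = "\<lambda>s. r\<^sup>2 - s"]) (auto intro!: derivative_eq_intros)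
      from DERIV_cmult[OF this, of "- 3"] show ?thesis by simp
    qed
    show "continuous_on {0..} (\<lambda>s. 6 * max 0 (r\<^sup>2 - s))" by (intro continuous_intros)
  qed
  then show ?thesis by (simp add: bump_def[abs_def])
qed

lemma bump_nonneg: "bump a r y \<ge> 0"
  by (simp add: bump_def)

lemma inner_dist: "(y - a) \<bullet> (y - a) = (dist a y)\<^sup>2"
  by (simp add: dist_norm power2_norm_eq_inner[symmetric] norm_minus_commute)

lemma bump_pos_iff:
  assumes "r \<ge> 0" shows "bump a r y > 0 \<longleftrightarrow> y \<in> ball a r"
proof -
  have "dist a y < r \<longleftrightarrow> (dist a y)\<^sup>2 < r\<^sup>2"
    using assms power_strict_mono[of "dist a y" r 2] power2_less_imp_less[of "dist a y" r] by auto
  moreover have "max 0 X ^ 3 > 0 \<longleftrightarrow> X > 0" for X :: real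
    by (cases "X > 0") (simp_all add: max_def)
  ultimately show ?thesis by (simp add: bump_def inner_dist)
qed

lemma bump_eq_0: "r \<ge> 0 \<Longrightarrow> y \<notin> cball a r \<Longrightarrow> bump a r y = 0"
  using bump_pos_iff[of r a y] bump_nonneg[of a r y] by (simp add: less_le)

text \<open>\<open>G\<close> is the Newtonian kernel as a function of the squared distance \<open>t\<close>, a negative power of \<open>t\<close> or, in dimension two,
a logarithm.  The bound by any power slightly worse than \<open>t\<^bsup>1 - n/2\<^esup>\<close> covers both cases.\<close>

lemma newton_profile:
  assumes n: "n \<ge> (2 :: nat)" and L: "L > 0" and b: "b > real n - 2"
  shows "\<exists>G C. C \<ge> 1 \<and> (\<forall>t>0. (G has_real_derivative - (t powr (- real n / 2))) (at t))
    \<and> (\<forall>t. 0 < t \<longrightarrow> t \<le> L \<longrightarrow> \<bar>G t\<bar> \<le> C * t powr (- b / 2))"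
proof (cases "n = 2")
  case True
  have b0: "b > 0" using b True by simp
  define C where "C = max 1 (L powr (b / 2) / (b / 2))"
  have "\<bar>ln L - ln t\<bar> \<le> C * t powr (- b / 2)" if t: "0 < t" "t \<le> L" for t
  proof -
    have "ln L - ln t = ln (L / t)" using t L by (simp add: ln_div)
    also have "\<dots> \<le> (L / t) powr (b / 2) / (b / 2)"
      using t b0 by (intro ln_powr_bound) auto
    also have "\<dots> = L powr (b / 2) / (b / 2) * t powr (- b / 2)"
      using t L by (simp add: powr_divide powr_minus field_simps)
    also have "\<dots> \<le> C * t powr (- b / 2)" unfolding C_def by (intro mult_right_mono) auto
    finally show ?thesis using t by (simp add: abs_of_nonneg)
  qed
  moreover have "((\<lambda>t. ln L - ln t) has_real_derivative - (t powr (- real n / 2))) (at t)" if "t > 0" for t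
    using that True by (auto intro!: derivative_eq_intros simp: powr_minus inverse_eq_divide)
  moreover have "C \<ge> 1" by (simp add: C_def)
  ultimately show ?thesis by blast
next
  case False
  then have n2: "real n > 2" using n by simp
  define k where "k = real n / 2 - 1"
  have k: "k > 0" "b / 2 \<ge> k" using n2 b by (auto simp: k_def)
  define C where "C = max 1 (L powr (b / 2 - k) / k)"
  have "\<bar>t powr (- k) / k\<bar> \<le> C * t powr (- b / 2)" if t: "0 < t" "t \<le> L" for t
  proof -
    have "t powr (- k) = t powr (b / 2 - k) * t powr (- b / 2)" by (simp flip: powr_add)
    also have "\<dots> \<le> L powr (b / 2 - k) * t powr (- b / 2)"
      using t k by (intro mult_right_mono powr_mono2) auto
    finally have "t powr (- k) / k \<le> L powr (b / 2 - k) / k * t powr (- b / 2)"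
      using k by (simp add: field_simps)
    also have "\<dots> \<le> C * t powr (- b / 2)" unfolding C_def by (intro mult_right_mono) auto
    finally show ?thesis using k by simp
  qed
  moreover have "((\<lambda>t. t powr (- k) / k) has_real_derivative - (t powr (- real n / 2))) (at t)" if "t > 0" for t
  proof -
    have "((\<lambda>t. t powr (- k) / k) has_real_derivative (- k * t powr (- k - 1)) / k) (at t)"
      using DERIV_cdivide[OF has_real_derivative_powr[OF that, of "- k"], of k] by simp
    moreover have "- k - 1 = - real n / 2" by (simp add: k_def)
    ultimately show ?thesis using k by simp
  qed
  moreover have "C \<ge> 1" by (simp add: C_def)
  ultimately show ?thesis by (intro exI[of _ "\<lambda>t. t powr (- k) / k"] exI[of _ C]) blast
qed


section \<open>The potential estimate for solutions\<close>

lemma cball_enlarge: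
  fixes a :: "real ^ 'n"
  assumes "open S" "cball a r \<subseteq> S" "r \<ge> 0"
  obtains r' where "r' > r" "cball a r' \<subseteq> S"
proof -
  obtain e where e: "e > 0" "(\<Union>x\<in>cball a r. ball x e) \<subseteq> S"
    using compact_subset_open_imp_ball_epsilon_subset[OF compact_cball assms(1,2)] by auto
  have "cball a (r + e / 2) \<subseteq> S"
  proof
    fix y assume y: "y \<in> cball a (r + e / 2)"
    show "y \<in> S"
    proof (cases "dist a y \<le> r")
      case True then show ?thesis using assms(2) by auto
    next
      case False
      define d where "d = dist a y"
      have d: "d > r" "d \<le> r + e / 2" "d > 0" using False y assms(3) by (auto simp: d_def)
      define x where "x = a + (r / d) *\<^sub>R (y - a)"
      have "norm (y - a) = d" by (simp add: d_def dist_norm norm_minus_commute)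
      then have "dist a x = r" using d assms(3) by (simp add: x_def dist_norm)
      moreover have "y - x = (1 - r / d) *\<^sub>R (y - a)" by (simp add: x_def algebra_simps)
      then have "norm (y - x) = (1 - r / d) * d" using d \<open>norm (y - a) = d\<close> by simp
      then have "dist x y = d - r" using d by (simp add: dist_norm norm_minus_commute left_diff_distrib)
      ultimately have "x \<in> cball a r" "y \<in> ball x e" using d e by auto
      then show ?thesis using e(2) by blast
    qed
  qed
  then show ?thesis using that[of "r + e / 2"] e(1) by simp
qed

text \<open>The test function is the bump \<open>X\<close> of a larger ball times the regularised Newtonian kernel \<open>N\<close> with pole \<open>x\<close>.  Its
Laplacian is \<open>- X\<close> times the mollifier plus terms with derivatives of \<open>X\<close>, so that \<open>test\<close> estimates the mollification
of \<open>u X\<close> at \<open>x\<close>.  Every other term contains \<open>N\<close> or its gradient, and these are bounded by \<open>riesz b\<close> and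
\<open>riesz (n - 1)\<close> uniformly in the regularisation parameter; hence \<open>mollifier_bound_AE\<close> applies.\<close>

lemma newton_test_inequality:
  fixes \<Omega> :: "(real ^ 'n) set" and u w :: "real ^ 'n \<Rightarrow> real" and \<nu> :: "'i \<Rightarrow> (real ^ 'n) measure"
  defines "n \<equiv> real CARD('n)"
  assumes n: "CARD('n) \<ge> 2" and \<Omega>: "open \<Omega>"
    and u: "integrable lborel u" and meas: "w \<in> borel_measurable borel" and w: "\<And>x. w x \<ge> 0"
    and I: "finite I" "\<And>i. i \<in> I \<Longrightarrow> finite_measure (\<nu> i)" "\<And>i. i \<in> I \<Longrightarrow> sets (\<nu> i) = sets borel"
    and test: "\<And>\<Phi> K. C2_on UNIV \<Phi> \<Longrightarrow> compact K \<Longrightarrow> K \<subseteq> \<Omega> \<Longrightarrow> (\<And>x. x \<notin> K \<Longrightarrow> \<Phi> x = 0) \<Longrightarrow>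
       ennreal \<bar>LINT x|lborel. u x * laplacian \<Phi> x\<bar>
       \<le> (\<integral>\<^sup>+x\<in>\<Omega>. ennreal (\<bar>u x\<bar> * w x * norm (grad \<Phi> x)) \<partial>lborel) + (\<Sum>i\<in>I. \<integral>\<^sup>+y\<in>\<Omega>. ennreal \<bar>\<Phi> y\<bar> \<partial>\<nu> i)"
    and b: "n - 2 < b" "b \<le> n - 1" and ball: "cball a r \<subseteq> \<Omega>"
  shows "\<exists>r' C. cball a r' \<subseteq> \<Omega> \<and> (AE x in lborel. x \<in> cball a r \<longrightarrow>
         ennreal \<bar>u x\<bar> \<le> ennreal C * (riesz_pot (cball a r') (n - 1) (\<lambda>y. ennreal (\<bar>u y\<bar> * (w y + 1))) x
           + (\<Sum>i\<in>I. \<integral>\<^sup>+y\<in>\<Omega>. riesz b x y \<partial>\<nu> i)))"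
proof (cases "r \<ge> 0")
  case False
  then have "cball a r = {}" by simp
  then show ?thesis by (intro exI[of _ r]) simp
next
  case r: True
  have [measurable]: "\<Omega> \<in> sets borel" "cball a r \<in> sets borel" for a :: "real ^ 'n" and r using \<Omega> by auto
  note [measurable] = meas
  have um [measurable]: "u \<in> borel_measurable borel" using u by simp
  obtain r' where r': "r' > r" "cball a r' \<subseteq> \<Omega>" using cball_enlarge[OF \<Omega> ball r] by auto
  have r'0: "r' > 0" using r r' by simp
  define X where "X = bump a r'"
  have XC2: "C2_on UNIV X" unfolding X_def by (rule C2_on_bump)
  have X0: "X y = 0" if "y \<notin> cball a r'" for y unfolding X_def using that r'0 by (intro bump_eq_0) auto
  note X_bounds = C2_compact_support_bounds[OF XC2 compact_cball[of a r'] X0]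
  obtain B where B: "B \<ge> 1" "\<And>y. \<bar>X y\<bar> \<le> B" "\<And>y. norm (grad X y) \<le> B" "\<And>y. \<bar>laplacian X y\<bar> \<le> B"
    using X_bounds(6) by blast
  \<comment> \<open>an upper bound of \<open>|y - x|\<^sup>2 + d\<^sup>2\<close> for points of the larger ball and \<open>d \<le> 1\<close>\<close>
  define L where "L = (2 * r')\<^sup>2 + 1"
  have L: "L > 0" unfolding L_def by (simp add: add_nonneg_pos)
  obtain G C0 where C0: "C0 \<ge> 1" and G: "\<And>t. t > 0 \<Longrightarrow> (G has_real_derivative - (t powr (- n / 2))) (at t)"
    "\<And>t. 0 < t \<Longrightarrow> t \<le> L \<Longrightarrow> \<bar>G t\<bar> \<le> C0 * t powr (- b / 2)"
    using newton_profile[OF n L, of b] b(1) by (auto simp: n_def)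
  have b0: "b > 0" "n \<ge> 2" using b n by (auto simp: n_def)
  define Rb where "Rb = (2 * r') powr (n - 1 - b)"
  define C1 where "C1 = B * (4 + C0 * Rb + C0)"
  have nn: "0 \<le> Rb" "0 \<le> B" "0 \<le> C0" using B C0 by (auto simp: Rb_def)
  define P where "P x = ennreal C1 * (riesz_pot (cball a r') (n - 1) (\<lambda>y. ennreal (\<bar>u y\<bar> * (w y + 1))) x
           + (\<Sum>i\<in>I. \<integral>\<^sup>+y\<in>\<Omega>. riesz b x y \<partial>\<nu> i))" for x
  have [measurable]: "(\<lambda>x. \<integral>\<^sup>+y\<in>\<Omega>. riesz b x y \<partial>\<nu> i) \<in> borel_measurable borel" if i: "i \<in> I" for i
    by (rule measurable_nn_integral_riesz[OF I(2)[OF i] I(3)[OF i]]) measurable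
  have [measurable]: "P \<in> borel_measurable borel" unfolding P_def by measurable
  have Xm [measurable]: "X \<in> borel_measurable borel" "grad X \<in> borel_measurable borel" "laplacian X \<in> borel_measurable borel"
    using X_bounds(1-3) by (auto intro: borel_measurable_continuous_onI)
  have uX: "integrable lborel (\<lambda>y. u y * X y)" by (rule integrable_mult_bounded[OF u _ B(2)]) simp
  have "AE x in lborel. x \<in> cball a r \<longrightarrow>
     (\<integral>\<^sup>+z. ennreal (mollifier 1 (0 :: real ^ 'n) z) \<partial>lborel) * ennreal \<bar>u x * X x\<bar> \<le> P x"
  proof (rule mollifier_bound_AE[OF uX])
    fix x and d :: real assume x: "x \<in> cball a r" and d: "0 < d" "d \<le> 1"
    have xr': "x \<in> cball a r'" using x r' by auto
    define t where "t y = (y - x) \<bullet> (y - x) + d\<^sup>2" for y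
    have t0: "t y > 0" for y using d by (simp add: t_def add_nonneg_pos)
    have t_dist: "(dist x y)\<^sup>2 \<le> t y" for y by (simp add: t_def inner_dist)
    have dist_le: "dist x y \<le> 2 * r'" if "y \<in> cball a r'" for y
      using dist_triangle[of x y a] xr' that by (simp add: dist_commute)
    have tL: "t y \<le> L" if "y \<in> cball a r'" for y
    proof -
      have "(dist x y)\<^sup>2 \<le> (2 * r')\<^sup>2" using dist_le[OF that] by (intro power_mono) auto
      moreover have "d\<^sup>2 \<le> 1" using d by (simp add: power_le_one)
      ultimately show ?thesis by (simp add: t_def L_def inner_dist)
    qed
    define N where "N y = G (t y)" for y
    have G': "((\<lambda>s. G (s + d\<^sup>2)) has_real_derivative - ((s + d\<^sup>2) powr (- n / 2))) (at s)" if "s \<ge> 0" for s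
    proof -
      have "s + d\<^sup>2 > 0" using that d by (simp add: add_nonneg_pos)
      then have "((\<lambda>s. G (s + d\<^sup>2)) has_real_derivative - ((s + d\<^sup>2) powr (- n / 2)) * 1) (at s)"
        by (intro DERIV_chain2[where f = G and g = "\<lambda>s. s + d\<^sup>2"] G) (auto intro!: derivative_eq_intros)
      then show ?thesis by simp
    qed
    have G'': "((\<lambda>s. - ((s + d\<^sup>2) powr (- n / 2))) has_real_derivative n / 2 * (s + d\<^sup>2) powr (- n / 2 - 1)) (at s)" if "s \<ge> 0" for s
    proof -
      have pos: "s + d\<^sup>2 > 0" using that d by (simp add: add_nonneg_pos)
      have "((\<lambda>s. (s + d\<^sup>2) powr (- n / 2)) has_real_derivative - n / 2 * (s + d\<^sup>2) powr (- n / 2 - 1) * 1) (at s)"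
      proof (rule DERIV_chain2[where f = "\<lambda>t. t powr (- n / 2)" and g = "\<lambda>s. s + d\<^sup>2"])
        show "((\<lambda>t. t powr (- n / 2)) has_real_derivative - n / 2 * (s + d\<^sup>2) powr (- n / 2 - 1)) (at (s + d\<^sup>2))"
          using has_real_derivative_powr[OF pos, of "- n / 2"] by simp
      qed (auto intro!: derivative_eq_intros)
      from DERIV_minus[OF this] show ?thesis by simp
    qed
    have NC2: "C2_on UNIV N"
    proof -
      have "continuous_on {0..} (\<lambda>s. n / 2 * (s + d\<^sup>2) powr (- n / 2 - 1))"
        using d by (intro continuous_intros) (auto simp: add_nonneg_eq_0_iff)
      then show ?thesis using C2_on_radial[OF G' G'', of x] by (simp add: N_def[abs_def] t_def)
    qed
    have gradN: "grad N y = (- 2 * t y powr (- n / 2)) *\<^sub>R (y - x)" for y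
      using grad_radial[OF G', of x y] by (simp add: N_def[abs_def] t_def)
    have lapN: "laplacian N y = - mollifier d x y" for y
    proof -
      have "laplacian N y = 2 * n * t y powr (- n / 2 - 1) * ((y - x) \<bullet> (y - x)) - 2 * n * t y powr (- n / 2)"
        using laplacian_radial[OF G' G'', of x y] by (simp add: N_def[abs_def] t_def n_def)
      \<comment> \<open>the squared distance is \<open>t y - d\<^sup>2\<close>, so only the term with \<open>d\<^sup>2\<close> survives\<close>
      also have "t y powr (- n / 2) = t y powr (- n / 2 - 1) * t y"
        using t0[of y] by (simp add: powr_diff)
      finally show ?thesis
        by (simp add: mollifier_def t_def n_def algebra_simps)
    qed
    have normN: "ennreal (norm (grad N y)) \<le> ennreal 2 * riesz (n - 1) x y" for y
    proof (cases "x = y")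
      case False
      then have pos: "dist x y > 0" by simp
      have "t y powr (- n / 2) \<le> ((dist x y)\<^sup>2) powr (- n / 2)"
        using t_dist pos b0 by (intro powr_mono2') auto
      also have "\<dots> = dist x y powr (- n)"
        using pos by (simp add: power2_powr)
      finally have "norm (grad N y) \<le> 2 * dist x y powr (- n) * dist x y"
        by (simp add: gradN dist_norm norm_minus_commute mult_right_mono)
      also have "\<dots> = 2 * dist x y powr (- (n - 1))"
        using pos by (simp add: powr_diff powr_minus field_simps)
      finally have "ennreal (norm (grad N y)) \<le> ennreal (2 * dist x y powr (- (n - 1)))" by (rule ennreal_leI)
      then show ?thesis using False by (simp add: riesz_def ennreal_mult)
    qed (simp add: riesz_def ennreal_mult_top)
    have absN: "ennreal \<bar>N y\<bar> \<le> ennreal C0 * riesz b x y" if y: "y \<in> cball a r'" for y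
    proof (cases "x = y")
      case True
      then show ?thesis using C0 by (simp add: riesz_def ennreal_mult_top)
    next
      case False
      then have pos: "dist x y > 0" by simp
      have "\<bar>N y\<bar> \<le> C0 * t y powr (- b / 2)" unfolding N_def using G(2) t0 tL[OF y] by simp
      also have "\<dots> \<le> C0 * ((dist x y)\<^sup>2) powr (- b / 2)"
        using t_dist pos b0 C0 by (intro mult_left_mono powr_mono2') auto
      also have "((dist x y)\<^sup>2) powr (- b / 2) = dist x y powr (- b)"
        using pos by (simp add: power2_powr)
      finally have "ennreal \<bar>N y\<bar> \<le> ennreal (C0 * dist x y powr (- b))" by (rule ennreal_leI)
      then show ?thesis using False C0 by (simp add: riesz_def ennreal_mult)
    qed
    have absN': "ennreal \<bar>N y\<bar> \<le> ennreal (C0 * Rb) * riesz (n - 1) x y" if y: "y \<in> cball a r'" for y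
    proof -
      have "ennreal \<bar>N y\<bar> \<le> ennreal C0 * (ennreal Rb * riesz (n - 1) x y)"
        unfolding Rb_def using r'0 b dist_le[OF y]
        by (intro order_trans[OF absN[OF y]] mult_left_mono riesz_mono_exponent) auto
      then show ?thesis using nn by (simp add: ennreal_mult mult.assoc)
    qed
    have comb: "ennreal (k1 * norm (grad N y) + k2 * \<bar>N y\<bar>) \<le> ennreal C1 * riesz (n - 1) x y"
      if y: "y \<in> cball a r'" and k: "0 \<le> k1" "k1 \<le> 2 * B" "0 \<le> k2" "k2 \<le> B" for y k1 k2
    proof -
      have "ennreal (k1 * norm (grad N y) + k2 * \<bar>N y\<bar>) = ennreal k1 * ennreal (norm (grad N y)) + ennreal k2 * ennreal \<bar>N y\<bar>"
        using k by (simp add: ennreal_mult)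
      also have "\<dots> \<le> ennreal (2 * B) * (ennreal 2 * riesz (n - 1) x y) + ennreal B * (ennreal (C0 * Rb) * riesz (n - 1) x y)"
        using k by (intro add_mono mult_mono normN absN' y ennreal_leI) auto
      also have "\<dots> = ennreal (2 * B * 2 + B * (C0 * Rb)) * riesz (n - 1) x y"
      proof -
        have "ennreal (2 * B * 2 + B * (C0 * Rb)) = ennreal (2 * B * 2) + ennreal (B * (C0 * Rb))"
          by (rule ennreal_plus) (use nn in auto)
        moreover have "ennreal (2 * B * 2) = ennreal (2 * B) * ennreal 2"
          by (rule ennreal_mult) (use nn in auto)
        moreover have "ennreal (B * (C0 * Rb)) = ennreal B * ennreal (C0 * Rb)"
          by (rule ennreal_mult) (use nn in auto)
        ultimately show ?thesis by (simp only: distrib_right mult.assoc)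
      qed
      also have "\<dots> \<le> ennreal C1 * riesz (n - 1) x y"
        using nn by (intro mult_right_mono ennreal_leI) (auto simp: C1_def algebra_simps)
      finally show ?thesis .
    qed
    define \<Phi> where "\<Phi> y = X y * N y" for y
    have \<Phi>C2: "C2_on UNIV \<Phi>" unfolding \<Phi>_def[abs_def] by (rule C2_on_mult[OF open_UNIV XC2 NC2])
    have \<Phi>0: "\<Phi> y = 0" if "y \<notin> cball a r'" for y using X0[OF that] by (simp add: \<Phi>_def)
    note \<Phi>_bounds = C2_compact_support_bounds[OF \<Phi>C2 compact_cball[of a r'] \<Phi>0]
    obtain B' where B': "\<And>y. \<bar>laplacian \<Phi> y\<bar> \<le> B'" using \<Phi>_bounds(6) by blast
    have [measurable]: "laplacian \<Phi> \<in> borel_measurable borel" "grad \<Phi> \<in> borel_measurable borel"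
      using \<Phi>_bounds by (auto intro: borel_measurable_continuous_onI)
    have lap\<Phi>: "laplacian \<Phi> y = - X y * mollifier d x y + 2 * (grad X y \<bullet> grad N y) + N y * laplacian X y" for y
      unfolding \<Phi>_def[abs_def] using laplacian_mult[OF open_UNIV UNIV_I XC2 NC2, of y] by (simp add: lapN)
    have grad\<Phi>: "grad \<Phi> y = X y *\<^sub>R grad N y + N y *\<^sub>R grad X y" for y
      unfolding \<Phi>_def[abs_def]
      by (rule grad_mult) (auto intro: C2_on_differentiable[OF XC2] C2_on_differentiable[OF NC2])
    define Z where "Z y = 2 * (grad X y \<bullet> grad N y) + N y * laplacian X y" for y
    have Z: "ennreal \<bar>Z y\<bar> \<le> ennreal C1 * riesz (n - 1) x y * indicator (cball a r') y" for y
    proof (cases "y \<in> cball a r'")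
      case True
      have "\<bar>Z y\<bar> \<le> 2 * \<bar>grad X y \<bullet> grad N y\<bar> + \<bar>N y\<bar> * \<bar>laplacian X y\<bar>"
        unfolding Z_def by (simp add: abs_mult[symmetric])
      also have "\<dots> \<le> 2 * (B * norm (grad N y)) + \<bar>N y\<bar> * B"
        using Cauchy_Schwarz_ineq2[of "grad X y" "grad N y"] B(3)[of y] B(4)[of y]
        by (intro add_mono mult_left_mono order_trans[OF Cauchy_Schwarz_ineq2] mult_right_mono) auto
      finally have "\<bar>Z y\<bar> \<le> 2 * B * norm (grad N y) + B * \<bar>N y\<bar>" by (simp add: mult_ac)
      then have "ennreal \<bar>Z y\<bar> \<le> ennreal (2 * B * norm (grad N y) + B * \<bar>N y\<bar>)" by (rule ennreal_leI)
      also have "\<dots> \<le> ennreal C1 * riesz (n - 1) x y" using nn by (intro comb True) auto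
      finally show ?thesis using True by simp
    next
      case False
      then show ?thesis using X_bounds(4)[of y] X_bounds(5)[of y] False by (simp add: Z_def)
    qed
    have gr: "ennreal (norm (grad \<Phi> y)) \<le> ennreal C1 * riesz (n - 1) x y * indicator (cball a r') y" for y
    proof (cases "y \<in> cball a r'")
      case True
      have "norm (grad \<Phi> y) \<le> norm (X y *\<^sub>R grad N y) + norm (N y *\<^sub>R grad X y)"
        unfolding grad\<Phi> by (rule norm_triangle_ineq)
      also have "\<dots> \<le> B * norm (grad N y) + B * \<bar>N y\<bar>"
        using mult_right_mono[OF B(2)[of y], of "norm (grad N y)"] mult_right_mono[OF B(3)[of y], of "\<bar>N y\<bar>"]
        by (simp add: mult.commute[of "\<bar>N y\<bar>"])
      finally have "ennreal (norm (grad \<Phi> y)) \<le> ennreal (B * norm (grad N y) + B * \<bar>N y\<bar>)" by (rule ennreal_leI)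
      also have "\<dots> \<le> ennreal C1 * riesz (n - 1) x y" using nn by (intro comb True) auto
      finally show ?thesis using True by simp
    next
      case False
      then show ?thesis using \<Phi>_bounds(4)[of y] False by simp
    qed
    have ph: "ennreal \<bar>\<Phi> y\<bar> \<le> ennreal C1 * riesz b x y" for y
    proof (cases "y \<in> cball a r'")
      case True
      have "ennreal \<bar>\<Phi> y\<bar> = ennreal \<bar>X y\<bar> * ennreal \<bar>N y\<bar>" by (simp add: \<Phi>_def abs_mult ennreal_mult)
      also have "\<dots> \<le> ennreal B * (ennreal C0 * riesz b x y)"
        using B(2) by (intro mult_mono absN True ennreal_leI) auto
      also have "\<dots> = ennreal (B * C0) * riesz b x y" using nn by (simp add: ennreal_mult mult.assoc)
      also have "\<dots> \<le> ennreal C1 * riesz b x y"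
        using nn by (intro mult_right_mono ennreal_leI) (auto simp: C1_def algebra_simps)
      finally show ?thesis .
    qed (simp add: \<Phi>0)
    have [measurable]: "Z \<in> borel_measurable borel"
    proof -
      have "continuous_on UNIV (grad N)" unfolding gradN[abs_def] t_def
        using t0 by (intro continuous_intros) (auto simp: t_def less_imp_neq[symmetric])
      moreover have "continuous_on UNIV N" using NC2 by (auto simp: C2_on_def intro: C1_on_continuous)
      ultimately have "continuous_on UNIV Z" unfolding Z_def[abs_def] using X_bounds(2,3) by (intro continuous_intros)
      then show ?thesis by (rule borel_measurable_continuous_onI)
    qed
    have u\<Phi>: "integrable lborel (\<lambda>y. u y * laplacian \<Phi> y)" by (rule integrable_mult_bounded[OF u _ B']) simp
    have um: "integrable lborel (\<lambda>y. u y * X y * mollifier d x y)"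
      by (rule integrable_mult_bounded[OF uX, where B = "2 * real CARD('n) * d\<^sup>2 * (d\<^sup>2) powr (- real CARD('n) / 2 - 1)"])
        (use mollifier_le[OF d(1), of x] in \<open>auto simp: mollifier_nonneg\<close>)
    have uZeq: "u y * Z y = u y * laplacian \<Phi> y + u y * X y * mollifier d x y" for y
      by (simp add: Z_def lap\<Phi> algebra_simps)
    then have uZ: "integrable lborel (\<lambda>y. u y * Z y)" using u\<Phi> um by simp
    have "(LINT y|lborel. u y * Z y) = (LINT y|lborel. u y * laplacian \<Phi> y) + (LINT y|lborel. u y * X y * mollifier d x y)"
      unfolding uZeq using u\<Phi> um by (rule Bochner_Integration.integral_add)
    then have "\<bar>LINT y|lborel. u y * X y * mollifier d x y\<bar> \<le> \<bar>LINT y|lborel. u y * laplacian \<Phi> y\<bar> + \<bar>LINT y|lborel. u y * Z y\<bar>"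
      by linarith
    then have "ennreal \<bar>LINT y|lborel. u y * X y * mollifier d x y\<bar>
        \<le> ennreal (\<bar>LINT y|lborel. u y * laplacian \<Phi> y\<bar> + \<bar>LINT y|lborel. u y * Z y\<bar>)" by (rule ennreal_leI)
    also have "\<dots> = ennreal \<bar>LINT y|lborel. u y * laplacian \<Phi> y\<bar> + ennreal \<bar>LINT y|lborel. u y * Z y\<bar>" by simp
    also have "\<dots> \<le> ((\<integral>\<^sup>+x\<in>\<Omega>. ennreal (\<bar>u x\<bar> * w x * norm (grad \<Phi> x)) \<partial>lborel) + (\<Sum>i\<in>I. \<integral>\<^sup>+y\<in>\<Omega>. ennreal \<bar>\<Phi> y\<bar> \<partial>\<nu> i))
        + (\<integral>\<^sup>+y. ennreal \<bar>u y * Z y\<bar> \<partial>lborel)"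
      using integral_norm_bound_ennreal[OF uZ] by (intro add_mono test[OF \<Phi>C2 compact_cball[of a r'] r'(2) \<Phi>0]) auto
    also have "\<dots> \<le> ((\<integral>\<^sup>+y. ennreal C1 * (riesz (n - 1) x y * ennreal (\<bar>u y\<bar> * w y) * indicator (cball a r') y) \<partial>lborel)
          + (\<Sum>i\<in>I. ennreal C1 * (\<integral>\<^sup>+y\<in>\<Omega>. riesz b x y \<partial>\<nu> i)))
        + (\<integral>\<^sup>+y. ennreal C1 * (riesz (n - 1) x y * ennreal \<bar>u y\<bar> * indicator (cball a r') y) \<partial>lborel)"
    proof (intro add_mono sum_mono nn_integral_mono)
      fix y
      have "ennreal (\<bar>u y\<bar> * w y * norm (grad \<Phi> y)) * indicator \<Omega> y \<le> ennreal (\<bar>u y\<bar> * w y * norm (grad \<Phi> y))"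
        by (simp add: indicator_def)
      also have "\<dots> = ennreal (\<bar>u y\<bar> * w y) * ennreal (norm (grad \<Phi> y))" using w[of y] by (simp add: ennreal_mult)
      also have "\<dots> \<le> ennreal (\<bar>u y\<bar> * w y) * (ennreal C1 * riesz (n - 1) x y * indicator (cball a r') y)"
        by (intro mult_left_mono gr) simp
      finally show "ennreal (\<bar>u y\<bar> * w y * norm (grad \<Phi> y)) * indicator \<Omega> y
         \<le> ennreal C1 * (riesz (n - 1) x y * ennreal (\<bar>u y\<bar> * w y) * indicator (cball a r') y)"
        by (simp only: mult_ac)
      have "ennreal \<bar>u y * Z y\<bar> = ennreal \<bar>u y\<bar> * ennreal \<bar>Z y\<bar>" by (simp add: abs_mult ennreal_mult)
      also have "\<dots> \<le> ennreal \<bar>u y\<bar> * (ennreal C1 * riesz (n - 1) x y * indicator (cball a r') y)"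
        by (intro mult_left_mono Z) simp
      finally show "ennreal \<bar>u y * Z y\<bar> \<le> ennreal C1 * (riesz (n - 1) x y * ennreal \<bar>u y\<bar> * indicator (cball a r') y)"
        by (simp only: mult_ac)
    next
      fix i assume i: "i \<in> I"
      note [measurable_cong] = I(3)[OF i]
      have "(\<integral>\<^sup>+y\<in>\<Omega>. ennreal \<bar>\<Phi> y\<bar> \<partial>\<nu> i) \<le> (\<integral>\<^sup>+y. ennreal C1 * (riesz b x y * indicator \<Omega> y) \<partial>\<nu> i)"
        using ph by (intro nn_integral_mono) (auto simp: mult.assoc[symmetric] intro!: mult_right_mono)
      also have "\<dots> = ennreal C1 * (\<integral>\<^sup>+y\<in>\<Omega>. riesz b x y \<partial>\<nu> i)" by (rule nn_integral_cmult) measurable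
      finally show "(\<integral>\<^sup>+y\<in>\<Omega>. ennreal \<bar>\<Phi> y\<bar> \<partial>\<nu> i) \<le> ennreal C1 * (\<integral>\<^sup>+y\<in>\<Omega>. riesz b x y \<partial>\<nu> i)" .
    qed
    also have "\<dots> = P x"
    proof -
      have "riesz_pot (cball a r') (n - 1) (\<lambda>y. ennreal (\<bar>u y\<bar> * (w y + 1))) x
        = (\<integral>\<^sup>+y. riesz (n - 1) x y * ennreal (\<bar>u y\<bar> * w y) * indicator (cball a r') y + riesz (n - 1) x y * ennreal \<bar>u y\<bar> * indicator (cball a r') y \<partial>lborel)"
        unfolding riesz_pot_def using w
        by (intro nn_integral_cong) (simp add: distrib_left ennreal_plus distrib_right mult_ac)
      also have "\<dots> = (\<integral>\<^sup>+y. riesz (n - 1) x y * ennreal (\<bar>u y\<bar> * w y) * indicator (cball a r') y \<partial>lborel)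
         + (\<integral>\<^sup>+y. riesz (n - 1) x y * ennreal \<bar>u y\<bar> * indicator (cball a r') y \<partial>lborel)"
        by (rule nn_integral_add) measurable
      finally show ?thesis
        unfolding P_def by (simp add: nn_integral_cmult distrib_left sum_distrib_left add_ac)
    qed
    finally show "ennreal \<bar>LINT y|lborel. u y * X y * mollifier d x y\<bar> \<le> P x" .
  qed measurable
  moreover obtain c where c: "(\<integral>\<^sup>+z. ennreal (mollifier 1 (0 :: real ^ 'n) z) \<partial>lborel) = ennreal c" "c > 0"
    using mollifier_mass_finite[where 'n = 'n] mollifier_mass_pos[where 'n = 'n]
    by (cases "\<integral>\<^sup>+z. ennreal (mollifier 1 (0 :: real ^ 'n) z) \<partial>lborel") auto
  \<comment> \<open>\<open>m0\<close> is the minimum of the bump on the smaller ball\<close>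
  define m0 where "m0 = (r'\<^sup>2 - r\<^sup>2) ^ 3"
  have m0: "m0 > 0" unfolding m0_def using r r' by (intro zero_less_power) (simp add: power_strict_mono)
  have Xm0: "X x \<ge> m0" if "x \<in> cball a r" for x
  proof -
    have "(dist a x)\<^sup>2 \<le> r\<^sup>2" using that by (intro power_mono) auto
    moreover have "r\<^sup>2 \<le> r'\<^sup>2" using r r' by (intro power_mono) auto
    ultimately show ?thesis unfolding m0_def X_def bump_def inner_dist by (intro power_mono) auto
  qed
  ultimately have "AE x in lborel. x \<in> cball a r \<longrightarrow> ennreal \<bar>u x\<bar> \<le> ennreal (1 / (c * m0)) * P x"
  proof (elim eventually_mono, intro impI)
    fix x assume x: "x \<in> cball a r" and le: "x \<in> cball a r \<longrightarrow>
      (\<integral>\<^sup>+z. ennreal (mollifier 1 (0 :: real ^ 'n) z) \<partial>lborel) * ennreal \<bar>u x * X x\<bar> \<le> P x"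
    have "\<bar>u x\<bar> * (c * m0) \<le> \<bar>u x\<bar> * (c * X x)" using Xm0[OF x] c(2) by (intro mult_left_mono) auto
    also have "\<dots> = c * \<bar>u x * X x\<bar>" by (simp add: abs_mult X_def bump_nonneg)
    finally have "ennreal (\<bar>u x\<bar> * (c * m0)) \<le> ennreal c * ennreal \<bar>u x * X x\<bar>"
      using c(2) by (simp add: ennreal_mult[symmetric] ennreal_leI)
    also have "\<dots> \<le> P x" using le x c(1) by simp
    finally have "ennreal (1 / (c * m0)) * ennreal (\<bar>u x\<bar> * (c * m0)) \<le> ennreal (1 / (c * m0)) * P x"
      by (rule mult_left_mono) simp
    moreover have "1 / (c * m0) * (\<bar>u x\<bar> * (c * m0)) = \<bar>u x\<bar>" using c(2) m0 by simp
    ultimately show "ennreal \<bar>u x\<bar> \<le> ennreal (1 / (c * m0)) * P x"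
      using c(2) m0 by (simp add: ennreal_mult[symmetric] del: times_divide_eq_left)
  qed
  moreover have "ennreal (1 / (c * m0)) * P x = ennreal (1 / (c * m0) * C1) * (riesz_pot (cball a r') (n - 1) (\<lambda>y. ennreal (\<bar>u y\<bar> * (w y + 1))) x
           + (\<Sum>i\<in>I. \<integral>\<^sup>+y\<in>\<Omega>. riesz b x y \<partial>\<nu> i))" for x
    unfolding P_def using c(2) m0 nn by (subst ennreal_mult) (auto simp: C1_def mult.assoc)
  ultimately show ?thesis using r'(2) by auto
qed


section \<open>Borel representatives and the data of the equation\<close>

text \<open>Tonelli's theorem is applied to Lebesgue measure on the Borel sets, so the data of the equation, which are only
Lebesgue measurable on \<open>S\<close>, are replaced by Borel functions on the whole space.\<close>

lemma borel_representative:
  fixes S :: "(real ^ 'n) set" and g :: "real ^ 'n \<Rightarrow> real"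
  assumes S: "S \<in> sets borel" and g: "g \<in> borel_measurable (lebesgue_on S)"
  shows "\<exists>g'\<in>borel_measurable borel. (AE x in lebesgue_on S. g x = g' x) \<and> (\<forall>x. x \<notin> S \<longrightarrow> g' x = 0)"
proof -
  have SL: "S \<in> sets lebesgue" using S by simp
  have "(\<lambda>x. indicat_real S x *\<^sub>R g x) \<in> borel_measurable lebesgue"
    using g borel_measurable_restrict_space_iff[of S lebesgue g] SL by simp
  then obtain h where h: "h \<in> borel_measurable lborel" "AE x in lborel. indicat_real S x *\<^sub>R g x = h x"
    using completion_ex_borel_measurable_real[of "\<lambda>x. indicat_real S x *\<^sub>R g x" lborel] by auto
  have "AE x in lebesgue. indicat_real S x *\<^sub>R g x = h x" using h(2) by (rule AE_completion)
  then have "AE x in lebesgue. x \<in> S \<longrightarrow> g x = indicat_real S x * h x"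
    by (elim eventually_mono) auto
  then have "AE x in lebesgue_on S. g x = indicat_real S x * h x"
    using SL by (simp add: AE_restrict_space_iff)
  moreover have "(\<lambda>x. indicat_real S x * h x) \<in> borel_measurable borel" using h(1) S by measurable
  ultimately show ?thesis by (intro bexI[of _ "\<lambda>x. indicat_real S x * h x"]) auto
qed

lemma borel_imp_lebesgue_on:
  "g \<in> borel_measurable borel \<Longrightarrow> g \<in> borel_measurable (lebesgue_on S)"
  by (simp add: measurable_completion measurable_restrict_space1)

lemma nn_integral_lebesgue_on:
  fixes S :: "(real ^ 'n) set"
  assumes [measurable]: "S \<in> sets borel" "g \<in> borel_measurable borel"
  shows "(\<integral>\<^sup>+x. g x \<partial>lebesgue_on S) = (\<integral>\<^sup>+x\<in>S. g x \<partial>lborel)"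
proof -
  have "(\<integral>\<^sup>+x. g x \<partial>lebesgue_on S) = (\<integral>\<^sup>+x. g x * indicator S x \<partial>lebesgue)"
    by (rule nn_integral_restrict_space) simp
  also have "\<dots> = (\<integral>\<^sup>+x. g x * indicator S x \<partial>lborel)" by (rule nn_integral_completion)
  finally show ?thesis .
qed

lemma integral_lebesgue_on:
  fixes S :: "(real ^ 'n) set" and g :: "real ^ 'n \<Rightarrow> real"
  assumes [measurable]: "S \<in> sets borel" "g \<in> borel_measurable borel" and 0: "\<And>x. x \<notin> S \<Longrightarrow> g x = 0"
  shows "(LINT x|lebesgue_on S. g x) = (LINT x|lborel. g x)"
    and "integrable (lebesgue_on S) g \<longleftrightarrow> integrable lborel g"
proof -
  have eq: "(\<lambda>x. indicat_real S x *\<^sub>R g x) = g" using 0 by (auto simp: fun_eq_iff indicator_def)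
  have "(LINT x|lebesgue_on S. g x) = (LINT x|lebesgue. indicat_real S x *\<^sub>R g x)"
    by (rule integral_restrict_space) simp
  also have "\<dots> = (LINT x|lborel. g x)" unfolding eq by (rule integral_completion) simp
  finally show "(LINT x|lebesgue_on S. g x) = (LINT x|lborel. g x)" .
  have "integrable (lebesgue_on S) g \<longleftrightarrow> integrable lebesgue (\<lambda>x. indicat_real S x *\<^sub>R g x)"
    by (rule integrable_restrict_space) simp
  also have "\<dots> \<longleftrightarrow> integrable lborel g" unfolding eq by (rule integrable_completion) simp
  finally show "integrable (lebesgue_on S) g \<longleftrightarrow> integrable lborel g" .
qed

lemma sum_powr_le:
  fixes a :: "'i \<Rightarrow> real"
  assumes "finite S" "\<And>i. i \<in> S \<Longrightarrow> a i \<ge> 0" "q > 0"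
  shows "(\<Sum>i\<in>S. a i) powr q \<le> real (card S) powr q * (\<Sum>i\<in>S. a i powr q)"
proof (cases "S = {}")
  case False
  define m where "m = Max (a ` S)"
  have m: "a i \<le> m" if "i \<in> S" for i using assms(1) that by (simp add: m_def)
  have "m \<in> a ` S" unfolding m_def using assms(1) False by (intro Max_in) auto
  then obtain j where j: "j \<in> S" "m = a j" by auto
  have "(\<Sum>i\<in>S. a i) \<le> real (card S) * m" using sum_bounded_above[of S a m] m by simp
  then have "(\<Sum>i\<in>S. a i) powr q \<le> (real (card S) * m) powr q"
    using assms by (intro powr_mono2) (auto intro: sum_nonneg)
  also have "\<dots> = real (card S) powr q * m powr q" using j assms(2) by (simp add: powr_mult)
  also have "\<dots> \<le> real (card S) powr q * (\<Sum>i\<in>S. a i powr q)"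
    using member_le_sum[of j S "\<lambda>i. a i powr q"] j assms(1) by (intro mult_left_mono) auto
  finally show ?thesis .
qed simp

lemma measurable_norm_components:
  fixes U :: "'a \<Rightarrow> real ^ 'n"
  assumes "\<And>i. (\<lambda>x. U x $ i) \<in> borel_measurable M"
  shows "(\<lambda>x. norm (U x)) \<in> borel_measurable M"
  unfolding norm_vec_def L2_set_def using assms by measurable

lemma drift_Lq:
  fixes U :: "real ^ 'n \<Rightarrow> real ^ 'n"
  assumes p: "p \<ge> 1" and q: "0 < q" "q < p" and S: "open S" "bounded S"
    and U: "\<And>i. (\<lambda>x. U x $ i) \<in> lorentz_space S p"
  shows "(\<integral>\<^sup>+x. ennreal ((norm (U x) + 1) powr q) \<partial>lebesgue_on S) < \<infinity>"
proof -
  have Um [measurable]: "(\<lambda>x. U x $ i) \<in> borel_measurable (lebesgue_on S)" for i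
    using U by (simp add: lorentz_space_def)
  have SL: "S \<in> sets lebesgue" using S by simp
  have fin: "emeasure lebesgue S < \<infinity>" using emeasure_bounded_finite[OF S(2)] by (simp add: S(1) borel_open)
  define c where "c = 2 powr q"
  define k where "k = real CARD('n) powr q"
  have le: "ennreal ((norm (U x) + 1) powr q)
      \<le> ennreal c + ennreal (c * k) * (\<Sum>i\<in>UNIV. ennreal (\<bar>U x $ i\<bar> powr q))" for x
  proof -
    define a where "a = norm (U x)"
    have "a powr q \<le> (\<Sum>i\<in>UNIV. \<bar>U x $ i\<bar>) powr q"
      unfolding a_def using q norm_le_l1_cart[of "U x"] by (intro powr_mono2) auto
    also have "\<dots> \<le> k * (\<Sum>i\<in>UNIV. \<bar>U x $ i\<bar> powr q)"
      unfolding k_def using q by (intro sum_powr_le) auto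
    finally have 1: "a powr q \<le> k * (\<Sum>i\<in>UNIV. \<bar>U x $ i\<bar> powr q)" .
    have "(a + 1) powr q \<le> (2 * max a 1) powr q" using q by (intro powr_mono2) (auto simp: a_def)
    also have "\<dots> = c * (max a 1) powr q" by (simp add: c_def powr_mult)
    also have "\<dots> \<le> c * (1 + a powr q)" by (intro mult_left_mono) (auto simp: c_def max_def)
    also have "\<dots> \<le> c * (1 + k * (\<Sum>i\<in>UNIV. \<bar>U x $ i\<bar> powr q))"
      using 1 by (intro mult_left_mono) (auto simp: c_def)
    finally have "ennreal ((a + 1) powr q) \<le> ennreal (c + c * k * (\<Sum>i\<in>UNIV. \<bar>U x $ i\<bar> powr q))"
      by (intro ennreal_leI) (simp add: algebra_simps)
    also have "\<dots> = ennreal c + ennreal (c * k) * (\<Sum>i\<in>UNIV. ennreal (\<bar>U x $ i\<bar> powr q))"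
      by (simp add: c_def k_def ennreal_mult sum_nonneg sum_ennreal)
    finally show ?thesis by (simp add: a_def)
  qed
  have "(\<integral>\<^sup>+x. ennreal ((norm (U x) + 1) powr q) \<partial>lebesgue_on S)
     \<le> (\<integral>\<^sup>+x. ennreal c + ennreal (c * k) * (\<Sum>i\<in>UNIV. ennreal (\<bar>U x $ i\<bar> powr q)) \<partial>lebesgue_on S)"
    by (intro nn_integral_mono le)
  also have "\<dots> = ennreal c * emeasure (lebesgue_on S) (space (lebesgue_on S))
     + ennreal (c * k) * (\<Sum>i\<in>UNIV. \<integral>\<^sup>+x. ennreal (\<bar>U x $ i\<bar> powr q) \<partial>lebesgue_on S)"
  proof -
    have m1: "(\<lambda>x. ennreal (\<bar>U x $ i\<bar> powr q)) \<in> borel_measurable (lebesgue_on S)" for i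
      using Um[of i] by measurable
    have m2: "(\<lambda>x. \<Sum>i\<in>UNIV. ennreal (\<bar>U x $ i\<bar> powr q)) \<in> borel_measurable (lebesgue_on S)"
      by (intro borel_measurable_sum m1)
    have "(\<integral>\<^sup>+x. ennreal c + ennreal (c * k) * (\<Sum>i\<in>UNIV. ennreal (\<bar>U x $ i\<bar> powr q)) \<partial>lebesgue_on S)
       = (\<integral>\<^sup>+x. ennreal c \<partial>lebesgue_on S) + (\<integral>\<^sup>+x. ennreal (c * k) * (\<Sum>i\<in>UNIV. ennreal (\<bar>U x $ i\<bar> powr q)) \<partial>lebesgue_on S)"
      by (rule nn_integral_add[OF borel_measurable_const borel_measurable_times_ennreal[OF borel_measurable_const m2]])
    also have "(\<integral>\<^sup>+x. ennreal (c * k) * (\<Sum>i\<in>UNIV. ennreal (\<bar>U x $ i\<bar> powr q)) \<partial>lebesgue_on S)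
       = ennreal (c * k) * (\<integral>\<^sup>+x. (\<Sum>i\<in>UNIV. ennreal (\<bar>U x $ i\<bar> powr q)) \<partial>lebesgue_on S)"
      by (rule nn_integral_cmult[OF m2])
    also have "(\<integral>\<^sup>+x. (\<Sum>i\<in>UNIV. ennreal (\<bar>U x $ i\<bar> powr q)) \<partial>lebesgue_on S)
       = (\<Sum>i\<in>UNIV. \<integral>\<^sup>+x. ennreal (\<bar>U x $ i\<bar> powr q) \<partial>lebesgue_on S)"
      by (rule nn_integral_sum[OF m1])
    also have "(\<integral>\<^sup>+x. ennreal c \<partial>lebesgue_on S) = ennreal c * emeasure (lebesgue_on S) (space (lebesgue_on S))"
      by (rule nn_integral_const)
    finally show ?thesis .
  qed
  also have "\<dots> < \<infinity>"
  proof -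
    have "(\<integral>\<^sup>+x. ennreal (\<bar>U x $ i\<bar> powr q) \<partial>lebesgue_on S) < top" for i
      using lorentz_space_Lq[OF p q fin SL U] by simp
    then have "(\<Sum>i\<in>UNIV. \<integral>\<^sup>+x. ennreal (\<bar>U x $ i\<bar> powr q) \<partial>lebesgue_on S) < top" by simp
    moreover have "emeasure (lebesgue_on S) (space (lebesgue_on S)) < top"
      using fin SL by (simp add: emeasure_restrict_space space_restrict_space)
    ultimately show ?thesis by (simp add: ennreal_mult_less_top)
  qed
  finally show ?thesis .
qed

lemma finite_upper_measure:
  assumes f: "bounded_radon_measure S f"
  defines "M \<equiv> restrict_space borel S"
  shows "finite_measure (upper_measure M f)" "finite_measure (lower_measure M f)"
    "signed_measure M f" "signed_measure M (\<lambda>B. - f B)"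
proof -
  show s: "signed_measure M f" "signed_measure M (\<lambda>B. - f B)"
    using f signed_measure_uminus by (auto simp: bounded_radon_measure_def M_def)
  have sp: "space M = S" by (simp add: M_def space_restrict_space)
  have tv: "total_var M f S < \<infinity>" using f by (simp add: bounded_radon_measure_def M_def)
  have "emeasure (upper_measure M f) (space M) \<noteq> \<infinity>" "emeasure (lower_measure M f) (space M) \<noteq> \<infinity>"
    using tv by (auto simp: emeasure_upper_measure[OF s(1)] emeasure_upper_measure[OF s(2)] sp total_var_def
       simp flip: sp)
  then show "finite_measure (upper_measure M f)" "finite_measure (lower_measure M f)"
    by (auto intro!: finite_measureI)
qed


section \<open>Interior regularity of solutions\<close>

lemma integrable_potential_term:
  assumes u: "u \<in> L1_weighted S V" and V: "V \<in> borel_measurable (lebesgue_on S)"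
  shows "integrable (lebesgue_on S) (\<lambda>x. u x * enn2real (V x))"
proof (rule integrableI_bounded)
  note [measurable] = V
  have [measurable]: "u \<in> borel_measurable (lebesgue_on S)" using u by (simp add: L1_weighted_def)
  show "(\<lambda>x. u x * enn2real (V x)) \<in> borel_measurable (lebesgue_on S)" by measurable
  have "(\<integral>\<^sup>+x. ennreal (norm (u x * enn2real (V x))) \<partial>lebesgue_on S) \<le> (\<integral>\<^sup>+x. ennreal \<bar>u x\<bar> * V x \<partial>lebesgue_on S)"
  proof (rule nn_integral_mono)
    fix x
    have "ennreal (enn2real (V x)) \<le> V x" by (cases "V x") auto
    then show "ennreal (norm (u x * enn2real (V x))) \<le> ennreal \<bar>u x\<bar> * V x"
      by (simp add: abs_mult ennreal_mult mult_left_mono)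
  qed
  also have "\<dots> < \<infinity>" using u by (simp add: L1_weighted_def)
  finally show "(\<integral>\<^sup>+x. ennreal (norm (u x * enn2real (V x))) \<partial>lebesgue_on S) < \<infinity>" .
qed

lemma measurable_inner_components:
  fixes U G :: "'a \<Rightarrow> real ^ 'n"
  assumes "\<And>i. (\<lambda>x. U x $ i) \<in> borel_measurable M" "\<And>i. (\<lambda>x. G x $ i) \<in> borel_measurable M"
  shows "(\<lambda>x. U x \<bullet> G x) \<in> borel_measurable M"
  unfolding inner_vec_def inner_real_def using assms by measurable

lemma integrable_drift_term:
  fixes U G :: "real ^ 'n \<Rightarrow> real ^ 'n"
  assumes uU: "integrable M (\<lambda>x. u x * norm (U x))" and u: "u \<in> borel_measurable M"
    and U: "\<And>i. (\<lambda>x. U x $ i) \<in> borel_measurable M" and G: "\<And>i. (\<lambda>x. G x $ i) \<in> borel_measurable M"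
    and B: "\<And>x. norm (G x) \<le> B"
  shows "integrable M (\<lambda>x. u x * (U x \<bullet> G x))"
proof (rule Bochner_Integration.integrable_bound)
  show "integrable M (\<lambda>x. B * (u x * norm (U x)))" using uU by simp
  show "(\<lambda>x. u x * (U x \<bullet> G x)) \<in> borel_measurable M"
    by (intro borel_measurable_times u measurable_inner_components U G)
  show "AE x in M. norm (u x * (U x \<bullet> G x)) \<le> norm (B * (u x * norm (U x)))"
  proof (intro always_eventually allI)
    fix x
    have "\<bar>U x \<bullet> G x\<bar> \<le> norm (U x) * B"
      by (rule order_trans[OF Cauchy_Schwarz_ineq2]) (intro mult_left_mono B norm_ge_zero)
    moreover have "B \<ge> 0" using order_trans[OF norm_ge_zero B] .
    ultimately have "\<bar>u x\<bar> * \<bar>U x \<bullet> G x\<bar> \<le> \<bar>u x\<bar> * (norm (U x) * B)" by (intro mult_left_mono) auto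
    then show "norm (u x * (U x \<bullet> G x)) \<le> norm (B * (u x * norm (U x)))"
      using \<open>B \<ge> 0\<close> by (simp add: abs_mult mult_ac)
  qed
qed

text \<open>Interior regularity of a solution.  The measures \<open>\<nu>\<close> are \<open>|u| V dx\<close> and the two variations of \<open>f\<close>; the functions
\<open>u'\<close>, \<open>w\<close> and \<open>h\<close> are Borel versions of \<open>u\<close>, \<open>|U|\<close> and \<open>u V\<close>.  The equation becomes the hypothesis of
\<open>newton_test_inequality\<close>, whose conclusion is the hypothesis of \<open>riesz_bootstrap\<close>; finitely many balls cover \<open>K\<close>.\<close>

lemma drift_square_integrable:
  fixes \<Omega> :: "(real ^ 'n) set" and U :: "real ^ 'n \<Rightarrow> real ^ 'n"
  assumes n: "CARD('n) \<ge> 2" and \<Omega>: "open \<Omega>" "bounded \<Omega>" and p: "p > real CARD('n)"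
    and U: "\<And>i. (\<lambda>x. U x $ i) \<in> lorentz_space \<Omega> p"
    and f: "bounded_radon_measure \<Omega> f" and V: "V \<in> borel_measurable (lebesgue_on \<Omega>)"
    and uV: "u \<in> L1_weighted \<Omega> V" and u: "integrable (lebesgue_on \<Omega>) u" and eq: "solves_eq \<Omega> U V f u"
    and K: "compact K" "K \<subseteq> \<Omega>"
  shows "(\<integral>\<^sup>+x\<in>K. ennreal (\<bar>u x\<bar> * (norm (U x))\<^sup>2) \<partial>lebesgue_on \<Omega>) < \<infinity>"
proof -
  define M where "M = restrict_space borel \<Omega>"
  define L where "L = lebesgue_on \<Omega>"
  have \<Omega>B [measurable]: "\<Omega> \<in> sets borel" using \<Omega> by simp
  have Um: "(\<lambda>x. U x $ i) \<in> borel_measurable L" for i using U by (simp add: lorentz_space_def L_def)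
  have Vm: "V \<in> borel_measurable L" using V by (simp add: L_def)
  have um: "u \<in> borel_measurable L" using u by (simp add: L_def)
  have normUm: "(\<lambda>x. norm (U x)) \<in> borel_measurable L" by (rule measurable_norm_components) (rule Um)
  have uU: "integrable L (\<lambda>x. u x * norm (U x))" using eq by (simp add: solves_eq_def L_def)
  have uVi: "integrable L (\<lambda>x. u x * enn2real (V x))" using integrable_potential_term[OF uV V] by (simp add: L_def)
  have rep: "\<exists>g'\<in>borel_measurable borel. (AE x in L. g x = g' x) \<and> (\<forall>x. x \<notin> \<Omega> \<longrightarrow> g' x = 0)"
    if "g \<in> borel_measurable L" for g :: "real ^ 'n \<Rightarrow> real"
    using borel_representative[OF \<Omega>B] that unfolding L_def by blast
  obtain u' where u'm [measurable]: "u' \<in> borel_measurable borel" and u': "AE x in L. u x = u' x" "\<And>x. x \<notin> \<Omega> \<Longrightarrow> u' x = 0"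
    using rep[OF um] by blast
  obtain w' where w'm [measurable]: "w' \<in> borel_measurable borel" and w': "AE x in L. norm (U x) = w' x" "\<And>x. x \<notin> \<Omega> \<Longrightarrow> w' x = 0"
    using rep[OF normUm] by blast
  obtain h where hm [measurable]: "h \<in> borel_measurable borel" and h: "AE x in L. u x * enn2real (V x) = h x" "\<And>x. x \<notin> \<Omega> \<Longrightarrow> h x = 0"
    using rep[OF borel_measurable_integrable[OF uVi]] by blast
  define w where "w x = \<bar>w' x\<bar>" for x
  have [measurable]: "w \<in> borel_measurable borel" unfolding w_def[abs_def] by measurable
  have w: "AE x in L. norm (U x) = w x" using w'(1) by (elim eventually_mono) (simp add: w_def, metis abs_norm_cancel)
  define \<nu> where "\<nu> i = (if i = (0::nat) then density lborel (\<lambda>x. ennreal \<bar>h x\<bar>)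
     else distr (upper_measure M (if i = 1 then f else (\<lambda>B. - f B))) borel (\<lambda>x. x))" for i
  note fin = finite_upper_measure[OF f, folded M_def]
  have idm: "(\<lambda>x. x) \<in> measurable (upper_measure M g) borel" for g
    unfolding M_def by (rule measurable_ident_upper_measure)
  have nnL: "(\<integral>\<^sup>+x. k x \<partial>L) = (\<integral>\<^sup>+x\<in>\<Omega>. k x \<partial>lborel)" if "k \<in> borel_measurable borel" for k
    unfolding L_def by (rule nn_integral_lebesgue_on[OF \<Omega>B that])
  have \<nu>: "finite_measure (\<nu> i)" "sets (\<nu> i) = sets borel" for i
  proof -
    have "integrable L h" using uVi h(1) integrable_cong_AE[of "\<lambda>x. u x * enn2real (V x)" L h]
      borel_imp_lebesgue_on[OF hm] by (simp add: L_def)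
    then have "integrable lborel h" using integral_lebesgue_on(2)[OF \<Omega>B hm h(2)] by (simp add: L_def)
    then have "(\<integral>\<^sup>+x. ennreal \<bar>h x\<bar> \<partial>lborel) < \<infinity>" by (simp add: integrable_iff_bounded)
    then have "finite_measure (density lborel (\<lambda>x. ennreal \<bar>h x\<bar>))"
      by (intro finite_measureI) (auto simp: emeasure_density)
    moreover have "finite_measure (distr (upper_measure M f) borel (\<lambda>x. x))"
       "finite_measure (distr (lower_measure M f) borel (\<lambda>x. x))"
      using finite_measure.finite_measure_distr[OF fin(1) idm] finite_measure.finite_measure_distr[OF fin(2) idm] by auto
    ultimately show "finite_measure (\<nu> i)" by (auto simp: \<nu>_def)
    show "sets (\<nu> i) = sets borel" by (simp add: \<nu>_def)
  qed
  have test: "ennreal \<bar>LINT x|lborel. u' x * laplacian \<Phi> x\<bar>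
       \<le> (\<integral>\<^sup>+x\<in>\<Omega>. ennreal (\<bar>u' x\<bar> * w x * norm (grad \<Phi> x)) \<partial>lborel) + (\<Sum>i\<in>{0,1,2}. \<integral>\<^sup>+y\<in>\<Omega>. ennreal \<bar>\<Phi> y\<bar> \<partial>\<nu> i)"
    if \<Phi>: "C2_on UNIV \<Phi>" and C: "compact C" "C \<subseteq> \<Omega>" and 0: "\<And>x. x \<notin> C \<Longrightarrow> \<Phi> x = 0" for \<Phi> C
  proof -
    note bounds = C2_compact_support_bounds[OF \<Phi> C(1) 0]
    obtain B where B: "\<And>x. \<bar>\<Phi> x\<bar> \<le> B" "\<And>x. norm (grad \<Phi> x) \<le> B" "\<And>x. \<bar>laplacian \<Phi> x\<bar> \<le> B"
      using bounds(6) by blast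
    have cont: "continuous_on UNIV \<Phi>" "continuous_on UNIV (grad \<Phi>)" "continuous_on UNIV (laplacian \<Phi>)"
      using bounds(1-3) by auto
    have [measurable]: "\<Phi> \<in> borel_measurable borel" "grad \<Phi> \<in> borel_measurable borel" "laplacian \<Phi> \<in> borel_measurable borel"
      using cont by (auto intro: borel_measurable_continuous_onI)
    have \<Phi>L: "\<Phi> \<in> borel_measurable L" "laplacian \<Phi> \<in> borel_measurable L" unfolding L_def by (rule borel_imp_lebesgue_on; simp)+
    have gL: "(\<lambda>x. grad \<Phi> x $ i) \<in> borel_measurable L" for i
      unfolding L_def by (rule borel_imp_lebesgue_on) (use cont(2) in \<open>auto intro!: borel_measurable_continuous_onI continuous_intros\<close>)
    have i1: "integrable L (\<lambda>x. u x * laplacian \<Phi> x)"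
      by (rule integrable_mult_bounded[OF _ \<Phi>L(2) B(3)]) (use u in \<open>simp add: L_def\<close>)
    have i2: "integrable L (\<lambda>x. u x * (U x \<bullet> grad \<Phi> x))"
      by (rule integrable_drift_term[OF uU um Um gL B(2)])
    have i3: "integrable L (\<lambda>x. u x * enn2real (V x) * \<Phi> x)"
      by (rule integrable_mult_bounded[OF uVi \<Phi>L(1) B(1)])
    have \<Phi>M: "\<Phi> \<in> borel_measurable (upper_measure M g)" for g
      using measurable_compose[OF idm[of g], of \<Phi> borel] by simp
    have i4: "integrable (upper_measure M f) \<Phi>" "integrable (lower_measure M f) \<Phi>"
      using B(1) by (auto intro!: finite_measure.integrable_const_bound[OF fin(1), of _ B] finite_measure.integrable_const_bound[OF fin(2), of _ B] \<Phi>M)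
    have "\<Phi> \<in> C2_zero \<Omega>" by (rule C2_zeroI[OF \<Omega>(1) C \<Phi> 0])
    then have "(LINT x|L. u x * (- laplacian \<Phi> x - U x \<bullet> grad \<Phi> x + enn2real (V x) * \<Phi> x)) = signed_integral M f \<Phi>"
      using eq by (simp add: solves_eq_def L_def M_def)
    also have "(\<lambda>x. u x * (- laplacian \<Phi> x - U x \<bullet> grad \<Phi> x + enn2real (V x) * \<Phi> x))
      = (\<lambda>x. u x * enn2real (V x) * \<Phi> x - u x * laplacian \<Phi> x - u x * (U x \<bullet> grad \<Phi> x))"
      by (simp add: fun_eq_iff algebra_simps)
    also have "(LINT x|L. u x * enn2real (V x) * \<Phi> x - u x * laplacian \<Phi> x - u x * (U x \<bullet> grad \<Phi> x))
      = (LINT x|L. u x * enn2real (V x) * \<Phi> x) - (LINT x|L. u x * laplacian \<Phi> x) - (LINT x|L. u x * (U x \<bullet> grad \<Phi> x))"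
      using i1 i2 i3 by simp
    finally have "\<bar>LINT x|L. u x * laplacian \<Phi> x\<bar> \<le> \<bar>LINT x|L. u x * (U x \<bullet> grad \<Phi> x)\<bar> + (\<bar>LINT x|L. u x * enn2real (V x) * \<Phi> x\<bar>
       + (\<bar>LINT x|upper_measure M f. \<Phi> x\<bar> + \<bar>LINT x|lower_measure M f. \<Phi> x\<bar>))"
      unfolding signed_integral_def by linarith
    then have "ennreal \<bar>LINT x|L. u x * laplacian \<Phi> x\<bar> \<le> ennreal (\<bar>LINT x|L. u x * (U x \<bullet> grad \<Phi> x)\<bar> + (\<bar>LINT x|L. u x * enn2real (V x) * \<Phi> x\<bar>
       + (\<bar>LINT x|upper_measure M f. \<Phi> x\<bar> + \<bar>LINT x|lower_measure M f. \<Phi> x\<bar>)))" by (rule ennreal_leI)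
    also have "\<dots> = ennreal \<bar>LINT x|L. u x * (U x \<bullet> grad \<Phi> x)\<bar> + (ennreal \<bar>LINT x|L. u x * enn2real (V x) * \<Phi> x\<bar>
       + (ennreal \<bar>LINT x|upper_measure M f. \<Phi> x\<bar> + ennreal \<bar>LINT x|lower_measure M f. \<Phi> x\<bar>))" by simp
    also have "\<dots> \<le> (\<integral>\<^sup>+x. ennreal \<bar>u x * (U x \<bullet> grad \<Phi> x)\<bar> \<partial>L) + ((\<integral>\<^sup>+x. ennreal \<bar>u x * enn2real (V x) * \<Phi> x\<bar> \<partial>L)
       + ((\<integral>\<^sup>+x. ennreal \<bar>\<Phi> x\<bar> \<partial>upper_measure M f) + (\<integral>\<^sup>+x. ennreal \<bar>\<Phi> x\<bar> \<partial>lower_measure M f)))"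
      using integral_norm_bound_ennreal[OF i2] integral_norm_bound_ennreal[OF i3]
        integral_norm_bound_ennreal[OF i4(1)] integral_norm_bound_ennreal[OF i4(2)]
      by (intro add_mono) auto
    also have "\<dots> \<le> (\<integral>\<^sup>+x\<in>\<Omega>. ennreal (\<bar>u' x\<bar> * w x * norm (grad \<Phi> x)) \<partial>lborel) + ((\<integral>\<^sup>+y\<in>\<Omega>. ennreal \<bar>\<Phi> y\<bar> \<partial>\<nu> 0)
        + ((\<integral>\<^sup>+y\<in>\<Omega>. ennreal \<bar>\<Phi> y\<bar> \<partial>\<nu> 1) + (\<integral>\<^sup>+y\<in>\<Omega>. ennreal \<bar>\<Phi> y\<bar> \<partial>\<nu> 2)))"
    proof (intro add_mono)
      have "(\<integral>\<^sup>+x. ennreal \<bar>u x * (U x \<bullet> grad \<Phi> x)\<bar> \<partial>L) \<le> (\<integral>\<^sup>+x. ennreal (\<bar>u' x\<bar> * w x * norm (grad \<Phi> x)) \<partial>L)"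
      proof (rule nn_integral_mono_AE)
        show "AE x in L. ennreal \<bar>u x * (U x \<bullet> grad \<Phi> x)\<bar> \<le> ennreal (\<bar>u' x\<bar> * w x * norm (grad \<Phi> x))"
          using u'(1) w
        proof eventually_elim
          case (elim x)
          have "\<bar>u x\<bar> * \<bar>U x \<bullet> grad \<Phi> x\<bar> \<le> \<bar>u x\<bar> * (norm (U x) * norm (grad \<Phi> x))"
            by (intro mult_left_mono Cauchy_Schwarz_ineq2) simp
          then show ?case using elim by (intro ennreal_leI) (simp add: abs_mult mult.assoc)
        qed
      qed
      also have "\<dots> = (\<integral>\<^sup>+x\<in>\<Omega>. ennreal (\<bar>u' x\<bar> * w x * norm (grad \<Phi> x)) \<partial>lborel)"
        by (rule nnL) measurable
      finally show "(\<integral>\<^sup>+x. ennreal \<bar>u x * (U x \<bullet> grad \<Phi> x)\<bar> \<partial>L) \<le> (\<integral>\<^sup>+x\<in>\<Omega>. ennreal (\<bar>u' x\<bar> * w x * norm (grad \<Phi> x)) \<partial>lborel)" .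
      have "(\<integral>\<^sup>+x. ennreal \<bar>u x * enn2real (V x) * \<Phi> x\<bar> \<partial>L) = (\<integral>\<^sup>+x. ennreal \<bar>h x\<bar> * ennreal \<bar>\<Phi> x\<bar> \<partial>L)"
      proof (rule nn_integral_cong_AE)
        show "AE x in L. ennreal \<bar>u x * enn2real (V x) * \<Phi> x\<bar> = ennreal \<bar>h x\<bar> * ennreal \<bar>\<Phi> x\<bar>"
          using h(1) by eventually_elim (simp add: abs_mult[of _ "\<Phi> _"] ennreal_mult)
      qed
      also have "\<dots> = (\<integral>\<^sup>+x. ennreal \<bar>h x\<bar> * ennreal \<bar>\<Phi> x\<bar> * indicator \<Omega> x \<partial>lborel)"
        by (rule nnL) measurable
      also have "\<dots> = (\<integral>\<^sup>+y\<in>\<Omega>. ennreal \<bar>\<Phi> y\<bar> \<partial>\<nu> 0)"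
        unfolding \<nu>_def by (simp add: nn_integral_density mult.assoc)
      finally show "(\<integral>\<^sup>+x. ennreal \<bar>u x * enn2real (V x) * \<Phi> x\<bar> \<partial>L) \<le> (\<integral>\<^sup>+y\<in>\<Omega>. ennreal \<bar>\<Phi> y\<bar> \<partial>\<nu> 0)" by simp
      have up: "(\<integral>\<^sup>+x. ennreal \<bar>\<Phi> x\<bar> \<partial>upper_measure M g) = (\<integral>\<^sup>+y\<in>\<Omega>. ennreal \<bar>\<Phi> y\<bar> \<partial>distr (upper_measure M g) borel (\<lambda>x. x))" for g
      proof -
        have "(\<integral>\<^sup>+y\<in>\<Omega>. ennreal \<bar>\<Phi> y\<bar> \<partial>distr (upper_measure M g) borel (\<lambda>x. x)) = (\<integral>\<^sup>+y\<in>\<Omega>. ennreal \<bar>\<Phi> y\<bar> \<partial>upper_measure M g)"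
          by (rule nn_integral_distr[OF idm]) measurable
        also have "\<dots> = (\<integral>\<^sup>+x. ennreal \<bar>\<Phi> x\<bar> \<partial>upper_measure M g)"
        proof (rule nn_integral_cong)
          fix x assume "x \<in> space (upper_measure M g)"
          then have "x \<in> space M" by (simp only: space_upper_measure)
          then show "ennreal \<bar>\<Phi> x\<bar> * indicator \<Omega> x = ennreal \<bar>\<Phi> x\<bar>"
            by (simp add: M_def space_restrict_space)
        qed
        finally show ?thesis by simp
      qed
      show "(\<integral>\<^sup>+x. ennreal \<bar>\<Phi> x\<bar> \<partial>upper_measure M f) \<le> (\<integral>\<^sup>+y\<in>\<Omega>. ennreal \<bar>\<Phi> y\<bar> \<partial>\<nu> 1)"
        unfolding up \<nu>_def by simp
      show "(\<integral>\<^sup>+x. ennreal \<bar>\<Phi> x\<bar> \<partial>lower_measure M f) \<le> (\<integral>\<^sup>+y\<in>\<Omega>. ennreal \<bar>\<Phi> y\<bar> \<partial>\<nu> 2)"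
        unfolding up \<nu>_def by simp
    qed
    also have "\<dots> = (\<integral>\<^sup>+x\<in>\<Omega>. ennreal (\<bar>u' x\<bar> * w x * norm (grad \<Phi> x)) \<partial>lborel) + (\<Sum>i\<in>{0,1,2}. \<integral>\<^sup>+y\<in>\<Omega>. ennreal \<bar>\<Phi> y\<bar> \<partial>\<nu> i)"
      by simp
    also have "(LINT x|L. u x * laplacian \<Phi> x) = (LINT x|lborel. u' x * laplacian \<Phi> x)"
    proof -
      have "(LINT x|L. u x * laplacian \<Phi> x) = (LINT x|L. u' x * laplacian \<Phi> x)"
      proof (rule integral_cong_AE)
        show "(\<lambda>x. u' x * laplacian \<Phi> x) \<in> borel_measurable L" unfolding L_def by (rule borel_imp_lebesgue_on) measurable
        show "AE x in L. u x * laplacian \<Phi> x = u' x * laplacian \<Phi> x" using u'(1) by eventually_elim simp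
      qed (use i1 in auto)
      also have "\<dots> = (LINT x|lborel. u' x * laplacian \<Phi> x)"
        unfolding L_def by (rule integral_lebesgue_on(1)) (use u'(2) in auto)
      finally show ?thesis .
    qed
    finally show ?thesis .
  qed
  have u'i: "integrable lborel u'"
  proof -
    have "integrable L u'" using u u'(1) integrable_cong_AE[of u L u'] um borel_imp_lebesgue_on[OF u'm] by (simp add: L_def)
    then show ?thesis using integral_lebesgue_on(2)[OF \<Omega>B u'm u'(2)] by (simp add: L_def)
  qed
  \<comment> \<open>any exponent strictly between the dimension and \<open>p\<close>\<close>
  define q where "q = (p + real CARD('n)) / 2"
  have q: "q > real CARD('n)" "q < p" using p by (auto simp: q_def)
  have loc: "(\<integral>\<^sup>+x\<in>cball a r. ennreal (\<bar>u' x\<bar> * (w x + 1)\<^sup>2) \<partial>lborel) < \<infinity>" if ball: "cball a r \<subseteq> \<Omega>" for a r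
  proof (rule riesz_bootstrap[where \<nu> = \<nu> and I = "{0,1,2}" and q = q and \<Omega> = \<Omega>])
    show "real CARD('n) \<ge> 2" using n by simp
    show "(\<integral>\<^sup>+x\<in>\<Omega>. ennreal (\<bar>u' x\<bar> * (w x + 1)) \<partial>lborel) < \<infinity>"
    proof -
      have "(\<integral>\<^sup>+x\<in>\<Omega>. ennreal (\<bar>u' x\<bar> * (w x + 1)) \<partial>lborel) = (\<integral>\<^sup>+x. ennreal (\<bar>u' x\<bar> * (w x + 1)) \<partial>L)"
        by (rule nnL[symmetric]) measurable
      also have "\<dots> = (\<integral>\<^sup>+x. ennreal (norm (u x * norm (U x))) + ennreal (norm (u x)) \<partial>L)"
      proof (rule nn_integral_cong_AE)
        show "AE x in L. ennreal (\<bar>u' x\<bar> * (w x + 1)) = ennreal (norm (u x * norm (U x))) + ennreal (norm (u x))"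
          using u'(1) w by eventually_elim (simp add: abs_mult distrib_left w_def ennreal_plus[symmetric] del: ennreal_plus)
      qed
      also have "\<dots> = (\<integral>\<^sup>+x. ennreal (norm (u x * norm (U x))) \<partial>L) + (\<integral>\<^sup>+x. ennreal (norm (u x)) \<partial>L)"
        using um uU by (intro nn_integral_add) auto
      also have "\<dots> < \<infinity>" using uU u by (simp add: integrable_iff_bounded L_def)
      finally show ?thesis .
    qed
    show "(\<integral>\<^sup>+x\<in>\<Omega>. ennreal ((w x + 1) powr q) \<partial>lborel) < \<infinity>"
    proof -
      have "(\<integral>\<^sup>+x\<in>\<Omega>. ennreal ((w x + 1) powr q) \<partial>lborel) = (\<integral>\<^sup>+x. ennreal ((w x + 1) powr q) \<partial>L)"
        by (rule nnL[symmetric]) measurable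
      also have "\<dots> = (\<integral>\<^sup>+x. ennreal ((norm (U x) + 1) powr q) \<partial>L)"
      proof (rule nn_integral_cong_AE)
        show "AE x in L. ennreal ((w x + 1) powr q) = ennreal ((norm (U x) + 1) powr q)"
          using w by eventually_elim simp
      qed
      also have "\<dots> < \<infinity>" unfolding L_def using n p q by (intro drift_Lq[OF _ _ _ \<Omega> U]) auto
      finally show ?thesis .
    qed
    show "\<exists>r' C. cball a r' \<subseteq> \<Omega> \<and> (AE x in lborel. x \<in> cball a r \<longrightarrow>
         ennreal \<bar>u' x\<bar> \<le> ennreal C * (riesz_pot (cball a r') (real CARD('n) - 1) (\<lambda>y. ennreal (\<bar>u' y\<bar> * (w y + 1))) x
           + (\<Sum>i\<in>{0,1,2}. \<integral>\<^sup>+y\<in>\<Omega>. riesz b x y \<partial>\<nu> i)))"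
      if "real CARD('n) - 2 < b" "b \<le> real CARD('n) - 1" "cball a r \<subseteq> \<Omega>" for b a r
      by (rule newton_test_inequality[OF n \<Omega>(1) u'i _ _ _ \<nu>(1) \<nu>(2) test that]) (auto simp: w_def)
  qed (use \<Omega> \<nu> q ball in \<open>auto simp: w_def\<close>)
  have "\<forall>x\<in>K. \<exists>r. r > 0 \<and> cball x r \<subseteq> \<Omega>"
    using open_contains_cball[of \<Omega>] \<Omega>(1) K(2) by blast
  from bchoice[OF this] obtain r where r: "\<And>x. x \<in> K \<Longrightarrow> r x > 0 \<and> cball x (r x) \<subseteq> \<Omega>" by blast
  obtain D where D: "D \<subseteq> K" "finite D" "K \<subseteq> (\<Union>x\<in>D. ball x (r x))"
  proof (rule compactE_image[OF K(1), of K "\<lambda>x. ball x (r x)"])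
    show "K \<subseteq> (\<Union>x\<in>K. ball x (r x))" using r by force
  qed (simp, blast)
  have KB [measurable]: "K \<in> sets borel" using K(1) by (simp add: borel_closed compact_imp_closed)
  have "(\<integral>\<^sup>+x\<in>K. ennreal (\<bar>u x\<bar> * (norm (U x))\<^sup>2) \<partial>L) = (\<integral>\<^sup>+x\<in>K. ennreal (\<bar>u' x\<bar> * (w x)\<^sup>2) \<partial>L)"
  proof (rule nn_integral_cong_AE)
    show "AE x in L. ennreal (\<bar>u x\<bar> * (norm (U x))\<^sup>2) * indicator K x = ennreal (\<bar>u' x\<bar> * (w x)\<^sup>2) * indicator K x"
      using u'(1) w by eventually_elim simp
  qed
  also have "\<dots> = (\<integral>\<^sup>+x. ennreal (\<bar>u' x\<bar> * (w x)\<^sup>2) * indicator K x * indicator \<Omega> x \<partial>lborel)" by (rule nnL) measurable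
  also have "\<dots> \<le> (\<integral>\<^sup>+x. (\<Sum>a\<in>D. ennreal (\<bar>u' x\<bar> * (w x + 1)\<^sup>2) * indicator (cball a (r a)) x) \<partial>lborel)"
  proof (rule nn_integral_mono)
    fix x
    show "ennreal (\<bar>u' x\<bar> * (w x)\<^sup>2) * indicator K x * indicator \<Omega> x \<le> (\<Sum>a\<in>D. ennreal (\<bar>u' x\<bar> * (w x + 1)\<^sup>2) * indicator (cball a (r a)) x)"
    proof (cases "x \<in> K")
      case True
      then obtain a where a: "a \<in> D" "x \<in> ball a (r a)" using D(3) by blast
      have "(w x)\<^sup>2 \<le> (w x + 1)\<^sup>2" by (intro power_mono) (auto simp: w_def)
      then have "ennreal (\<bar>u' x\<bar> * (w x)\<^sup>2) * indicator K x * indicator \<Omega> x \<le> ennreal (\<bar>u' x\<bar> * (w x + 1)\<^sup>2) * indicator (cball a (r a)) x"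
        using a(2) by (auto simp: indicator_def intro!: ennreal_leI mult_left_mono)
      also have "\<dots> \<le> (\<Sum>a\<in>D. ennreal (\<bar>u' x\<bar> * (w x + 1)\<^sup>2) * indicator (cball a (r a)) x)"
        by (rule member_le_sum[OF a(1)]) (use D(2) in auto)
      finally show ?thesis .
    qed simp
  qed
  also have "\<dots> = (\<Sum>a\<in>D. \<integral>\<^sup>+x\<in>cball a (r a). ennreal (\<bar>u' x\<bar> * (w x + 1)\<^sup>2) \<partial>lborel)"
    by (rule nn_integral_sum) (auto intro!: borel_measurable_times_ennreal borel_measurable_indicator)
  also have "\<dots> < \<infinity>"
  proof -
    have "(\<integral>\<^sup>+x\<in>cball a (r a). ennreal (\<bar>u' x\<bar> * (w x + 1)\<^sup>2) \<partial>lborel) < top" if "a \<in> D" for a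
      using loc[of a "r a"] r[of a] D(1) that by auto
    then show ?thesis using D(2) by simp
  qed
  finally show ?thesis by (simp add: L_def)
qed


section \<open>Test functions and signed measures\<close>

text \<open>By the Lindelof property, countably many of the open null sets outside the support cover its complement.\<close>

lemma complement_of_support_null:
  fixes S :: "(real ^ 'n) set"
  assumes S: "open S" and f: "bounded_radon_measure S f"
  defines "M \<equiv> restrict_space borel S"
  shows "S - support S f \<in> null_sets (upper_measure M f)" "S - support S f \<in> null_sets (lower_measure M f)"
proof -
  note s = finite_upper_measure(3,4)[OF f, folded M_def]
  define F where "F = {W. open W \<and> total_var M f (W \<inter> S) = 0}"
  obtain F' where F': "F' \<subseteq> F" "countable F'" "\<Union>F' = \<Union>F"
    using Lindelof[of F] by (auto simp: F_def)
  have eq: "S - support S f = (\<Union>W\<in>F'. W \<inter> S)"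
  proof -
    have "S - support S f = S \<inter> \<Union>F"
      by (auto simp: support_def F_def M_def[symmetric] not_gr_zero)
    then show ?thesis using F'(3) by auto
  qed
  have null: "W \<inter> S \<in> null_sets (upper_measure M f) \<and> W \<inter> S \<in> null_sets (lower_measure M f)" if "W \<in> F'" for W
  proof -
    have W: "open W" "total_var M f (W \<inter> S) = 0" using that F'(1) by (auto simp: F_def)
    have WM: "W \<inter> S \<in> sets M"
      unfolding M_def using W(1) S by (subst sets_restrict_space_iff) (auto intro: borel_open)
    have "upper_var M f (W \<inter> S) = 0" "upper_var M (\<lambda>B. - f B) (W \<inter> S) = 0"
      using W(2) by (simp_all add: total_var_def)
    then have "emeasure (upper_measure M f) (W \<inter> S) = 0" "emeasure (lower_measure M f) (W \<inter> S) = 0"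
      by (simp_all only: emeasure_upper_measure[OF s(1) WM] emeasure_upper_measure[OF s(2) WM])
    then show ?thesis unfolding null_sets_def using WM by (simp only: mem_Collect_eq sets_upper_measure simp_thms)
  qed
  show "S - support S f \<in> null_sets (upper_measure M f)" "S - support S f \<in> null_sets (lower_measure M f)"
    unfolding eq by (rule null_sets_UN'[OF F'(2)], use null in blast)+
qed

lemma open_countable_Union_balls:
  fixes T :: "(real ^ 'n) set"
  assumes "open T" "T \<noteq> {}"
  shows "\<exists>a r. (\<forall>i :: nat. r i > 0 \<and> cball (a i) (r i) \<subseteq> T) \<and> T = (\<Union>i. ball (a i) (r i))"
proof -
  define F where "F = {ball a r | a r. r > 0 \<and> cball a r \<subseteq> T}"
  obtain F' where F': "F' \<subseteq> F" "countable F'" "\<Union>F' = \<Union>F"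
    using Lindelof[of F] by (auto simp: F_def)
  have UF: "\<Union>F = T"
  proof
    show "\<Union>F \<subseteq> T" by (auto simp: F_def)
    show "T \<subseteq> \<Union>F"
    proof
      fix x assume "x \<in> T"
      then obtain e where "e > 0" "cball x e \<subseteq> T" using assms(1) open_contains_cball by blast
      then have "ball x e \<in> F" "x \<in> ball x e" by (auto simp: F_def)
      then show "x \<in> \<Union>F" by blast
    qed
  qed
  then have ne: "F' \<noteq> {}" using F' assms(2) by auto
  have "\<forall>i. \<exists>p. from_nat_into F' i = ball (fst p) (snd p) \<and> snd p > 0 \<and> cball (fst p) (snd p) \<subseteq> T"
  proof
    fix i
    have "from_nat_into F' i \<in> F" using from_nat_into[OF ne] F'(1) by blast
    then obtain a r where "from_nat_into F' i = ball a r" "r > 0" "cball a r \<subseteq> T" by (auto simp: F_def)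
    then show "\<exists>p. from_nat_into F' i = ball (fst p) (snd p) \<and> snd p > 0 \<and> cball (fst p) (snd p) \<subseteq> T"
      by (intro exI[of _ "(a, r)"]) auto
  qed
  from choice[OF this] obtain p where p: "\<And>i. from_nat_into F' i = ball (fst (p i)) (snd (p i))" "\<And>i. snd (p i) > 0"
    "\<And>i. cball (fst (p i)) (snd (p i)) \<subseteq> T" by blast
  have "(\<Union>i. ball (fst (p i)) (snd (p i))) = \<Union>F'"
    using range_from_nat_into[OF ne F'(2)] by (simp add: p(1)[symmetric])
  then have U: "T = (\<Union>i. ball (fst (p i)) (snd (p i)))" using F'(3) UF by simp
  show ?thesis
    by (rule exI[of _ "\<lambda>i. fst (p i)"], rule exI[of _ "\<lambda>i. snd (p i)"]) (use p(2,3) U in blast)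
qed

text \<open>Exhaust the open set by countably many balls and take \<open>\<phi> m = 1 - exp (- q m)\<close>, where \<open>q m\<close> is \<open>m\<close> times the sum of
the first \<open>m\<close> bump functions: \<open>q m\<close> tends to infinity on the set and is \<open>0\<close> outside.\<close>

lemma open_indicator_limit_of_test_functions:
  fixes T :: "(real ^ 'n) set"
  assumes T: "open T"
  obtains \<phi> :: "nat \<Rightarrow> real ^ 'n \<Rightarrow> real" and K where
    "\<And>m. C2_on UNIV (\<phi> m)" "\<And>m. compact (K m)" "\<And>m. K m \<subseteq> T" "\<And>m x. x \<notin> K m \<Longrightarrow> \<phi> m x = 0"
    "\<And>m x. 0 \<le> \<phi> m x \<and> \<phi> m x \<le> 1" "\<And>x. (\<lambda>m. \<phi> m x) \<longlonglongrightarrow> indicat_real T x"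
proof (cases "T = {}")
  case True
  show ?thesis
  proof (rule that[of "\<lambda>m x. 0" "\<lambda>m. {}"])
    show "C2_on UNIV (\<lambda>x :: real ^ 'n. 0)" by (rule C2_on_const)
  qed (simp_all add: True)
next
  case False
  obtain a r where ar: "(\<forall>i :: nat. r i > 0 \<and> cball (a i) (r i) \<subseteq> T) \<and> T = (\<Union>i. ball (a i) (r i))"
    using open_countable_Union_balls[OF T False] by (elim exE)
  have r: "r i > 0" "cball (a i) (r i) \<subseteq> T" for i using ar by blast+
  have TU: "T = (\<Union>i. ball (a i) (r i))" using ar by simp
  define q where "q m x = real m * (\<Sum>i<m. bump (a i) (r i) x)" for m x
  have q0: "q m x \<ge> 0" for m x by (auto simp: q_def intro!: mult_nonneg_nonneg sum_nonneg bump_nonneg)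
  show ?thesis
  proof (rule that[of "\<lambda>m x. 1 - exp (- q m x)" "\<lambda>m. \<Union>i<m. cball (a i) (r i)"])
    show "C2_on UNIV (\<lambda>x. 1 - exp (- q m x))" for m
    proof (rule C2_on_compose[where F = "\<lambda>t. 1 - exp (- t)" and F' = "\<lambda>t. exp (- t)" and F'' = "\<lambda>t. - exp (- t)" and f = "q m"])
      show qC2: "C2_on UNIV (q m)"
        unfolding q_def[abs_def] by (rule C2_on_mult[OF open_UNIV C2_on_const C2_on_sum]) (auto intro: C2_on_bump)
      have "continuous_on UNIV (q m)" by (rule C1_on_continuous) (use qC2 in \<open>simp add: C2_on_def\<close>)
      then show "continuous_on UNIV (\<lambda>x. - exp (- q m x))" by (intro continuous_intros)
      show "((\<lambda>t. 1 - exp (- t)) has_real_derivative exp (- q m x)) (at (q m x))" for x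
        by (auto intro!: derivative_eq_intros)
      show "((\<lambda>t. exp (- t)) has_real_derivative - exp (- q m x)) (at (q m x))" for x
        by (auto intro!: derivative_eq_intros)
    qed simp
    show "compact (\<Union>i<m. cball (a i) (r i))" for m by (intro compact_UN) auto
    show "(\<Union>i<m. cball (a i) (r i)) \<subseteq> T" for m using r(2) by blast
    show "1 - exp (- q m x) = 0" if "x \<notin> (\<Union>i<m. cball (a i) (r i))" for m x
    proof -
      have "bump (a i) (r i) x = 0" if "i < m" for i
        using that \<open>x \<notin> (\<Union>i<m. cball (a i) (r i))\<close> less_imp_le[OF r(1)] by (intro bump_eq_0) auto
      then show ?thesis by (simp add: q_def)
    qed
    show "0 \<le> 1 - exp (- q m x) \<and> 1 - exp (- q m x) \<le> 1" for m x using q0[of m x] by simp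
    show "(\<lambda>m. 1 - exp (- q m x)) \<longlonglongrightarrow> indicat_real T x" for x
    proof (cases "x \<in> T")
      case True
      then obtain j where "x \<in> ball (a j) (r j)" using TU by blast
      then have bj: "bump (a j) (r j) x > 0" using bump_pos_iff[of "r j" "a j" x] r(1)[of j] by simp
      have "filterlim (\<lambda>m. bump (a j) (r j) x * real m) at_top sequentially"
        by (rule filterlim_tendsto_pos_mult_at_top[OF tendsto_const bj filterlim_real_sequentially])
      then have "filterlim (\<lambda>m. q m x) at_top sequentially"
      proof (rule filterlim_at_top_mono)
        show "eventually (\<lambda>m. bump (a j) (r j) x * real m \<le> q m x) sequentially"
          using eventually_gt_at_top[of j]
        proof eventually_elim
          case (elim m)
          have "bump (a j) (r j) x \<le> (\<Sum>i<m. bump (a i) (r i) x)"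
            by (rule member_le_sum) (use elim in \<open>auto intro: bump_nonneg\<close>)
          then show ?case unfolding q_def by (subst mult.commute) (intro mult_left_mono, auto)
        qed
      qed
      then have "filterlim (\<lambda>m. - q m x) at_bot sequentially" by (simp add: filterlim_uminus_at_bot)
      then have "(\<lambda>m. exp (- q m x)) \<longlonglongrightarrow> 0" by (rule filterlim_compose[OF exp_at_bot])
      then have "(\<lambda>m. 1 - exp (- q m x)) \<longlonglongrightarrow> 1 - 0" by (intro tendsto_intros)
      then show ?thesis using True by simp
    next
      case False
      then have "bump (a i) (r i) x = 0" for i
        using bump_pos_iff[of "r i" "a i" x] bump_nonneg[of "a i" "r i" x] r(1)[of i] TU by (auto simp: less_le)
      then show ?thesis using False by (simp add: q_def)
    qed
  qed
qed

text \<open>Test functions converging to indicators show that the two variations of \<open>f\<close> agree on the open subsets of \<open>T\<close>,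
hence on all Borel subsets, and \<open>f\<close> is their difference.\<close>

lemma test_functions_separate_signed_measure:
  fixes S T :: "(real ^ 'n) set"
  assumes S: "open S" and f: "bounded_radon_measure S f" and T: "open T" "T \<subseteq> S"
    and 0: "\<And>\<phi> K. C2_on UNIV \<phi> \<Longrightarrow> compact K \<Longrightarrow> K \<subseteq> T \<Longrightarrow> (\<And>x. x \<notin> K \<Longrightarrow> \<phi> x = 0) \<Longrightarrow>
      signed_integral (restrict_space borel S) f \<phi> = 0"
    and B: "B \<in> sets (restrict_space borel S)" "B \<subseteq> T"
  shows "f B = 0"
proof -
  define M where "M = restrict_space borel S"
  note fin = finite_upper_measure[OF f, folded M_def]
  have SB [measurable]: "S \<in> sets borel" "T \<in> sets borel" using S T by auto
  have idm: "(\<lambda>x. x) \<in> measurable (upper_measure M g) borel" for g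
    unfolding M_def by (rule measurable_ident_upper_measure)
  have setsM: "A \<in> sets M \<longleftrightarrow> A \<in> sets borel \<and> A \<subseteq> S" for A
    unfolding M_def by (subst sets_restrict_space_iff) auto
  have open_eq: "measure (upper_measure M f) Q = measure (lower_measure M f) Q" if O: "open Q" "Q \<subseteq> T" for Q
  proof -
    obtain \<phi> K where \<phi>: "\<And>m :: nat. C2_on UNIV (\<phi> m)" "\<And>m. compact (K m)" "\<And>m. K m \<subseteq> Q" "\<And>m x. x \<notin> K m \<Longrightarrow> \<phi> m x = 0"
      "\<And>m x. 0 \<le> \<phi> m x \<and> \<phi> m x \<le> 1" "\<And>x. (\<lambda>m. \<phi> m x) \<longlonglongrightarrow> indicat_real Q x"
      using open_indicator_limit_of_test_functions[OF O(1)] by blast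
    have OM: "Q \<in> sets M" using O T by (auto simp: setsM)
    have lim: "(\<lambda>m. LINT x|upper_measure M g. \<phi> m x) \<longlonglongrightarrow> measure (upper_measure M g) Q"
      if g: "finite_measure (upper_measure M g)" for g
    proof -
      have "(\<lambda>m. LINT x|upper_measure M g. \<phi> m x) \<longlonglongrightarrow> (LINT x|upper_measure M g. indicat_real Q x)"
      proof (rule Bochner_Integration.integral_dominated_convergence[where w = "\<lambda>x. 1"])
        show "\<phi> m \<in> borel_measurable (upper_measure M g)" for m
        proof -
          have "\<phi> m \<in> borel_measurable borel"
            using \<phi>(1)[of m] by (intro borel_measurable_continuous_onI) (auto simp: C2_on_def intro: C1_on_continuous)
          from measurable_compose[OF idm this] show ?thesis by simp
        qed
        show "indicat_real Q \<in> borel_measurable (upper_measure M g)"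
          by (rule borel_measurable_indicator) (simp only: sets_upper_measure OM)
        show "integrable (upper_measure M g) (\<lambda>x. 1 :: real)" using g by (rule finite_measure.integrable_const)
        show "AE x in upper_measure M g. norm (\<phi> m x) \<le> 1" for m using \<phi>(5) by (auto intro!: always_eventually)
      qed (use \<phi>(6) in auto)
      moreover have "Q \<subseteq> space (upper_measure M g)" using OM sets.sets_into_space by (simp only: space_upper_measure)
      ultimately show ?thesis by (simp add: Int_absorb2)
    qed
    have "(LINT x|upper_measure M f. \<phi> m x) = (LINT x|lower_measure M f. \<phi> m x)" for m
      using 0[OF \<phi>(1,2) _ \<phi>(4), of m] \<phi>(3)[of m] O(2) by (auto simp: signed_integral_def M_def)
    then show ?thesis using lim[OF fin(1)] lim[OF fin(2)] by (simp add: LIMSEQ_unique)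
  qed
  \<comment> \<open>the variations restricted to \<open>T\<close>, as measures on the whole space, where the open sets generate\<close>
  define N where "N g = density (distr (upper_measure M g) borel (\<lambda>x. x)) (indicator T)" for g
  have N: "emeasure (N g) A = emeasure (upper_measure M g) (A \<inter> T)" if A: "A \<in> sets borel" for g A
  proof -
    have "emeasure (N g) A = (\<integral>\<^sup>+x. indicator T x * indicator A x \<partial>distr (upper_measure M g) borel (\<lambda>x. x))"
      unfolding N_def by (rule emeasure_density) (use A in auto)
    also have "\<dots> = (\<integral>\<^sup>+x. indicator (A \<inter> T) x \<partial>distr (upper_measure M g) borel (\<lambda>x. x))"
      by (intro nn_integral_cong) (simp split: split_indicator)
    also have "\<dots> = emeasure (distr (upper_measure M g) borel (\<lambda>x. x)) (A \<inter> T)"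
      by (rule nn_integral_indicator) (use A in auto)
    also have "\<dots> = emeasure (upper_measure M g) ((\<lambda>x. x) -` (A \<inter> T) \<inter> space (upper_measure M g))"
      by (rule emeasure_distr[OF idm]) (use A in auto)
    also have "(\<lambda>x. x) -` (A \<inter> T) \<inter> space (upper_measure M g) = A \<inter> T"
      unfolding space_upper_measure using T(2) by (auto simp: M_def space_restrict_space)
    finally show ?thesis .
  qed
  have "N f = N (\<lambda>B. - f B)"
  proof (rule measure_eqI_generator_eq[where E = "{Q. open Q}" and \<Omega> = UNIV and A = "\<lambda>i. UNIV"])
    show "Int_stable {Q :: (real ^ 'n) set. open Q}" by (auto simp: Int_stable_def)
    show "emeasure (N f) Q = emeasure (N (\<lambda>B. - f B)) Q" if "Q \<in> {Q. open Q}" for Q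
      using that open_eq[of "Q \<inter> T"] T open_Int[of Q T]
      by (simp add: N finite_measure.emeasure_eq_measure[OF fin(1)] finite_measure.emeasure_eq_measure[OF fin(2)])
    show "sets (N f) = sigma_sets UNIV {Q. open Q}" "sets (N (\<lambda>B. - f B)) = sigma_sets UNIV {Q. open Q}"
      by (simp_all add: N_def borel_def)
    show "emeasure (N f) UNIV \<noteq> \<infinity>" for i :: nat
      using finite_measure.emeasure_finite[OF fin(1)] by (simp add: N)
  qed auto
  then have "emeasure (upper_measure M f) (B \<inter> T) = emeasure (lower_measure M f) (B \<inter> T)"
    using N[of B] B(1) by (metis M_def setsM)
  then have "upper_var M f B = upper_var M (\<lambda>B. - f B) B"
    using B emeasure_upper_measure[OF fin(3), of B] emeasure_upper_measure[OF fin(4), of B]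
    by (simp add: M_def Int_absorb2)
  moreover have "upper_var M f B < \<infinity>" "upper_var M (\<lambda>B. - f B) B < \<infinity>"
    using finite_measure.emeasure_finite[OF fin(1), of B] finite_measure.emeasure_finite[OF fin(2), of B]
      B(1) emeasure_upper_measure[OF fin(3), of B] emeasure_upper_measure[OF fin(4), of B]
    by (simp_all add: M_def less_top[symmetric])
  ultimately show ?thesis using jordan_decomposition[OF fin(3), of B] B(1) by (simp add: M_def)
qed


section \<open>Cut-offs of small norm\<close>

lemma ennreal_quotient_le:
  assumes "ennreal g / ennreal v \<le> ennreal e" "g \<ge> 0" "v \<ge> 0" "e \<ge> 0"
  shows "g \<le> e * v"
proof (cases "v = 0")
  case True
  show ?thesis
  proof (rule ccontr)
    assume "\<not> g \<le> e * v"
    then have "g > 0" using True by simp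
    then have "ennreal g / ennreal v = \<infinity>" using True by (simp add: divide_ennreal_def ennreal_mult_top)
    then show False using assms(1) by (simp add: top_unique)
  qed
next
  case False
  then have "v > 0" using assms by simp
  then have "ennreal (g / v) \<le> ennreal e" using assms by (simp add: divide_ennreal)
  then have "g / v \<le> e" using assms by (simp add: ennreal_le_iff)
  then show ?thesis using \<open>v > 0\<close> by (simp add: divide_le_eq)
qed

text \<open>On the set where \<open>V\<close> is finite, a quotient that is essentially bounded forces its numerator to vanish where \<open>V = 0\<close>,
so that the product form of the bound holds there too.\<close>

lemma V_norm_small:
  assumes "V_norm S V \<psi> < ennreal e" "e \<ge> 0"
  shows "(\<integral>\<^sup>+x. ennreal \<bar>\<psi> x\<bar> \<partial>lebesgue_on S) \<le> ennreal e"
    and "AE x in lebesgue_on S. V x < \<infinity> \<longrightarrow>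
      norm (grad \<psi> x) \<le> e * sqrt (enn2real (V x)) \<and> \<bar>laplacian \<psi> x\<bar> \<le> e * enn2real (V x)"
proof -
  define a where "a = (\<integral>\<^sup>+x. ennreal \<bar>\<psi> x\<bar> \<partial>lebesgue_on S)"
  define b where "b = esssup (lebesgue_on S) (\<lambda>x. ennreal (norm (grad \<psi> x)) / ennsqrt (V x))"
  define c where "c = esssup (lebesgue_on S) (\<lambda>x. ennreal \<bar>laplacian \<psi> x\<bar> / V x)"
  have "a + b + c \<le> ennreal e"
    using assms(1) unfolding V_norm_def a_def b_def c_def by simp
  then have abc: "a \<le> ennreal e" "b \<le> ennreal e" "c \<le> ennreal e"
    using add_increasing2[of "b + c" a a] add_increasing[of a b b] le_add2 
    by (meson add_increasing add_increasing2 order_refl order_trans zero_le)+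
  show "(\<integral>\<^sup>+x. ennreal \<bar>\<psi> x\<bar> \<partial>lebesgue_on S) \<le> ennreal e" using abc(1) by (simp add: a_def)
  have "AE x in lebesgue_on S. ennreal (norm (grad \<psi> x)) / ennsqrt (V x) \<le> b" unfolding b_def by (rule esssup_AE)
  moreover have "AE x in lebesgue_on S. ennreal \<bar>laplacian \<psi> x\<bar> / V x \<le> c" unfolding c_def by (rule esssup_AE)
  ultimately show "AE x in lebesgue_on S. V x < \<infinity> \<longrightarrow>
      norm (grad \<psi> x) \<le> e * sqrt (enn2real (V x)) \<and> \<bar>laplacian \<psi> x\<bar> \<le> e * enn2real (V x)"
  proof eventually_elim
    case (elim x)
    show ?case
    proof (intro impI conjI)
      assume fin: "V x < \<infinity>"
      then have V: "V x = ennreal (enn2real (V x))" by simp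
      have sq: "ennsqrt (V x) = ennreal (sqrt (enn2real (V x)))" using fin by (auto simp: ennsqrt_def)
      show "norm (grad \<psi> x) \<le> e * sqrt (enn2real (V x))"
        by (rule ennreal_quotient_le) (use elim(1) abc(2) assms(2) sq in \<open>auto intro: order_trans\<close>)
      have "ennreal \<bar>laplacian \<psi> x\<bar> / ennreal (enn2real (V x)) \<le> ennreal e"
        using elim(2) abc(3) V by (metis order_trans)
      then show "\<bar>laplacian \<psi> x\<bar> \<le> e * enn2real (V x)"
        by (rule ennreal_quotient_le) (use assms(2) in auto)
    qed
  qed
qed

text \<open>The integrand of the equation at one point, for the test function \<open>\<psi> \<phi>\<close>, divided by \<open>u\<close>.  Here \<open>t\<close>, \<open>gp\<close>, \<open>lp\<close> are
the value, gradient and Laplacian of \<open>\<psi>\<close>, and \<open>gq\<close>, \<open>lq\<close> the gradient and Laplacian of \<open>\<phi>\<close>.  The inequalities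
\<open>\<surd>v \<le> 1 + v\<close> and \<open>N \<surd>v \<le> N\<^sup>2 + v\<close> remove the square root of the potential; the second is where the square of the
drift enters.\<close>

lemma cutoff_integrand_bound:
  fixes gp gq Ux :: "real ^ 'n"
  assumes t: "0 \<le> t" "t \<le> 1" and e: "0 \<le> e" and v: "0 \<le> v"
    and B: "\<bar>\<phi>\<bar> \<le> B" "norm gq \<le> B" "\<bar>lq\<bar> \<le> B"
    and gp: "norm gp \<le> e * sqrt v" and lp: "\<bar>lp\<bar> \<le> e * v"
  shows "\<bar>- (t * lq + 2 * (gp \<bullet> gq) + \<phi> * lp) - Ux \<bullet> (t *\<^sub>R gq + \<phi> *\<^sub>R gp) + v * (t * \<phi>)\<bar>
    \<le> (t + e) * (B * (3 + norm Ux + 5 * v + (norm Ux)\<^sup>2))"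
proof -
  define N where "N = norm Ux"
  have N: "N \<ge> 0" "B \<ge> 0" using B(1) by (auto simp: N_def)
  have sv: "sqrt v \<le> 1 + v"
  proof -
    have "sqrt v \<le> sqrt ((1 + v)\<^sup>2)" using v by (intro real_sqrt_le_mono) (simp add: power2_eq_square algebra_simps)
    then show ?thesis using v by simp
  qed
  have Nv: "N * sqrt v \<le> N\<^sup>2 + v"
  proof -
    have "0 \<le> (N - sqrt v)\<^sup>2" by simp
    also have "\<dots> = N\<^sup>2 - 2 * (N * sqrt v) + v" using v by (simp add: power2_diff)
    finally have "2 * (N * sqrt v) \<le> N\<^sup>2 + v" by simp
    moreover have "0 \<le> N * sqrt v" using N v by simp
    ultimately show ?thesis by linarith
  qed
  have h1: "\<bar>t * lq\<bar> \<le> t * B" using t B(3) by (simp add: abs_mult mult_left_mono)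
  have h2: "\<bar>Ux \<bullet> gq\<bar> \<le> N * B"
    unfolding N_def by (rule order_trans[OF Cauchy_Schwarz_ineq2]) (intro mult_left_mono B norm_ge_zero)
  have h3: "\<bar>t * (Ux \<bullet> gq)\<bar> \<le> t * (N * B)" using t h2 by (simp add: abs_mult mult_left_mono)
  have h4: "\<bar>v * (t * \<phi>)\<bar> \<le> t * (v * B)"
    using t v B(1) by (simp add: abs_mult mult.left_commute mult_left_mono)
  have h5: "\<bar>gp \<bullet> gq\<bar> \<le> e * sqrt v * B"
    by (rule order_trans[OF Cauchy_Schwarz_ineq2]) (intro mult_mono gp B; use e v in simp)
  have "e * sqrt v * B \<le> e * (1 + v) * B" using sv e N by (intro mult_right_mono mult_left_mono) auto
  with h5 have h5': "\<bar>gp \<bullet> gq\<bar> \<le> e * (1 + v) * B" by linarith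
  have h6: "\<bar>\<phi> * lp\<bar> \<le> B * (e * v)" unfolding abs_mult by (intro mult_mono B lp) (use N in auto)
  have h7: "\<bar>Ux \<bullet> gp\<bar> \<le> N * (e * sqrt v)"
    unfolding N_def by (rule order_trans[OF Cauchy_Schwarz_ineq2]) (intro mult_left_mono gp norm_ge_zero)
  have "N * (e * sqrt v) \<le> e * (N\<^sup>2 + v)" using mult_left_mono[OF Nv e] by (simp add: mult_ac)
  with h7 have h7': "\<bar>Ux \<bullet> gp\<bar> \<le> e * (N\<^sup>2 + v)" by linarith
  have h8: "\<bar>\<phi> * (Ux \<bullet> gp)\<bar> \<le> B * (e * (N\<^sup>2 + v))" unfolding abs_mult by (intro mult_mono B h7') (use N in auto)
  have "\<bar>- (t * lq + 2 * (gp \<bullet> gq) + \<phi> * lp) - Ux \<bullet> (t *\<^sub>R gq + \<phi> *\<^sub>R gp) + v * (t * \<phi>)\<bar>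
    \<le> \<bar>t * lq\<bar> + 2 * \<bar>gp \<bullet> gq\<bar> + \<bar>\<phi> * lp\<bar> + \<bar>t * (Ux \<bullet> gq)\<bar> + \<bar>\<phi> * (Ux \<bullet> gp)\<bar> + \<bar>v * (t * \<phi>)\<bar>"
    unfolding inner_add_right inner_scaleR_right by linarith
  also have "\<dots> \<le> t * B + 2 * (e * (1 + v) * B) + B * (e * v) + t * (N * B) + B * (e * (N\<^sup>2 + v)) + t * (v * B)"
    using h1 h3 h4 h5' h6 h8 by linarith
  also have "\<dots> = t * (B * (1 + N + v)) + e * (B * (2 + 4 * v + N\<^sup>2))" by (simp add: algebra_simps)
  also have "\<dots> \<le> t * (B * (3 + N + 5 * v + N\<^sup>2)) + e * (B * (3 + N + 5 * v + N\<^sup>2))"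
  proof -
    have Y: "1 + N + v \<le> 3 + N + 5 * v + N\<^sup>2" "2 + 4 * v + N\<^sup>2 \<le> 3 + N + 5 * v + N\<^sup>2"
      using N v zero_le_power2[of N] by linarith+
    show ?thesis
      by (rule add_mono[OF mult_left_mono[OF mult_left_mono[OF Y(1) N(2)] t(1)]
            mult_left_mono[OF mult_left_mono[OF Y(2) N(2)] e]])
  qed
  finally show ?thesis by (simp add: N_def distrib_right)
qed

text \<open>A sequence of cut-offs with norms below \<open>2\<^bsup>- k\<^esup>\<close> tends to \<open>0\<close> in \<open>L\<^sup>1\<close>, hence almost everywhere along a subsequence.  By
\<open>cutoff_integrand_bound\<close> the integrand is at most \<open>\<psi> + \<epsilon>\<close> times one integrable function \<open>D\<close>, so that dominated
convergence applies.\<close>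

lemma capacity_cutoff_limit:
  fixes \<Omega> :: "(real ^ 'n) set" and U :: "real ^ 'n \<Rightarrow> real ^ 'n"
  assumes \<Omega>: "open \<Omega>" and Um: "\<And>i. (\<lambda>x. U x $ i) \<in> borel_measurable (lebesgue_on \<Omega>)"
    and V: "V \<in> borel_measurable (lebesgue_on \<Omega>)"
    and uV: "u \<in> L1_weighted \<Omega> V" and u: "integrable (lebesgue_on \<Omega>) u" and eq: "solves_eq \<Omega> U V f u"
    and cap: "Cap \<Omega> V Z = 0"
    and K: "compact K" "K \<subseteq> \<Omega>" and \<phi>: "C2_on UNIV \<phi>" "\<And>x. x \<notin> K \<Longrightarrow> \<phi> x = 0"
    and loc: "(\<integral>\<^sup>+x\<in>K. ennreal (\<bar>u x\<bar> * (norm (U x))\<^sup>2) \<partial>lebesgue_on \<Omega>) < \<infinity>"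
    and \<epsilon>: "\<epsilon> > 0"
  shows "\<exists>\<psi>\<in>cap_test \<Omega> Z. \<bar>signed_integral (restrict_space borel \<Omega>) f (\<lambda>x. \<psi> x * \<phi> x)\<bar> < \<epsilon>"
proof -
  define L where "L = lebesgue_on \<Omega>"
  have KB: "K \<in> sets L" unfolding L_def using K \<Omega> by (subst sets_restrict_space_iff) (auto simp: borel_closed compact_imp_closed)
  have Um' [measurable]: "(\<lambda>x. U x $ i) \<in> borel_measurable L" for i using Um by (simp add: L_def)
  have [measurable]: "V \<in> borel_measurable L" "u \<in> borel_measurable L" using V u by (auto simp: L_def)
  have [measurable]: "(\<lambda>x. norm (U x)) \<in> borel_measurable L" by (rule measurable_norm_components) (rule Um')
  have uU: "integrable L (\<lambda>x. u x * norm (U x))" using eq by (simp add: solves_eq_def L_def)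
  have uVi: "integrable L (\<lambda>x. u x * enn2real (V x))" using integrable_potential_term[OF uV V] by (simp add: L_def)
  have uU2: "integrable L (\<lambda>x. u x * (norm (U x))\<^sup>2 * indicat_real K x)"
  proof (rule integrableI_bounded)
    show "(\<lambda>x. u x * (norm (U x))\<^sup>2 * indicat_real K x) \<in> borel_measurable L"
      using KB by measurable
    have "(\<integral>\<^sup>+x. ennreal (norm (u x * (norm (U x))\<^sup>2 * indicat_real K x)) \<partial>L) = (\<integral>\<^sup>+x\<in>K. ennreal (\<bar>u x\<bar> * (norm (U x))\<^sup>2) \<partial>lebesgue_on \<Omega>)"
      unfolding L_def by (intro nn_integral_cong) (simp add: abs_mult split: split_indicator)
    then show "(\<integral>\<^sup>+x. ennreal (norm (u x * (norm (U x))\<^sup>2 * indicat_real K x)) \<partial>L) < \<infinity>" using loc by simp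
  qed
  \<comment> \<open>\<open>enn2real\<close> sends infinity to \<open>0\<close>; where this changes \<open>V\<close>, the function \<open>u\<close> vanishes\<close>
  have uinf: "AE x in L. V x = \<infinity> \<longrightarrow> u x = 0"
  proof -
    have "(\<integral>\<^sup>+x. ennreal \<bar>u x\<bar> * V x \<partial>L) \<noteq> \<infinity>" using uV by (auto simp: L1_weighted_def L_def)
    then have "AE x in L. ennreal \<bar>u x\<bar> * V x \<noteq> \<infinity>" by (intro nn_integral_PInf_AE) measurable
    then show ?thesis by eventually_elim (auto simp: ennreal_mult_top split: if_splits)
  qed
  have "\<exists>\<psi>. \<psi> \<in> cap_test \<Omega> Z \<and> V_norm \<Omega> V \<psi> < ennreal ((1 / 2) ^ k)" for k
  proof -
    have "(INF \<psi>\<in>cap_test \<Omega> Z. V_norm \<Omega> V \<psi>) < ennreal ((1 / 2) ^ k)" using cap by (simp add: Cap_def)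
    then show ?thesis unfolding INF_less_iff by blast
  qed
  then obtain \<psi> where \<psi>: "\<And>k. \<psi> k \<in> cap_test \<Omega> Z" "\<And>k. V_norm \<Omega> V (\<psi> k) < ennreal ((1 / 2) ^ k)" by metis
  have \<psi>01: "0 \<le> \<psi> k x" "\<psi> k x \<le> 1" if "x \<in> \<Omega>" for k x using \<psi>(1)[of k] that by (auto simp: cap_test_def)
  have \<psi>C2: "C2_on \<Omega> (\<psi> k)" for k using \<psi>(1)[of k] by (auto simp: cap_test_def C2_compact_def)
  have \<psi>m [measurable]: "\<psi> k \<in> borel_measurable L" for k
    unfolding L_def using \<Omega> \<psi>C2[of k]
    by (intro continuous_imp_measurable_on_sets_lebesgue) (auto simp: C2_on_def intro: C1_on_continuous)
  have \<psi>i: "(\<integral>\<^sup>+x. ennreal (norm (\<psi> k x)) \<partial>L) \<le> ennreal ((1 / 2) ^ k)" for k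
    using V_norm_small(1)[OF \<psi>(2)] by (simp add: L_def)
  have \<psi>int: "integrable L (\<psi> k)" for k
    using le_less_trans[OF \<psi>i[of k] ennreal_less_top] by (intro integrableI_bounded) auto
  have "(\<lambda>k. LINT x|L. norm (\<psi> k x)) \<longlonglongrightarrow> 0"
  proof (rule tendsto_sandwich[of "\<lambda>k. 0" _ _ "\<lambda>k. (1 / 2) ^ k"])
    show "eventually (\<lambda>k. (LINT x|L. norm (\<psi> k x)) \<le> (1 / 2) ^ k) sequentially"
    proof (intro always_eventually allI)
      fix k
      have "ennreal (LINT x|L. norm (\<psi> k x)) \<le> ennreal ((1 / 2) ^ k)"
        using \<psi>i[of k] \<psi>int[of k] by (subst nn_integral_eq_integral[symmetric]) auto
      then show "(LINT x|L. norm (\<psi> k x)) \<le> (1 / 2) ^ k" by (simp add: ennreal_le_iff)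
    qed
  qed (auto intro: LIMSEQ_realpow_zero)
  then obtain r where r: "strict_mono r" "AE x in L. (\<lambda>k. \<psi> (r k) x) \<longlonglongrightarrow> 0"
    using tendsto_L1_AE_subseq[where u = \<psi>, OF \<psi>int] by blast
  define e where "e k = (1 / 2 :: real) ^ r k" for k
  have e: "0 \<le> e k" "e k \<le> 1" for k by (auto simp: e_def power_le_one)
  have e_lim: "e \<longlonglongrightarrow> 0"
    using LIMSEQ_subseq_LIMSEQ[OF LIMSEQ_realpow_zero[of "1 / 2"] r(1)] by (simp add: e_def[abs_def] o_def)
  note bounds = C2_compact_support_bounds[OF \<phi>(1) K(1) \<phi>(2)]
  obtain B where B: "B \<ge> 1" "\<And>x. \<bar>\<phi> x\<bar> \<le> B" "\<And>x. norm (grad \<phi> x) \<le> B" "\<And>x. \<bar>laplacian \<phi> x\<bar> \<le> B"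
    using bounds(6) by blast
  have off: "grad \<phi> x = 0" "laplacian \<phi> x = 0" if "x \<notin> K" for x using bounds(4)[of x] bounds(5)[of x] that by auto
  define \<Psi> where "\<Psi> k x = \<psi> (r k) x * \<phi> x" for k x
  have \<phi>\<Omega>: "C2_on \<Omega> \<phi>" using \<phi>(1) by (rule C2_on_subset_UNIV)
  have \<Psi>0: "\<Psi> k x = 0" if "x \<notin> K" for k x using \<phi>(2)[OF that] by (simp add: \<Psi>_def)
  have \<Psi>\<Omega>: "C2_on \<Omega> (\<Psi> k)" for k unfolding \<Psi>_def[abs_def] by (rule C2_on_mult[OF \<Omega> \<psi>C2 \<phi>\<Omega>])
  have \<Psi>C2: "C2_on UNIV (\<Psi> k)" for k by (rule C2_on_extend_zero[OF \<Omega> K \<Psi>\<Omega> \<Psi>0])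
  note \<Psi>b = C2_compact_support_bounds[OF \<Psi>C2 K(1) \<Psi>0]
  have \<Psi>m: "\<Psi> k \<in> borel_measurable L" "laplacian (\<Psi> k) \<in> borel_measurable L" "(\<lambda>x. grad (\<Psi> k) x $ i) \<in> borel_measurable L" for k i
    unfolding L_def using \<Psi>b(1-3)[of k]
    by (auto intro!: borel_imp_lebesgue_on borel_measurable_continuous_onI continuous_intros)
  define s where "s k x = u x * (- laplacian (\<Psi> k) x - U x \<bullet> grad (\<Psi> k) x + enn2real (V x) * \<Psi> k x)" for k x
  have s_eq: "(LINT x|L. s k x) = signed_integral (restrict_space borel \<Omega>) f (\<Psi> k)" for k
    using eq C2_zeroI[OF \<Omega> K \<Psi>C2 \<Psi>0, of k] by (simp add: solves_eq_def s_def L_def)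
  have sm: "s k \<in> borel_measurable L" for k
    unfolding s_def[abs_def] using \<Psi>m[of k] measurable_inner_components[of U L "grad (\<Psi> k)"]
    by (intro borel_measurable_times borel_measurable_add borel_measurable_diff borel_measurable_uminus) auto
  define D where "D x = B * (3 * \<bar>u x\<bar> + \<bar>u x * norm (U x)\<bar> + 5 * \<bar>u x * enn2real (V x)\<bar> + \<bar>u x * (norm (U x))\<^sup>2 * indicat_real K x\<bar>)" for x
  have Di: "integrable L D"
    unfolding D_def using u uU uVi uU2
    by (intro integrable_mult_right Bochner_Integration.integrable_add integrable_abs) (auto simp: L_def)
  have D0: "D x \<ge> 0" for x unfolding D_def using B(1) by (intro mult_nonneg_nonneg add_nonneg_nonneg) auto
  have s_bound: "AE x in L. \<bar>s k x\<bar> \<le> (\<psi> (r k) x + e k) * D x" for k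
  proof -
    have "AE x in L. V x < \<infinity> \<longrightarrow> norm (grad (\<psi> (r k)) x) \<le> e k * sqrt (enn2real (V x)) \<and> \<bar>laplacian (\<psi> (r k)) x\<bar> \<le> e k * enn2real (V x)"
      unfolding L_def e_def by (rule V_norm_small(2)[OF \<psi>(2)]) simp
    then show ?thesis using uinf AE_space
    proof eventually_elim
      case (elim x)
      have x: "x \<in> \<Omega>" using elim(3) by (simp add: L_def space_restrict_space)
      show ?case
      proof (cases "u x = 0 \<or> x \<notin> K")
        case True
        then have "s k x = 0"
          using \<Psi>b(4)[of x k] \<Psi>b(5)[of x k] \<Psi>0[of x k] by (auto simp: s_def)
        then show ?thesis using D0[of x] e(1)[of k] \<psi>01[OF x, of "r k"] by (simp add: add_nonneg_nonneg)
      next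
        case False
        then have fin: "V x < \<infinity>" using elim(2) by (auto simp: less_top)
        have lap: "laplacian (\<Psi> k) x = \<psi> (r k) x * laplacian \<phi> x + 2 * (grad (\<psi> (r k)) x \<bullet> grad \<phi> x) + \<phi> x * laplacian (\<psi> (r k)) x"
          unfolding \<Psi>_def[abs_def] by (rule laplacian_mult[OF \<Omega> x \<psi>C2 \<phi>\<Omega>])
        have gr: "grad (\<Psi> k) x = \<psi> (r k) x *\<^sub>R grad \<phi> x + \<phi> x *\<^sub>R grad (\<psi> (r k)) x"
          unfolding \<Psi>_def[abs_def] by (rule grad_mult[OF C2_on_differentiable[OF \<psi>C2 x] C2_on_differentiable[OF \<phi>\<Omega> x]])
        have "\<bar>s k x\<bar> \<le> \<bar>u x\<bar> * ((\<psi> (r k) x + e k) * (B * (3 + norm (U x) + 5 * enn2real (V x) + (norm (U x))\<^sup>2)))"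
          unfolding s_def abs_mult lap gr unfolding \<Psi>_def
          by (intro mult_left_mono cutoff_integrand_bound) (use \<psi>01[OF x] e B elim(1) fin in auto)
        also have "\<dots> = (\<psi> (r k) x + e k) * D x"
          using False by (simp add: D_def abs_mult algebra_simps)
        finally show ?thesis .
      qed
    qed
  qed
  have "(\<lambda>k. LINT x|L. s k x) \<longlonglongrightarrow> integral\<^sup>L L (\<lambda>x :: real ^ 'n. 0 :: real)"
  proof (rule Bochner_Integration.integral_dominated_convergence[where w = "\<lambda>x. 2 * D x"])
    show "integrable L (\<lambda>x. 2 * D x)" using Di by simp
    show "AE x in L. norm (s k x) \<le> 2 * D x" for k
      using s_bound[of k] AE_space
    proof eventually_elim
      case (elim x)
      have x: "x \<in> \<Omega>" using elim(2) by (simp add: L_def space_restrict_space)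
      have "(\<psi> (r k) x + e k) * D x \<le> 2 * D x" using \<psi>01[OF x, of "r k"] e[of k] D0[of x] by (intro mult_right_mono) auto
      then show ?case using elim(1) by simp
    qed
    have "AE x in L. \<forall>k. \<bar>s k x\<bar> \<le> (\<psi> (r k) x + e k) * D x" using s_bound by (simp add: AE_all_countable)
    then show "AE x in L. (\<lambda>k. s k x) \<longlonglongrightarrow> 0" using r(2)
    proof eventually_elim
      case (elim x)
      have "(\<lambda>k. (\<psi> (r k) x + e k) * D x) \<longlonglongrightarrow> (0 + 0) * D x" by (intro tendsto_intros elim(2) e_lim)
      then have "(\<lambda>k. (\<psi> (r k) x + e k) * D x) \<longlonglongrightarrow> 0" by simp
      then show ?case by (rule Lim_null_comparison[rotated]) (use elim(1) in auto)
    qed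
  qed (use sm in auto)
  then have "(\<lambda>k. signed_integral (restrict_space borel \<Omega>) f (\<Psi> k)) \<longlonglongrightarrow> 0" by (simp add: s_eq)
  from tendstoD[OF this \<epsilon>] obtain k where "\<bar>signed_integral (restrict_space borel \<Omega>) f (\<Psi> k)\<bar> < \<epsilon>"
    by (auto simp: eventually_sequentially dist_real_def)
  then show ?thesis using \<psi>(1) by (auto simp: \<Psi>_def[abs_def])
qed


section \<open>Nonexistence of solutions\<close>

theorem theorem12:
  fixes \<Omega> :: "(real ^ 'n) set"
    and U :: "real ^ 'n \<Rightarrow> real ^ 'n"
    and V :: "real ^ 'n \<Rightarrow> ennreal"
    and f :: "(real ^ 'n) set \<Rightarrow> real"
    and p :: real
  assumes "CARD('n) \<ge> 2"
    and "open \<Omega>" and "connected \<Omega>" and "\<Omega> \<noteq> {}" and "bounded \<Omega>" and "C11_boundary \<Omega>"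
    and "p > real CARD('n)"
    and "\<And>i. (\<lambda>x. U x $ i) \<in> lorentz_space \<Omega> p"
    and "div_free_tangential \<Omega> U"
    and "potential \<Omega> V"
    and "compact (irregular_points \<Omega> V)"
    and "Cap \<Omega> V (irregular_points \<Omega> V) = 0"
    and "bounded_radon_measure \<Omega> f"
    and "\<exists>\<omega>. open \<omega> \<and> \<omega> \<inter> support \<Omega> f = support \<Omega> f \<inter> irregular_points \<Omega> V"
    and "total_var (restrict_space borel \<Omega>) f (irregular_points \<Omega> V) > 0"
  shows "\<not> (\<exists>u. u \<in> L1_weighted \<Omega> V \<inter> L1_zero \<Omega> \<and> solves_eq \<Omega> U V f u)"
proof
  assume "\<exists>u. u \<in> L1_weighted \<Omega> V \<inter> L1_zero \<Omega> \<and> solves_eq \<Omega> U V f u"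
  then obtain u where uV: "u \<in> L1_weighted \<Omega> V" and u: "integrable (lebesgue_on \<Omega>) u" and eq: "solves_eq \<Omega> U V f u"
    by (auto simp: L1_zero_def)
  define M where "M = restrict_space borel \<Omega>"
  define Z where "Z = irregular_points \<Omega> V"
  note fin = finite_upper_measure[OF assms(13), folded M_def]
  obtain \<omega> where \<omega>: "open \<omega>" "\<omega> \<inter> support \<Omega> f = support \<Omega> f \<inter> Z" using assms(14) by (auto simp: Z_def)
  define T where "T = \<omega> \<inter> \<Omega>"
  have T: "open T" "T \<subseteq> \<Omega>" using \<omega> assms(2) by (auto simp: T_def)
  have V: "V \<in> borel_measurable (lebesgue_on \<Omega>)" using assms(10) by (simp add: potential_def)
  have Um: "(\<lambda>x. U x $ i) \<in> borel_measurable (lebesgue_on \<Omega>)" for i using assms(8) by (simp add: lorentz_space_def)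
  have Z\<Omega>: "Z \<subseteq> \<Omega>" by (auto simp: Z_def irregular_points_def)
  have setsM: "A \<in> sets M \<longleftrightarrow> A \<in> sets borel \<and> A \<subseteq> \<Omega>" for A
    unfolding M_def using assms(2) by (subst sets_restrict_space_iff) auto
  have ZM: "Z \<in> sets M" using assms(11) Z\<Omega> by (simp add: setsM Z_def borel_closed compact_imp_closed)
  have spaceM: "space (upper_measure M g) = \<Omega>" for g
    unfolding space_upper_measure by (simp add: M_def space_restrict_space)
  note null = complement_of_support_null[OF assms(2,13), folded M_def]
  have AE_support: "AE x in upper_measure M f. x \<in> support \<Omega> f" "AE x in lower_measure M f. x \<in> support \<Omega> f"
    by (rule AE_I'[OF null(1)], use spaceM in blast, rule AE_I'[OF null(2)], use spaceM in blast)
  have zero: "signed_integral M f \<phi> = 0"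
    if \<phi>: "C2_on UNIV \<phi>" and K: "compact K" "K \<subseteq> T" and 0: "\<And>x. x \<notin> K \<Longrightarrow> \<phi> x = 0" for \<phi> K
  proof -
    have K\<Omega>: "K \<subseteq> \<Omega>" using K T by blast
    have loc: "(\<integral>\<^sup>+x\<in>K. ennreal (\<bar>u x\<bar> * (norm (U x))\<^sup>2) \<partial>lebesgue_on \<Omega>) < \<infinity>"
      by (rule drift_square_integrable[OF assms(1,2,5,7,8,13) V uV u eq K(1) K\<Omega>])
    have cut: "signed_integral M f (\<lambda>x. \<psi> x * \<phi> x) = signed_integral M f \<phi>" if \<psi>: "\<psi> \<in> cap_test \<Omega> Z" for \<psi>
    proof -
      have one: "\<psi> x * \<phi> x = \<phi> x" if x: "x \<in> support \<Omega> f" for x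
      proof (cases "x \<in> \<omega>")
        case True
        then have "x \<in> Z" using x \<omega>(2) by blast
        then have "\<psi> x = 1" using \<psi> Z\<Omega> by (auto simp: cap_test_def)
        then show ?thesis by simp
      next
        case False
        then have "x \<notin> K" using K(2) by (auto simp: T_def)
        then show ?thesis using 0 by simp
      qed
      have \<psi>C2: "C2_on \<Omega> \<psi>" using \<psi> by (auto simp: cap_test_def C2_compact_def)
      have "C2_on UNIV (\<lambda>x. \<psi> x * \<phi> x)"
        by (rule C2_on_extend_zero[OF assms(2) K(1) K\<Omega> C2_on_mult[OF assms(2) \<psi>C2 C2_on_subset_UNIV[OF \<phi>]]]) (simp add: 0)
      then have m: "(\<lambda>x. \<psi> x * \<phi> x) \<in> borel_measurable borel" "\<phi> \<in> borel_measurable borel"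
        using \<phi> by (auto simp: C2_on_def intro!: borel_measurable_continuous_onI intro: C1_on_continuous)
      have mM: "h \<in> borel_measurable (upper_measure M g)" if "h \<in> borel_measurable borel" for h :: "real ^ 'n \<Rightarrow> real" and g
        by (subst measurable_cong_sets[OF sets_upper_measure refl]) (use that in \<open>auto simp: M_def intro: measurable_restrict_space1\<close>)
      have "(LINT x|upper_measure M f. \<psi> x * \<phi> x) = (LINT x|upper_measure M f. \<phi> x)"
        by (rule integral_cong_AE[OF mM[OF m(1)] mM[OF m(2)]]) (use AE_support(1) one in \<open>auto elim: eventually_mono\<close>)
      moreover have "(LINT x|lower_measure M f. \<psi> x * \<phi> x) = (LINT x|lower_measure M f. \<phi> x)"
        by (rule integral_cong_AE[OF mM[OF m(1)] mM[OF m(2)]]) (use AE_support(2) one in \<open>auto elim: eventually_mono\<close>)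
      ultimately show ?thesis by (simp add: signed_integral_def)
    qed
    have "\<bar>signed_integral M f \<phi>\<bar> < \<epsilon>" if \<epsilon>: "\<epsilon> > 0" for \<epsilon>
      using capacity_cutoff_limit[OF assms(2) Um V uV u eq assms(12) K(1) K\<Omega> \<phi> 0 loc \<epsilon>] cut
      by (auto simp: Z_def M_def)
    then show ?thesis by (metis abs_le_zero_iff less_irrefl not_le)
  qed
  have fT: "f B = 0" if "B \<in> sets M" "B \<subseteq> T" for B
    by (rule test_functions_separate_signed_measure[OF assms(2,13) T])
      (use zero that in \<open>auto simp: M_def\<close>)
  have "emeasure (upper_measure M g) Z = 0"
    if g: "signed_measure M g" "\<Omega> - support \<Omega> f \<in> null_sets (upper_measure M g)" "\<And>B. B \<in> sets M \<Longrightarrow> B \<subseteq> T \<Longrightarrow> g B = 0" for g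
  proof -
    have TM: "Z \<inter> T \<in> sets M" using ZM T by (auto simp: setsM)
    have "upper_var M g (Z \<inter> T) = 0" unfolding upper_var_def using g(3) by (auto intro!: antisym SUP_least)
    then have "Z \<inter> T \<in> null_sets (upper_measure M g)"
      using TM by (simp add: null_sets_def emeasure_upper_measure[OF g(1) TM])
    moreover have "Z \<subseteq> (Z \<inter> T) \<union> (\<Omega> - support \<Omega> f)" using \<omega>(2) Z\<Omega> by (auto simp: T_def)
    ultimately have "Z \<in> null_sets (upper_measure M g)"
      using null_sets_subset[OF null_sets.Un[OF _ g(2)]] ZM by (simp only: sets_upper_measure)
    then show ?thesis by auto
  qed
  from this[OF fin(3) null(1)] this[OF fin(4) null(2)] fT
  have "total_var M f Z = 0"
    by (simp add: total_var_def emeasure_upper_measure[OF fin(3) ZM] emeasure_upper_measure[OF fin(4) ZM])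
  then show False using assms(15) by (simp add: M_def Z_def)
qed

end
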